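(* There exists a constant $C>0$, independent of $h$ and $N$, such that the following holds. For every mesh size $h>0$ and every $N\in\mathbb N$ satisfying, with $\tau=T/N$, the CFL-condition $$\frac{\tau}{h}\le c_{cfl}:=\frac{\sqrt{\nu_-}}{\sqrt2\,c_{inv}},$$ and for every $\nu_h\in\mathcal V_{ad}$, the unique solution $(\{p_h^l\}_{l=0}^N,\{\boldsymbol u_h^{l+\frac12}\}_{l=0}^{N-1})\in(P_{1,D}^h)^{N+1}\times(\mathbf{DG}_0^h)^N$ of the leapfrog scheme associated with $\nu_h$ satisfies $$\max_{0\le l\le N-1}\|\delta p_h^{l+\frac12}\|_{L^2(\Omega)}+\max_{1\le l\le N-1}\|\delta\boldsymbol u_h^l\|_{\boldsymbol L^2(\Omega)}+\max_{1\le l\le N-1}\|\nabla p_h^l\|_{\boldsymbol L^2(\Omega)}\le C$$ and $$\max_{0\le l\le N}\|p_h^l\|_{L^2(\Omega)}+\max_{0\le l\le N-1}\|\boldsymbol u_h^{l+\frac12}\|_{\boldsymbol L^2(\Omega)}\le C.$$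
   Context: Data. $\Omega\subset\mathbb R^d$ ($d\ge2$) is a bounded polyhedral Lipschitz domain, $\partial\Omega=\Gamma_N\cup\Gamma_D$ with $\Gamma_D\subsetneq\partial\Omega$ closed and $\Gamma_N=\partial\Omega\setminus\Gamma_D$ satisfying $|\Gamma_N|\neq0$. $I=[0,T]$, $T>0$. $\boldsymbol L^2(\Omega)$ is the space of $\mathbb R^d$-valued $L^2$ functions. $C^\infty_D(\Omega)=\{v|_\Omega: v\in C^\infty(\mathbb R^d),\ \mathrm{dist}(\mathrm{supp}\,v,\Gamma_D)>0\}$ and $H^1_D(\Omega)$ is its closure in $H^1(\Omega)$. Given are $p_0\in H^1_D(\Omega)$, $p_1\in L^\infty(\Omega)$, $f\in L^1(I,L^2(\Omega))$, a nonnegative $\eta\in L^\infty(\Omega)$, and reals $0<\nu_-\le\nu_+$. Put $F(t)=\int_0^t f(s)\,ds$ and $\mathcal V_{ad}=\{\nu\in L^2(\Omega):\nu_-\le\nu(x)\le\nu_+\text{ for a.e. }x\in\Omega\}$. Discretization. $\{\mathcal T_h\}_{h>0}$ is a quasi-uniform family of triangulations of $\Omega$, $h$ being the largest element diameter of $\mathcal T_h$, such that every boundary face of every element is contained either in $\Gamma_D$ or in $\overline{\Gamma_N}$. $P_1^h$ is the space of continuous functions on $\overline\Omega$ that are affine on every element, $P_{1,D}^h=\{\phi_h\in P_1^h:\phi_h=0\text{ on }\Gamma_D\}=P_1^h\cap H^1_D(\Omega)$, and $\mathbf{DG}_0^h$ is the space of $\mathbb R^d$-valued functions that are constant on every element.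 $c_{inv}>0$ is a constant independent of $h$ with $\|\nabla p_h\|_{\boldsymbol L^2(\Omega)}\le\frac{c_{inv}}h\|p_h\|_{L^2(\Omega)}$ for all $p_h\in P_1^h$ (the standard inverse estimate). For $N\in\mathbb N$: $\tau=T/N$, $t_l=l\tau$, $t_{l+\frac12}=t_l+\frac\tau2$, $F^{l+\frac12}=F(t_{l+\frac12})$. $\Psi_h:H^1_D(\Omega)\to P_{1,D}^h$ is the $H^1(\Omega)$-orthogonal projection: $(\Psi_hp,\phi_h)_{H^1(\Omega)}=(p,\phi_h)_{H^1(\Omega)}$ for all $\phi_h\in P_{1,D}^h$, with $(u,v)_{H^1(\Omega)}=\int_\Omega\nabla u\cdot\nabla v+uv\,dx$. $\Phi_h:L^\infty(\Omega)\to\mathbf{DG}_0^h$ is $\Phi_h(\nu)=\nabla y_h$, where $y_h\in P_{1,D}^h$ is the unique solution of $\int_\Omega\nabla y_h\cdot\nabla\phi_h\,dx=\int_\Omega(\eta p_0+\nu p_1)\phi_h\,dx$ for all $\phi_h\in P_{1,D}^h$. Notation: $\delta p_h^{l+\frac12}=\frac{p_h^{l+1}-p_h^l}\tau$ and $p_h^{l+\frac12}=\frac{p_h^{l+1}+p_h^l}2$ for $l=0,\dots,N-1$; $\delta\boldsymbol u_h^l=\frac{\boldsymbol u_h^{l+\frac12}-\boldsymbol u_h^{l-\frac12}}\tau$ for $l=1,\dots,N-1$. Maxima over empty index sets are $0$. Leapfrog scheme associated with $\nu_h\in\mathcal V_{ad}$ (it has a unique solution): find $\{p_h^l\}_{l=0}^N\subset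 P_{1,D}^h$, $\{\boldsymbol u_h^{l+\frac12}\}_{l=0}^{N-1}\subset\mathbf{DG}_0^h$ with $$\int_\Omega(\nu_h\delta p_h^{l+\frac12}+\eta p_h^{l+\frac12})\phi_h-\boldsymbol u_h^{l+\frac12}\cdot\nabla\phi_h\,dx=\int_\Omega F^{l+\frac12}\phi_h\,dx\quad\forall\phi_h\in P_{1,D}^h,\ l=0,\dots,N-1,$$ $$\delta\boldsymbol u_h^l+\nabla p_h^l=0\quad\forall l=1,\dots,N-1,\qquad p_h^0=\Psi_hp_0,\quad\boldsymbol u_h^{\frac12}=\Phi_h(\nu_h).$$ *)

theory Defs
  imports "HOL-Analysis.Analysis"
begin

text \<open>
  Elements of Lebesgue and Sobolev spaces on a set \<open>\<Omega>\<close> are represented by total functions; only their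
  values almost everywhere in \<open>\<Omega>\<close> matter, and equality of such elements is equality almost
  everywhere with respect to \<^term>\<open>lebesgue_on \<Omega>\<close>.
\<close>

section \<open>Domains and surface measure\<close>

text \<open>
  Locally, after a rigid motion, a Lipschitz domain is the part strictly above the graph of a
  Lipschitz function of the coordinates orthogonal to a unit vector \<open>e\<close>.
\<close>

definition lipschitz_boundary :: "'a::euclidean_space set \<Rightarrow> bool" where
  "lipschitz_boundary \<Omega> \<longleftrightarrow>
     (\<forall>x\<in>frontier \<Omega>. \<exists>U e g L. open U \<and> x \<in> U \<and> norm e = 1 \<and> L-lipschitz_on UNIV g \<and>
        (\<forall>z\<in>U. z \<in> \<Omega> \<longleftrightarrow> (g (z - (z \<bullet> e) *\<^sub>R e) :: real) < z \<bullet> e))"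

definition polyhedral_lipschitz_domain :: "'a::euclidean_space set \<Rightarrow> bool" where
  "polyhedral_lipschitz_domain \<Omega> \<longleftrightarrow>
     open \<Omega> \<and> connected \<Omega> \<and> \<Omega> \<noteq> {} \<and> bounded \<Omega> \<and> lipschitz_boundary \<Omega> \<and>
     (\<exists>P. finite P \<and> (\<forall>S\<in>P. polytope S) \<and> closure \<Omega> = \<Union>P)"

text \<open>
  The \<open>s\<close>-dimensional Hausdorff (outer) measure without its normalising constant, which is
  irrelevant for whether a set has measure zero. The surface measure of subsets of the boundary is
  the case \<open>s = d - 1\<close>.
\<close>

definition hausdorff_measure :: "real \<Rightarrow> 'a::metric_space set \<Rightarrow> ennreal" where
  "hausdorff_measure s A =
     (SUP \<delta>\<in>{0<..}. INF U\<in>{U :: nat \<Rightarrow> 'a set. A \<subseteq> (\<Union>i. U i) \<and>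
                                  (\<forall>i. bounded (U i) \<and> diameter (U i) \<le> \<delta>)}.
        \<Sum>i. ennreal (diameter (U i) powr s))"

section \<open>Function spaces\<close>

definition L2 :: "'a::euclidean_space set \<Rightarrow> ('a \<Rightarrow> 'b::euclidean_space) set" where
  "L2 \<Omega> = {v \<in> borel_measurable (lebesgue_on \<Omega>). integrable (lebesgue_on \<Omega>) (\<lambda>x. (norm (v x))\<^sup>2)}"

definition L2_norm :: "'a::euclidean_space set \<Rightarrow> ('a \<Rightarrow> 'b::euclidean_space) \<Rightarrow> real" where
  "L2_norm \<Omega> v = sqrt (LINT x|lebesgue_on \<Omega>. (norm (v x))\<^sup>2)"

definition Linfty :: "'a::euclidean_space set \<Rightarrow> ('a \<Rightarrow> real) set" where
  "Linfty \<Omega> = {v \<in> borel_measurable (lebesgue_on \<Omega>). \<exists>c. AE x in lebesgue_on \<Omega>. \<bar>v x\<bar> \<le> c}"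

primrec Ck :: "nat \<Rightarrow> ('a::euclidean_space \<Rightarrow> real) \<Rightarrow> bool" where
  "Ck 0 v \<longleftrightarrow> continuous_on UNIV v"
| "Ck (Suc k) v \<longleftrightarrow> (\<exists>G. (\<forall>x. GDERIV v x :> G x) \<and> (\<forall>b\<in>Basis. Ck k (\<lambda>x. G x \<bullet> b)))"

definition smooth :: "('a::euclidean_space \<Rightarrow> real) \<Rightarrow> bool" where
  "smooth v \<longleftrightarrow> (\<forall>k. Ck k v)"

definition supp :: "('a::euclidean_space \<Rightarrow> real) \<Rightarrow> 'a set" where
  "supp v = closure {x. v x \<noteq> 0}"

definition test_function :: "'a::euclidean_space set \<Rightarrow> ('a \<Rightarrow> real) \<Rightarrow> bool" where
  "test_function \<Omega> \<phi> \<longleftrightarrow> smooth \<phi> \<and> compact (supp \<phi>) \<and> supp \<phi> \<subseteq> \<Omega>"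

definition weak_gradient :: "'a::euclidean_space set \<Rightarrow> ('a \<Rightarrow> real) \<Rightarrow> ('a \<Rightarrow> 'a) \<Rightarrow> bool" where
  "weak_gradient \<Omega> v G \<longleftrightarrow> G \<in> L2 \<Omega> \<and>
     (\<forall>\<phi> D. test_function \<Omega> \<phi> \<and> (\<forall>x. GDERIV \<phi> x :> D x) \<longrightarrow>
        (LINT x|lebesgue_on \<Omega>. v x *\<^sub>R D x) = - (LINT x|lebesgue_on \<Omega>. \<phi> x *\<^sub>R G x))"

text \<open>The weak gradient is unique only almost everywhere; \<open>grad\<close> picks a representative.\<close>

definition grad :: "'a::euclidean_space set \<Rightarrow> ('a \<Rightarrow> real) \<Rightarrow> 'a \<Rightarrow> 'a" where
  "grad \<Omega> v = (SOME G. weak_gradient \<Omega> v G)"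

definition H1 :: "'a::euclidean_space set \<Rightarrow> ('a \<Rightarrow> real) set" where
  "H1 \<Omega> = {v \<in> L2 \<Omega>. \<exists>G. weak_gradient \<Omega> v G}"

definition H1_inner :: "'a::euclidean_space set \<Rightarrow> ('a \<Rightarrow> real) \<Rightarrow> ('a \<Rightarrow> real) \<Rightarrow> real" where
  "H1_inner \<Omega> v w = (LINT x|lebesgue_on \<Omega>. grad \<Omega> v x \<bullet> grad \<Omega> w x + v x * w x)"

definition H1_norm :: "'a::euclidean_space set \<Rightarrow> ('a \<Rightarrow> real) \<Rightarrow> real" where
  "H1_norm \<Omega> v = sqrt (H1_inner \<Omega> v v)"

text \<open>
  The distance condition is spelled out because the library function \<^const>\<open>setdist\<close> is \<open>0\<close>, rather
  than infinite, when one of the sets is empty.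
\<close>

definition CinfD :: "'a::euclidean_space set \<Rightarrow> ('a \<Rightarrow> real) set" where
  "CinfD \<Gamma>D = {v. smooth v \<and> (\<exists>\<delta>>0. \<forall>x\<in>supp v. \<forall>y\<in>\<Gamma>D. \<delta> \<le> dist x y)}"

definition H1D :: "'a::euclidean_space set \<Rightarrow> 'a set \<Rightarrow> ('a \<Rightarrow> real) set" where
  "H1D \<Omega> \<Gamma>D = {v \<in> H1 \<Omega>. \<forall>\<epsilon>>0. \<exists>w\<in>CinfD \<Gamma>D. H1_norm \<Omega> (\<lambda>x. v x - w x) < \<epsilon>}"

definition Vad :: "'a::euclidean_space set \<Rightarrow> real \<Rightarrow> real \<Rightarrow> ('a \<Rightarrow> real) set" where
  "Vad \<Omega> \<nu>m \<nu>p = {\<nu> \<in> L2 \<Omega>. AE x in lebesgue_on \<Omega>. \<nu>m \<le> \<nu> x \<and> \<nu> x \<le> \<nu>p}"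

section \<open>Bochner integration of functions with values in \<open>L2 \<Omega>\<close>\<close>

text \<open>
  The elements of \<^term>\<open>L2 \<Omega>\<close> do not form a type, so the library's Bochner integral does not apply. Its
  definition (\<^const>\<open>has_bochner_integral\<close>: approximation by simple functions) is repeated here with
  the seminorm \<^const>\<open>L2_norm\<close>.
\<close>

definition L2_simple :: "'a::euclidean_space set \<Rightarrow> (real \<Rightarrow> 'a \<Rightarrow> real) \<Rightarrow> bool" where
  "L2_simple \<Omega> s \<longleftrightarrow> (\<exists>n A g. (\<forall>k<n::nat. A k \<in> lmeasurable \<and> g k \<in> L2 \<Omega>) \<and>
     s = (\<lambda>t x. \<Sum>k<n. indicator (A k) t * g k x))"

definition L1_L2 :: "real set \<Rightarrow> 'a::euclidean_space set \<Rightarrow> (real \<Rightarrow> 'a \<Rightarrow> real) set" where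
  "L1_L2 J \<Omega> = {f. (\<forall>t\<in>J. f t \<in> L2 \<Omega>) \<and>
     (\<exists>s. (\<forall>i. L2_simple \<Omega> (s i)) \<and>
          (AE t in lebesgue_on J. (\<lambda>i. L2_norm \<Omega> (\<lambda>x. f t x - s i t x)) \<longlonglongrightarrow> 0)) \<and>
     (\<integral>\<^sup>+t. ennreal (L2_norm \<Omega> (f t)) \<partial>lebesgue_on J) < \<infinity>}"

definition has_L2_bochner_integral ::
    "'a::euclidean_space set \<Rightarrow> real set \<Rightarrow> (real \<Rightarrow> 'a \<Rightarrow> real) \<Rightarrow> ('a \<Rightarrow> real) \<Rightarrow> bool" where
  "has_L2_bochner_integral \<Omega> J f G \<longleftrightarrow> f \<in> L1_L2 J \<Omega> \<and> G \<in> L2 \<Omega> \<and>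
     (\<exists>s. (\<forall>i. L2_simple \<Omega> (s i)) \<and>
          (\<lambda>i. \<integral>\<^sup>+t. ennreal (L2_norm \<Omega> (\<lambda>x. f t x - s i t x)) \<partial>lebesgue_on J) \<longlonglongrightarrow> 0 \<and>
          (\<lambda>i. L2_norm \<Omega> (\<lambda>x. G x - (LINT t|lebesgue_on J. s i t x))) \<longlonglongrightarrow> 0)"

section \<open>Meshes and finite element spaces\<close>

text \<open>
  The library's \<^const>\<open>triangulation\<close> admits simplices of any dimension; the elements of a mesh are
  the full-dimensional ones. Boundary faces are the facets contained in the boundary of \<open>\<Omega>\<close>.
\<close>

definition mesh :: "'a::euclidean_space set \<Rightarrow> 'a set \<Rightarrow> 'a set set \<Rightarrow> real \<Rightarrow> bool" where
  "mesh \<Omega> \<Gamma>D M h \<longleftrightarrow>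
     triangulation M \<and> (\<forall>K\<in>M. int DIM('a) simplex K) \<and> \<Union>M = closure \<Omega> \<and>
     h = Max (diameter ` M) \<and>
     (\<forall>K\<in>M. \<forall>E. E facet_of K \<and> E \<subseteq> frontier \<Omega> \<longrightarrow>
        E \<subseteq> \<Gamma>D \<or> E \<subseteq> closure (frontier \<Omega> - \<Gamma>D))"

text \<open>
  Shape regularity (every element contains a ball of comparable radius) together with comparability
  of all element diameters to the mesh size.
\<close>

definition quasi_uniform :: "real set \<Rightarrow> (real \<Rightarrow> 'a::euclidean_space set set) \<Rightarrow> bool" where
  "quasi_uniform H \<T> \<longleftrightarrow>
     (\<exists>\<sigma>>0. \<forall>h\<in>H. \<forall>K\<in>\<T> h. (\<exists>z. cball z (\<sigma> * diameter K) \<subseteq> K) \<and> \<sigma> * h \<le> diameter K)"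

definition P1 :: "'a::euclidean_space set \<Rightarrow> 'a set set \<Rightarrow> ('a \<Rightarrow> real) set" where
  "P1 \<Omega> M = {\<phi>. continuous_on (closure \<Omega>) \<phi> \<and> (\<forall>K\<in>M. \<exists>a b. \<forall>x\<in>K. \<phi> x = a \<bullet> x + b)}"

definition P1D :: "'a::euclidean_space set \<Rightarrow> 'a set \<Rightarrow> 'a set set \<Rightarrow> ('a \<Rightarrow> real) set" where
  "P1D \<Omega> \<Gamma>D M = {\<phi> \<in> P1 \<Omega> M. \<forall>x\<in>\<Gamma>D. \<phi> x = 0}"

text \<open>
  Elements overlap in their (negligible) faces, where the values of a discontinuous function are
  immaterial; hence the interiors.
\<close>

definition DG0 :: "'a::euclidean_space set set \<Rightarrow> ('a \<Rightarrow> 'a) set" where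
  "DG0 M = {u. \<forall>K\<in>M. \<exists>c. \<forall>x\<in>interior K. u x = c}"

section \<open>The leapfrog scheme\<close>

text \<open>
  \<open>is_Psi\<close> renders \<open>q = \<Psi>\<^sub>h p\<close> and \<open>is_Phi\<close> renders \<open>u = \<Phi>\<^sub>h(\<nu>)\<close>. Both are relations because the values
  are determined only on \<^term>\<open>closure \<Omega>\<close> and almost everywhere in \<open>\<Omega>\<close>, respectively.
\<close>

definition is_Psi ::
    "'a::euclidean_space set \<Rightarrow> 'a set \<Rightarrow> 'a set set \<Rightarrow> ('a \<Rightarrow> real) \<Rightarrow> ('a \<Rightarrow> real) \<Rightarrow> bool" where
  "is_Psi \<Omega> \<Gamma>D M p q \<longleftrightarrow> q \<in> P1D \<Omega> \<Gamma>D M \<and> (\<forall>\<phi>\<in>P1D \<Omega> \<Gamma>D M. H1_inner \<Omega> q \<phi> = H1_inner \<Omega> p \<phi>)"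

definition is_Phi ::
    "'a::euclidean_space set \<Rightarrow> 'a set \<Rightarrow> 'a set set \<Rightarrow> ('a \<Rightarrow> real) \<Rightarrow> ('a \<Rightarrow> real) \<Rightarrow> ('a \<Rightarrow> real) \<Rightarrow>
     ('a \<Rightarrow> real) \<Rightarrow> ('a \<Rightarrow> 'a) \<Rightarrow> bool" where
  "is_Phi \<Omega> \<Gamma>D M \<eta> p0 p1 \<nu> u \<longleftrightarrow> u \<in> DG0 M \<and>
     (\<exists>y\<in>P1D \<Omega> \<Gamma>D M.
        (\<forall>\<phi>\<in>P1D \<Omega> \<Gamma>D M. (LINT x|lebesgue_on \<Omega>. grad \<Omega> y x \<bullet> grad \<Omega> \<phi> x) =
                        (LINT x|lebesgue_on \<Omega>. (\<eta> x * p0 x + \<nu> x * p1 x) * \<phi> x)) \<and>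
        (AE x in lebesgue_on \<Omega>. u x = grad \<Omega> y x))"

text \<open>
  \<open>p l\<close> is the value at the time level \<open>l\<close> and \<open>u l\<close> the value at the time level \<open>l + 1/2\<close>. Accordingly
  \<open>diff_p \<tau> p l\<close> and \<open>mean_p p l\<close> live at the level \<open>l + 1/2\<close>, and \<open>diff_u \<tau> u l\<close>, used for \<open>l \<ge> 1\<close> only, at
  the level \<open>l\<close>.
\<close>

definition diff_p :: "real \<Rightarrow> (nat \<Rightarrow> 'a \<Rightarrow> real) \<Rightarrow> nat \<Rightarrow> 'a \<Rightarrow> real" where
  "diff_p \<tau> p l = (\<lambda>x. (p (l + 1) x - p l x) / \<tau>)"

definition mean_p :: "(nat \<Rightarrow> 'a \<Rightarrow> real) \<Rightarrow> nat \<Rightarrow> 'a \<Rightarrow> real" where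
  "mean_p p l = (\<lambda>x. (p (l + 1) x + p l x) / 2)"

definition diff_u :: "real \<Rightarrow> (nat \<Rightarrow> 'a \<Rightarrow> 'a::real_vector) \<Rightarrow> nat \<Rightarrow> 'a \<Rightarrow> 'a" where
  "diff_u \<tau> u l = (\<lambda>x. (u l x - u (l - 1) x) /\<^sub>R \<tau>)"

definition leapfrog_solution ::
    "'a::euclidean_space set \<Rightarrow> 'a set \<Rightarrow> 'a set set \<Rightarrow> ('a \<Rightarrow> real) \<Rightarrow> ('a \<Rightarrow> real) \<Rightarrow> ('a \<Rightarrow> real) \<Rightarrow>
     (real \<Rightarrow> 'a \<Rightarrow> real) \<Rightarrow> real \<Rightarrow> nat \<Rightarrow> ('a \<Rightarrow> real) \<Rightarrow>
     (nat \<Rightarrow> 'a \<Rightarrow> real) \<Rightarrow> (nat \<Rightarrow> 'a \<Rightarrow> 'a) \<Rightarrow> bool" where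
  "leapfrog_solution \<Omega> \<Gamma>D M \<eta> p0 p1 F \<tau> N \<nu> p u \<longleftrightarrow>
     (\<forall>l\<le>N. p l \<in> P1D \<Omega> \<Gamma>D M) \<and> (\<forall>l<N. u l \<in> DG0 M) \<and>
     (\<forall>l<N. \<forall>\<phi>\<in>P1D \<Omega> \<Gamma>D M.
        (LINT x|lebesgue_on \<Omega>. (\<nu> x * diff_p \<tau> p l x + \<eta> x * mean_p p l x) * \<phi> x - u l x \<bullet> grad \<Omega> \<phi> x)
        = (LINT x|lebesgue_on \<Omega>. F (real l * \<tau> + \<tau> / 2) x * \<phi> x)) \<and>
     (\<forall>l. 1 \<le> l \<and> l \<le> N - 1 \<longrightarrow> (AE x in lebesgue_on \<Omega>. diff_u \<tau> u l x + grad \<Omega> (p l) x = 0)) \<and>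
     is_Psi \<Omega> \<Gamma>D M p0 (p 0) \<and> is_Phi \<Omega> \<Gamma>D M \<eta> p0 p1 \<nu> (u 0)"

definition max_over :: "nat set \<Rightarrow> (nat \<Rightarrow> real) \<Rightarrow> real" where
  "max_over A g = (if A = {} then 0 else Max (g ` A))"

end

theory Submission
  imports Defs
begin

text \<open>
  Subtracting two consecutive equations of the scheme and testing with the sum of the two difference
  quotients shows that the energy \<open>(\<nu> \<delta> l, \<delta> l) + (\<nabla> p (l + 1), \<nabla> p l)\<close>, with \<open>\<delta> l\<close> the difference quotient at the
  level \<open>l + 1/2\<close>, grows only through the increments of \<open>F\<close>, whose norms sum up to at most the norm of \<open>f\<close> in
  \<open>L\<^sup>1(I, L\<^sup>2(\<Omega>))\<close>. By the inverse estimate and the CFL condition the energy controls \<open>\<delta> l\<close> and the gradient of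
  \<open>(p (l + 1) + p l) / 2\<close>. The first equation, tested with \<open>\<delta> 0\<close>, bounds the initial energy, because the
  definition of \<open>\<Phi>\<^sub>h\<close> turns its flux term into the data.

  Only the bound of \<open>\<Phi>\<^sub>h(\<nu>)\<close> uses the geometry of the domain, through a Poincare inequality with a constant
  independent of \<open>h\<close>: it holds for smooth functions on convex sets, extends to the domain by chaining
  overlapping open sets, and passes to \<open>H\<^sup>1\<^sub>D\<close> by density. Either \<open>1\<close> is not in \<open>H\<^sup>1\<^sub>D\<close> and no constant has
  to be subtracted, or \<open>1\<close> is a test function and the data have mean zero.
\<close>

section \<open>Square integrable functions\<close>

lemma L2_D:
  assumes "v \<in> L2 \<Omega>"
  shows "v \<in> borel_measurable (lebesgue_on \<Omega>)" "integrable (lebesgue_on \<Omega>) (\<lambda>x. (norm (v x))\<^sup>2)"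
  using assms by (auto simp: L2_def)

lemma norm_mult_le_squares: "norm v * norm w \<le> norm ((norm v)\<^sup>2 + (norm w)\<^sup>2)"
proof -
  have "norm v * norm w \<le> (norm v)\<^sup>2 + (norm w)\<^sup>2"
    using sum_squares_bound[of "norm v" "norm w"] mult_nonneg_nonneg[OF norm_ge_zero[of v] norm_ge_zero[of w]]
    by linarith
  then show ?thesis by simp
qed

lemma L2_scaleR_integrable:
  fixes v :: "'a::euclidean_space \<Rightarrow> real" and w :: "'a \<Rightarrow> 'b::euclidean_space"
  assumes "v \<in> L2 \<Omega>" "w \<in> L2 \<Omega>"
  shows "integrable (lebesgue_on \<Omega>) (\<lambda>x. v x *\<^sub>R w x)"
proof (rule Bochner_Integration.integrable_bound)
  show "integrable (lebesgue_on \<Omega>) (\<lambda>x. (norm (v x))\<^sup>2 + (norm (w x))\<^sup>2)"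
    using L2_D[OF assms(1)] L2_D[OF assms(2)] by auto
  show "(\<lambda>x. v x *\<^sub>R w x) \<in> borel_measurable (lebesgue_on \<Omega>)"
    using L2_D[OF assms(1)] L2_D[OF assms(2)] by auto
  show "AE x in lebesgue_on \<Omega>. norm (v x *\<^sub>R w x) \<le> norm ((norm (v x))\<^sup>2 + (norm (w x))\<^sup>2)"
    by (simp only: norm_scaleR norm_mult_le_squares real_norm_def[symmetric]) simp
qed

lemma L2_inner_integrable:
  fixes v w :: "'a::euclidean_space \<Rightarrow> 'b::euclidean_space"
  assumes "v \<in> L2 \<Omega>" "w \<in> L2 \<Omega>"
  shows "integrable (lebesgue_on \<Omega>) (\<lambda>x. v x \<bullet> w x)"
proof (rule Bochner_Integration.integrable_bound)
  show "integrable (lebesgue_on \<Omega>) (\<lambda>x. (norm (v x))\<^sup>2 + (norm (w x))\<^sup>2)"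
    using L2_D[OF assms(1)] L2_D[OF assms(2)] by auto
  show "(\<lambda>x. v x \<bullet> w x) \<in> borel_measurable (lebesgue_on \<Omega>)"
    using L2_D[OF assms(1)] L2_D[OF assms(2)] by auto
  show "AE x in lebesgue_on \<Omega>. norm (v x \<bullet> w x) \<le> norm ((norm (v x))\<^sup>2 + (norm (w x))\<^sup>2)"
    by (intro AE_I2 order_trans[OF Cauchy_Schwarz_ineq2[folded real_norm_def] norm_mult_le_squares])
qed

lemma L2_mult_integrable:
  fixes v w :: "'a::euclidean_space \<Rightarrow> real"
  assumes "v \<in> L2 \<Omega>" "w \<in> L2 \<Omega>"
  shows "integrable (lebesgue_on \<Omega>) (\<lambda>x. v x * w x)"
  using L2_inner_integrable[OF assms] by (simp add: mult.commute)

lemma L2_bounded_mult: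
  fixes g :: "'a::euclidean_space \<Rightarrow> real" and v :: "'a \<Rightarrow> 'b::euclidean_space"
  assumes g: "g \<in> borel_measurable (lebesgue_on \<Omega>)" "AE x in lebesgue_on \<Omega>. \<bar>g x\<bar> \<le> c"
    and v: "v \<in> L2 \<Omega>"
  shows "(\<lambda>x. g x *\<^sub>R v x) \<in> L2 \<Omega>"
    and "c \<ge> 0 \<Longrightarrow> L2_norm \<Omega> (\<lambda>x. g x *\<^sub>R v x) \<le> c * L2_norm \<Omega> v"
proof -
  have le: "AE x in lebesgue_on \<Omega>. (norm (g x *\<^sub>R v x))\<^sup>2 \<le> c\<^sup>2 * (norm (v x))\<^sup>2"
    using g(2)
  proof eventually_elim
    case (elim x)
    have "norm (g x *\<^sub>R v x) \<le> c * norm (v x)"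
      using elim by (simp add: mult_right_mono)
    then show ?case
      by (metis norm_ge_zero power_mono power_mult_distrib)
  qed
  have int: "integrable (lebesgue_on \<Omega>) (\<lambda>x. c\<^sup>2 * (norm (v x))\<^sup>2)"
    using L2_D[OF v] by auto
  have int2: "integrable (lebesgue_on \<Omega>) (\<lambda>x. (norm (g x *\<^sub>R v x))\<^sup>2)"
    by (rule Bochner_Integration.integrable_bound[OF int]) (use le g L2_D[OF v] in \<open>auto simp: power_mult_distrib\<close>)
  show "(\<lambda>x. g x *\<^sub>R v x) \<in> L2 \<Omega>"
    using int2 g L2_D[OF v] by (auto simp: L2_def)
  assume "c \<ge> 0"
  have "(LINT x|lebesgue_on \<Omega>. (norm (g x *\<^sub>R v x))\<^sup>2) \<le> (LINT x|lebesgue_on \<Omega>. c\<^sup>2 * (norm (v x))\<^sup>2)"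
    by (rule integral_mono_AE[OF int2 int le])
  then have "L2_norm \<Omega> (\<lambda>x. g x *\<^sub>R v x) \<le> sqrt (c\<^sup>2 * (LINT x|lebesgue_on \<Omega>. (norm (v x))\<^sup>2))"
    by (simp add: L2_norm_def)
  also have "\<dots> = c * L2_norm \<Omega> v"
    using \<open>c \<ge> 0\<close> by (simp add: L2_norm_def real_sqrt_mult)
  finally show "L2_norm \<Omega> (\<lambda>x. g x *\<^sub>R v x) \<le> c * L2_norm \<Omega> v" .
qed

lemma L2_scaleR: "v \<in> L2 \<Omega> \<Longrightarrow> (\<lambda>x. c *\<^sub>R v x) \<in> L2 \<Omega>"
  by (rule L2_bounded_mult(1)[where c="\<bar>c\<bar>"]) auto

lemma L2_cmult: "v \<in> L2 \<Omega> \<Longrightarrow> (\<lambda>x. c * v x :: real) \<in> L2 \<Omega>"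
  using L2_scaleR[of v \<Omega> c] by simp

lemma L2_add:
  fixes v w :: "'a::euclidean_space \<Rightarrow> 'b::euclidean_space"
  assumes "v \<in> L2 \<Omega>" "w \<in> L2 \<Omega>"
  shows "(\<lambda>x. v x + w x) \<in> L2 \<Omega>"
proof -
  have "(\<lambda>x. (norm (v x + w x))\<^sup>2) = (\<lambda>x. (norm (v x))\<^sup>2 + 2 * (v x \<bullet> w x) + (norm (w x))\<^sup>2)"
    by (simp add: power2_norm_eq_inner inner_simps inner_commute algebra_simps fun_eq_iff)
  then show ?thesis
    using L2_D[OF assms(1)] L2_D[OF assms(2)] L2_inner_integrable[OF assms] by (auto simp: L2_def)
qed

lemma L2_diff: "v \<in> L2 \<Omega> \<Longrightarrow> w \<in> L2 \<Omega> \<Longrightarrow> (\<lambda>x. v x - w x) \<in> L2 \<Omega>"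
  using L2_add[OF _ L2_scaleR[of w \<Omega> "-1"], of v] by simp

lemma L2_zero: "(\<lambda>x. 0) \<in> L2 \<Omega>"
  by (simp add: L2_def)

lemma L2_sum:
  assumes "finite A" "\<And>k. k \<in> A \<Longrightarrow> v k \<in> L2 \<Omega>"
  shows "(\<lambda>x. \<Sum>k\<in>A. v k x) \<in> L2 \<Omega>"
  using assms by (induction A rule: finite_induct) (auto intro: L2_add simp: L2_zero)

lemma borel_measurable_lebesgue_on_cong_AE:
  fixes v w :: "'a::euclidean_space \<Rightarrow> 'b::euclidean_space"
  assumes "v \<in> borel_measurable (lebesgue_on \<Omega>)" "AE x in lebesgue_on \<Omega>. v x = w x" "\<Omega> \<in> sets lebesgue"
  shows "w \<in> borel_measurable (lebesgue_on \<Omega>)"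
proof -
  have "(\<lambda>x. if x \<in> \<Omega> then v x else 0) \<in> borel_measurable lebesgue"
    using assms(1,3) by (subst borel_measurable_if) auto
  moreover have "AE x in lebesgue. (if x \<in> \<Omega> then v x else 0) = (if x \<in> \<Omega> then w x else 0)"
    using assms(2,3) by (subst (asm) AE_restrict_space_iff) auto
  ultimately have "(\<lambda>x. if x \<in> \<Omega> then w x else 0) \<in> borel_measurable lebesgue"
    by (rule borel_measurable_AE)
  then show ?thesis
    using assms(3) by (subst (asm) borel_measurable_if) auto
qed

lemma L2_cong_AE:
  assumes "v \<in> L2 \<Omega>" "AE x in lebesgue_on \<Omega>. v x = w x" "\<Omega> \<in> sets lebesgue"
  shows "w \<in> L2 \<Omega>"
proof -
  have m: "w \<in> borel_measurable (lebesgue_on \<Omega>)"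
    by (rule borel_measurable_lebesgue_on_cong_AE[OF L2_D(1)[OF assms(1)] assms(2,3)])
  have "integrable (lebesgue_on \<Omega>) (\<lambda>x. (norm (w x))\<^sup>2)"
  proof (rule integrable_cong_AE_imp[OF L2_D(2)[OF assms(1)]])
    show "AE x in lebesgue_on \<Omega>. (norm (v x))\<^sup>2 = (norm (w x))\<^sup>2"
      using assms(2) by eventually_elim simp
  qed (use m in measurable)
  with m show ?thesis by (simp add: L2_def)
qed

lemma L2_norm_cong_AE:
  assumes "v \<in> borel_measurable (lebesgue_on \<Omega>)" "w \<in> borel_measurable (lebesgue_on \<Omega>)"
   "AE x in lebesgue_on \<Omega>. v x = w x"
  shows "L2_norm \<Omega> v = L2_norm \<Omega> w"
  unfolding L2_norm_def using assms
  by (intro arg_cong[where f=sqrt] integral_cong_AE) auto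

lemma L2_norm_nonneg [simp]: "0 \<le> L2_norm \<Omega> v"
  by (simp add: L2_norm_def)

lemma L2_norm_power2: "(L2_norm \<Omega> v)\<^sup>2 = (LINT x|lebesgue_on \<Omega>. v x \<bullet> v x)"
proof -
  have "0 \<le> (LINT x|lebesgue_on \<Omega>. (norm (v x))\<^sup>2)"
    by (intro integral_nonneg_AE) auto
  then show ?thesis
    by (simp only: L2_norm_def real_sqrt_pow2 power2_norm_eq_inner)
qed

lemma L2_norm_power2_real: "(L2_norm \<Omega> v)\<^sup>2 = (LINT x|lebesgue_on \<Omega>. v x * v x)"
  for v :: "'a::euclidean_space \<Rightarrow> real"
  using L2_norm_power2[of \<Omega> v] by simp

lemma L2_norm_scaleR: "L2_norm \<Omega> (\<lambda>x. c *\<^sub>R v x) = \<bar>c\<bar> * L2_norm \<Omega> v"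
  by (simp add: L2_norm_def power_mult_distrib real_sqrt_mult)

lemma L2_norm_cmult: "L2_norm \<Omega> (\<lambda>x. c * v x :: real) = \<bar>c\<bar> * L2_norm \<Omega> v"
  using L2_norm_scaleR[of \<Omega> c v] by simp

lemma L2_norm_minus_commute: "L2_norm \<Omega> (\<lambda>x. v x - w x) = L2_norm \<Omega> (\<lambda>x. w x - v x)"
  unfolding L2_norm_def by (subst norm_minus_commute) (rule refl)

lemma L2_Cauchy_Schwarz:
  fixes v w :: "'a::euclidean_space \<Rightarrow> 'b::euclidean_space"
  assumes v: "v \<in> L2 \<Omega>" and w: "w \<in> L2 \<Omega>"
  shows "\<bar>LINT x|lebesgue_on \<Omega>. v x \<bullet> w x\<bar> \<le> L2_norm \<Omega> v * L2_norm \<Omega> w"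
proof -
  let ?a = "LINT x|lebesgue_on \<Omega>. v x \<bullet> v x" and ?b = "LINT x|lebesgue_on \<Omega>. v x \<bullet> w x"
    and ?c = "LINT x|lebesgue_on \<Omega>. w x \<bullet> w x"
  note ints = L2_inner_integrable[OF v v] L2_inner_integrable[OF v w] L2_inner_integrable[OF w w]
  have q: "0 \<le> s\<^sup>2 * ?a + 2 * s * t * ?b + t\<^sup>2 * ?c" for s t
  proof -
    have "0 \<le> (LINT x|lebesgue_on \<Omega>. (s *\<^sub>R v x + t *\<^sub>R w x) \<bullet> (s *\<^sub>R v x + t *\<^sub>R w x))"
      by (intro integral_nonneg_AE) auto
    also have "\<dots> = (LINT x|lebesgue_on \<Omega>. s\<^sup>2 * (v x \<bullet> v x) + 2 * s * t * (v x \<bullet> w x) + t\<^sup>2 * (w x \<bullet> w x))"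
      by (intro Bochner_Integration.integral_cong refl)
        (simp add: inner_simps inner_commute algebra_simps power2_eq_square)
    also have "\<dots> = s\<^sup>2 * ?a + 2 * s * t * ?b + t\<^sup>2 * ?c"
      using ints by simp
    finally show ?thesis .
  qed
  have c0: "?c \<ge> 0" by (intro integral_nonneg_AE) auto
  have "?b\<^sup>2 \<le> ?a * ?c"
  proof (cases "?c = 0")
    case False
    have "0 \<le> ?c * (?a * ?c - ?b\<^sup>2)"
      using q[of ?c "- ?b"] by (simp add: algebra_simps power2_eq_square)
    then show ?thesis
      using c0 False by (simp add: zero_le_mult_iff)
  next
    case True
    have "?b = 0"
    proof (rule ccontr)
      assume "?b \<noteq> 0"
      then show False
        using q[of 1 "- (?a + 1) / (2 * ?b)"] True by (simp add: field_simps)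
    qed
    then show ?thesis using True by simp
  qed
  then have "\<bar>?b\<bar> \<le> sqrt (?a * ?c)"
    using real_le_rsqrt by fastforce
  then show ?thesis
    by (simp add: L2_norm_def power2_norm_eq_inner real_sqrt_mult)
qed

lemma L2_Cauchy_Schwarz_real:
  fixes v w :: "'a::euclidean_space \<Rightarrow> real"
  assumes v: "v \<in> L2 \<Omega>" and w: "w \<in> L2 \<Omega>"
  shows "\<bar>LINT x|lebesgue_on \<Omega>. v x * w x\<bar> \<le> L2_norm \<Omega> v * L2_norm \<Omega> w"
  using L2_Cauchy_Schwarz[OF assms] by (simp add: mult.commute)

lemma L2_norm_triangle:
  fixes v w :: "'a::euclidean_space \<Rightarrow> 'b::euclidean_space"
  assumes v: "v \<in> L2 \<Omega>" and w: "w \<in> L2 \<Omega>"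
  shows "L2_norm \<Omega> (\<lambda>x. v x + w x) \<le> L2_norm \<Omega> v + L2_norm \<Omega> w"
proof (rule power2_le_imp_le)
  note ints = L2_inner_integrable[OF v v] L2_inner_integrable[OF v w] L2_inner_integrable[OF w w]
  have "(L2_norm \<Omega> (\<lambda>x. v x + w x))\<^sup>2
      = (LINT x|lebesgue_on \<Omega>. v x \<bullet> v x + 2 * (v x \<bullet> w x) + w x \<bullet> w x)"
    unfolding L2_norm_power2
    by (intro Bochner_Integration.integral_cong refl) (simp add: inner_simps inner_commute)
  also have "\<dots> = (L2_norm \<Omega> v)\<^sup>2 + 2 * (LINT x|lebesgue_on \<Omega>. v x \<bullet> w x) + (L2_norm \<Omega> w)\<^sup>2"
    using ints by (simp add: L2_norm_power2)
  also have "\<dots> \<le> (L2_norm \<Omega> v + L2_norm \<Omega> w)\<^sup>2"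
    using L2_Cauchy_Schwarz[OF v w] by (simp add: power2_sum)
  finally show "(L2_norm \<Omega> (\<lambda>x. v x + w x))\<^sup>2 \<le> (L2_norm \<Omega> v + L2_norm \<Omega> w)\<^sup>2" .
qed simp

lemma L2_norm_triangle_diff:
  fixes v w :: "'a::euclidean_space \<Rightarrow> 'b::euclidean_space"
  assumes v: "v \<in> L2 \<Omega>" and w: "w \<in> L2 \<Omega>"
  shows "L2_norm \<Omega> v \<le> L2_norm \<Omega> w + L2_norm \<Omega> (\<lambda>x. v x - w x)"
  using L2_norm_triangle[OF w L2_diff[OF v w]] by simp

lemma L2_norm_triangle_minus:
  fixes v w :: "'a::euclidean_space \<Rightarrow> 'b::euclidean_space"
  assumes v: "v \<in> L2 \<Omega>" and w: "w \<in> L2 \<Omega>"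
  shows "L2_norm \<Omega> (\<lambda>x. v x - w x) \<le> L2_norm \<Omega> v + L2_norm \<Omega> w"
  using L2_norm_triangle[OF v L2_scaleR[OF w, of "-1"]] L2_norm_scaleR[of \<Omega> "-1" w] by simp

lemma bounded_in_L2:
  assumes "v \<in> borel_measurable (lebesgue_on \<Omega>)" "AE x in lebesgue_on \<Omega>. norm (v x) \<le> c" "\<Omega> \<in> lmeasurable"
  shows "v \<in> L2 \<Omega>"
proof -
  have fin: "finite_measure (lebesgue_on \<Omega>)"
    using assms(3) by (simp add: finite_measure_lebesgue_on)
  have "integrable (lebesgue_on \<Omega>) (\<lambda>x. (norm (v x))\<^sup>2)"
  proof (rule finite_measure.integrable_const_bound[OF fin, where B="c\<^sup>2"])
    show "AE x in lebesgue_on \<Omega>. norm ((norm (v x))\<^sup>2) \<le> c\<^sup>2"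
      using assms(2) by eventually_elim (simp add: power_mono)
  qed (use assms in auto)
  then show ?thesis using assms by (simp add: L2_def)
qed

lemma L2_imp_integrable:
  fixes v :: "'a::euclidean_space \<Rightarrow> 'b::euclidean_space"
  assumes "v \<in> L2 \<Omega>" "\<Omega> \<in> lmeasurable"
  shows "integrable (lebesgue_on \<Omega>) v"
proof (rule Bochner_Integration.integrable_bound)
  have fin: "finite_measure (lebesgue_on \<Omega>)"
    using assms(2) by (simp add: finite_measure_lebesgue_on)
  show "integrable (lebesgue_on \<Omega>) (\<lambda>x. 1 + (norm (v x))\<^sup>2)"
    by (intro Bochner_Integration.integrable_add finite_measure.integrable_const[OF fin] L2_D(2)[OF assms(1)])
  have "norm (v x) \<le> norm (1 + (norm (v x))\<^sup>2)" for x
  proof -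
    have "2 * norm (v x) \<le> 1 + (norm (v x))\<^sup>2"
      using sum_squares_bound[of 1 "norm (v x)"] by simp
    then have "norm (v x) \<le> 1 + (norm (v x))\<^sup>2"
      using norm_ge_zero[of "v x"] by linarith
    then show ?thesis by simp
  qed
  then show "AE x in lebesgue_on \<Omega>. norm (v x) \<le> norm (1 + (norm (v x))\<^sup>2)" by simp
qed (use assms in \<open>auto simp: L2_def\<close>)

section \<open>Smooth functions and weak gradients\<close>

lemma GDERIV_unique: "GDERIV f x :> D \<Longrightarrow> GDERIV f x :> D' \<Longrightarrow> D = D'"
  unfolding gderiv_def using has_derivative_unique[of f "\<lambda>h. h \<bullet> D" x "\<lambda>h. h \<bullet> D'"]
  by (metis vector_eq_ldot)

lemma GDERIV_isCont: "GDERIV f x :> D \<Longrightarrow> isCont f x"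
  unfolding gderiv_def by (rule has_derivative_continuous)

lemma Ck_imp_continuous: "Ck k v \<Longrightarrow> continuous_on UNIV v"
  by (cases k) (auto simp: continuous_on_eq_continuous_at intro: GDERIV_isCont)

lemma Ck_Suc_imp_Ck: "Ck (Suc k) v \<Longrightarrow> Ck k v"
proof (induction k arbitrary: v)
  case 0
  then show ?case using Ck_imp_continuous[of "Suc 0" v] by simp
next
  case (Suc k)
  then show ?case by (metis Ck.simps(2))
qed

lemma smooth_imp_C1:
  assumes "smooth v"
  obtains G where "\<And>x. GDERIV v x :> G x" "continuous_on UNIV G"
proof -
  have "Ck (Suc 0) v" using assms by (simp add: smooth_def)
  then obtain G where G: "\<And>x. GDERIV v x :> G x" "\<forall>b\<in>Basis. continuous_on UNIV (\<lambda>x. G x \<bullet> b)"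
    by auto
  have "continuous_on UNIV G"
    using G(2) by (subst continuous_on_componentwise) auto
  with G(1) show thesis by (rule that)
qed

lemma Ck_const: "Ck k (\<lambda>x::'a::euclidean_space. c)"
proof (induction k arbitrary: c)
  case (Suc k)
  have "\<forall>x::'a. GDERIV (\<lambda>x. c) x :> 0" by (simp add: GDERIV_const)
  moreover have "\<forall>b\<in>Basis. Ck k (\<lambda>x::'a. (0::'a) \<bullet> b)" using Suc[of 0] by simp
  ultimately show ?case unfolding Ck.simps by (intro exI[of _ "\<lambda>x::'a. 0::'a"] conjI)
qed simp

lemma Ck_add: "Ck k v \<Longrightarrow> Ck k w \<Longrightarrow> Ck k (\<lambda>x. v x + w x)"
proof (induction k arbitrary: v w)
  case 0
  then show ?case by (auto intro: continuous_intros)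
next
  case (Suc k)
  obtain G1 where G1: "\<forall>x. GDERIV v x :> G1 x" "\<forall>b\<in>Basis. Ck k (\<lambda>x. G1 x \<bullet> b)"
    using Suc.prems(1) by auto
  obtain G2 where G2: "\<forall>x. GDERIV w x :> G2 x" "\<forall>b\<in>Basis. Ck k (\<lambda>x. G2 x \<bullet> b)"
    using Suc.prems(2) by auto
  have "\<forall>x. GDERIV (\<lambda>x. v x + w x) x :> G1 x + G2 x"
    using G1 G2 by (auto intro: GDERIV_add)
  moreover have "\<forall>b\<in>Basis. Ck k (\<lambda>x. (G1 x + G2 x) \<bullet> b)"
    using Suc.IH G1 G2 by (simp add: inner_add_left)
  ultimately show ?case by (auto intro!: exI[of _ "\<lambda>x. G1 x + G2 x"])
qed

lemma Ck_mult: "Ck k v \<Longrightarrow> Ck k w \<Longrightarrow> Ck k (\<lambda>x. v x * w x)"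
proof (induction k arbitrary: v w)
  case 0
  then show ?case by (auto intro: continuous_intros)
next
  case (Suc k)
  obtain G1 where G1: "\<forall>x. GDERIV v x :> G1 x" "\<forall>b\<in>Basis. Ck k (\<lambda>x. G1 x \<bullet> b)"
    using Suc.prems(1) by auto
  obtain G2 where G2: "\<forall>x. GDERIV w x :> G2 x" "\<forall>b\<in>Basis. Ck k (\<lambda>x. G2 x \<bullet> b)"
    using Suc.prems(2) by auto
  have "\<forall>x. GDERIV (\<lambda>x. v x * w x) x :> v x *\<^sub>R G2 x + w x *\<^sub>R G1 x"
    using G1 G2 by (auto intro: GDERIV_mult)
  moreover have "\<forall>b\<in>Basis. Ck k (\<lambda>x. (v x *\<^sub>R G2 x + w x *\<^sub>R G1 x) \<bullet> b)"
    using Suc.IH G1 G2 Suc.prems[THEN Ck_Suc_imp_Ck] by (simp add: inner_add_left Ck_add)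
  ultimately show ?case by (auto intro!: exI[of _ "\<lambda>x. v x *\<^sub>R G2 x + w x *\<^sub>R G1 x"])
qed

lemma Ck_prod: "finite A \<Longrightarrow> (\<And>i. i \<in> A \<Longrightarrow> Ck k (v i)) \<Longrightarrow> Ck k (\<lambda>x. \<Prod>i\<in>A. v i x)"
  by (induction A rule: finite_induct) (auto intro: Ck_const Ck_mult)

lemma smooth_const: "smooth (\<lambda>x. c)"
  by (simp add: smooth_def Ck_const)

lemma smooth_cmult: "smooth v \<Longrightarrow> smooth (\<lambda>x. c * v x)"
  by (simp add: smooth_def Ck_const Ck_mult)

definition exp_bump :: "real poly \<Rightarrow> real \<Rightarrow> real" where
  "exp_bump p s = (if s > 0 then poly p (1 / s) * exp (- (1 / s)) else 0)"

lemma exp_bump_tendsto_0: "(exp_bump p \<longlongrightarrow> 0) (at 0)"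
proof (rule filterlim_split_at)
  show "(exp_bump p \<longlongrightarrow> 0) (at_left 0)"
    by (rule tendsto_eventually) (auto simp: eventually_at_filter exp_bump_def)
  have "((\<lambda>y. \<Sum>i\<le>degree p. coeff p i * (y ^ i / exp y)) \<longlongrightarrow> (\<Sum>i\<le>degree p. coeff p i * 0)) at_top"
    by (intro tendsto_intros tendsto_power_div_exp_0)
  then have "((\<lambda>y. poly p y * exp (- y)) \<longlongrightarrow> 0) at_top"
    by (simp add: poly_altdef sum_distrib_right exp_minus divide_inverse mult.assoc)
  from filterlim_compose[OF this filterlim_inverse_at_top_right]
  show "(exp_bump p \<longlongrightarrow> 0) (at_right 0)"
    by (rule Lim_transform_eventually)
      (auto simp: eventually_at_right_field exp_bump_def inverse_eq_divide intro!: exI[of _ 1])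
qed

lemma exp_bump_DERIV: "DERIV (exp_bump p) s :> exp_bump ([:0, 0, 1:] * (p - pderiv p)) s"
proof -
  consider "s < 0" | "s = 0" | "s > 0" by linarith
  then show ?thesis
  proof cases
    case 1
    have "DERIV (\<lambda>_. 0::real) s :> 0" by simp
    then have "DERIV (exp_bump p) s :> 0"
      by (rule has_field_derivative_transform_within_open[of _ _ _ "{..<0}"]) (use 1 in \<open>auto simp: exp_bump_def\<close>)
    then show ?thesis using 1 by (simp add: exp_bump_def)
  next
    case 2
    have "((\<lambda>h. (exp_bump p (0 + h) - exp_bump p 0) / h) \<longlongrightarrow> 0) (at 0)"
    proof (rule Lim_transform_eventually[OF exp_bump_tendsto_0[of "[:0, 1:] * p"]])
      show "\<forall>\<^sub>F h in at 0. exp_bump ([:0, 1:] * p) h = (exp_bump p (0 + h) - exp_bump p 0) / h"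
        by (auto simp: eventually_at_filter exp_bump_def)
    qed
    then show ?thesis using 2 by (simp add: DERIV_def exp_bump_def)
  next
    case 3
    have "DERIV (\<lambda>s. poly p (1 / s) * exp (- (1 / s))) s :> exp_bump ([:0, 0, 1:] * (p - pderiv p)) s"
      using 3 by (auto intro!: derivative_eq_intros DERIV_chain2[OF poly_DERIV]
          simp: exp_bump_def field_simps power2_eq_square)
    then show ?thesis
      by (rule has_field_derivative_transform_within_open[of _ _ _ "{0<..}"]) (use 3 in \<open>auto simp: exp_bump_def\<close>)
  qed
qed

lemma GDERIV_affine: "GDERIV (\<lambda>x. a * (x \<bullet> b) + c) x :> a *\<^sub>R b"
  unfolding gderiv_def by (auto intro!: derivative_eq_intros)

lemma Ck_exp_bump_affine: "Ck k (\<lambda>x. exp_bump p (a * (x \<bullet> b) + c))"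
proof (induction k arbitrary: p)
  case 0
  have "continuous_on UNIV (exp_bump p)"
    using exp_bump_DERIV DERIV_isCont by (metis continuous_at_imp_continuous_on)
  then have "continuous_on UNIV (exp_bump p \<circ> (\<lambda>x. a * (x \<bullet> b) + c))"
    by (intro continuous_on_compose) (auto intro!: continuous_intros intro: continuous_on_subset)
  then show ?case by (simp add: o_def)
next
  case (Suc k)
  let ?q = "[:0, 0, 1:] * (p - pderiv p)"
  have "\<forall>x. GDERIV (\<lambda>x. exp_bump p (a * (x \<bullet> b) + c)) x :> exp_bump ?q (a * (x \<bullet> b) + c) *\<^sub>R a *\<^sub>R b"
    by (intro allI GDERIV_DERIV_compose GDERIV_affine exp_bump_DERIV)
  moreover have "\<forall>b'\<in>Basis. Ck k (\<lambda>x. (exp_bump ?q (a * (x \<bullet> b) + c) *\<^sub>R a *\<^sub>R b) \<bullet> b')"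
    unfolding inner_scaleR_left by (intro ballI Ck_mult Suc.IH Ck_const)
  ultimately show ?case
    unfolding Ck.simps by (intro exI conjI)
qed

text \<open>As \<open>n\<close> tends to infinity, these test functions increase to the indicator function of \<open>box l u\<close>.\<close>

definition box_bump :: "'a::euclidean_space \<Rightarrow> 'a \<Rightarrow> nat \<Rightarrow> 'a \<Rightarrow> real" where
  "box_bump l u n x = (\<Prod>b\<in>Basis. exp_bump 1 (real n * (x \<bullet> b) + - (real n * (l \<bullet> b))) *
                                exp_bump 1 (- real n * (x \<bullet> b) + real n * (u \<bullet> b)))"

lemma exp_bump_1_bounds: "0 \<le> exp_bump 1 s" "exp_bump 1 s \<le> 1"
  by (auto simp: exp_bump_def)

lemma smooth_box_bump: "smooth (box_bump l u n)"
  unfolding smooth_def box_bump_def by (intro allI Ck_prod Ck_mult Ck_exp_bump_affine finite_Basis)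

lemma box_bump_bounds: "0 \<le> box_bump l u n x" "box_bump l u n x \<le> 1"
  unfolding box_bump_def
  by (auto intro!: prod_nonneg prod_le_1 mult_le_one simp: exp_bump_1_bounds)

lemma box_bump_eq_0:
  assumes "x \<notin> box l u"
  shows "box_bump l u n x = 0"
proof -
  obtain b where b: "b \<in> Basis" "x \<bullet> b \<le> l \<bullet> b \<or> u \<bullet> b \<le> x \<bullet> b"
    using assms by (auto simp: mem_box not_less)
  then have "real n * (x \<bullet> b) \<le> real n * (l \<bullet> b) \<or> real n * (u \<bullet> b) \<le> real n * (x \<bullet> b)"
    by (auto intro: mult_left_mono)
  then have "exp_bump 1 (real n * (x \<bullet> b) + - (real n * (l \<bullet> b))) *
             exp_bump 1 (- real n * (x \<bullet> b) + real n * (u \<bullet> b)) = 0"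
    by (auto simp: exp_bump_def)
  then show ?thesis
    unfolding box_bump_def using b(1) by (intro prod_zero) auto
qed

lemma box_bump_tendsto:
  fixes x :: "'a::euclidean_space"
  assumes "x \<in> box l u"
  shows "(\<lambda>n. box_bump l u n x) \<longlonglongrightarrow> 1"
proof -
  have *: "(\<lambda>n. exp_bump 1 (real n * d)) \<longlonglongrightarrow> 1" if "d > 0" for d
  proof -
    have "(\<lambda>n. exp (- (1 / real n * (1 / d)))) \<longlonglongrightarrow> exp (- (0 * (1 / d)))"
      by (intro tendsto_intros lim_1_over_n)
    then have "(\<lambda>n. exp (- (1 / real n * (1 / d)))) \<longlonglongrightarrow> 1" by simp
    then show ?thesis
      by (rule Lim_transform_eventually)
        (use that in \<open>auto simp: exp_bump_def intro!: eventually_sequentiallyI[of 1]\<close>)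
  qed
  have "(\<lambda>n. box_bump l u n x) \<longlonglongrightarrow> (\<Prod>b\<in>(Basis::'a set). 1 * 1)"
    unfolding box_bump_def
  proof (intro tendsto_prod tendsto_mult)
    fix b :: 'a assume b: "b \<in> Basis"
    show "(\<lambda>n. exp_bump 1 (real n * (x \<bullet> b) + - (real n * (l \<bullet> b)))) \<longlonglongrightarrow> 1"
      using *[of "x \<bullet> b - l \<bullet> b"] assms b by (auto simp: mem_box algebra_simps)
    show "(\<lambda>n. exp_bump 1 (- real n * (x \<bullet> b) + real n * (u \<bullet> b))) \<longlonglongrightarrow> 1"
      using *[of "u \<bullet> b - x \<bullet> b"] assms b by (auto simp: mem_box algebra_simps)
  qed
  then show ?thesis by simp
qed

lemma test_function_box_bump:
  assumes "cbox l u \<subseteq> \<Omega>"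
  shows "test_function \<Omega> (box_bump l u n)"
proof -
  have "supp (box_bump l u n) \<subseteq> cbox l u"
    unfolding supp_def
  proof (rule closure_minimal)
    show "{x. box_bump l u n x \<noteq> 0} \<subseteq> cbox l u"
      using box_bump_eq_0[of _ l u n] box_subset_cbox[of l u] by blast
  qed (rule closed_cbox)
  moreover have "compact (supp (box_bump l u n))"
    using calculation by (metis bounded_cbox bounded_subset closed_closure compact_eq_bounded_closed supp_def)
  ultimately show ?thesis
    using assms by (auto simp: test_function_def smooth_box_bump)
qed

lemma fundamental_lemma:
  fixes G :: "'a::euclidean_space \<Rightarrow> 'b::euclidean_space"
  assumes \<Omega>: "open \<Omega>" and G: "integrable (lebesgue_on \<Omega>) G"
    and zero: "\<And>\<phi>. test_function \<Omega> \<phi> \<Longrightarrow> (LINT x|lebesgue_on \<Omega>. \<phi> x *\<^sub>R G x) = 0"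
  shows "AE x in lebesgue_on \<Omega>. G x = 0"
proof -
  have \<Omega>l: "\<Omega> \<in> sets lebesgue" using \<Omega> by auto
  define g where "g = (\<lambda>x. indicator \<Omega> x *\<^sub>R G x)"
  have g: "integrable lebesgue g"
    using G \<Omega>l by (simp add: g_def integrable_restrict_space)
  have box0: "integral (cbox l u) g = 0" if "cbox l u \<subseteq> \<Omega>" for l u
  proof -
    have "(\<lambda>n. LINT x|lebesgue. box_bump l u n x *\<^sub>R g x) \<longlonglongrightarrow> (LINT x|lebesgue. indicator (box l u) x *\<^sub>R g x)"
    proof (rule integral_dominated_convergence[where w="\<lambda>x. norm (g x)"])
      show "(\<lambda>x. indicator (box l u) x *\<^sub>R g x) \<in> borel_measurable lebesgue"
        using g by (intro borel_measurable_scaleR borel_measurable_indicator) auto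
      show "(\<lambda>x. box_bump l u n x *\<^sub>R g x) \<in> borel_measurable lebesgue" for n
      proof (intro borel_measurable_scaleR)
        have "continuous_on UNIV (box_bump l u n)"
          using smooth_box_bump[of l u n] Ck_imp_continuous by (auto simp: smooth_def)
        then show "box_bump l u n \<in> borel_measurable lebesgue"
          by (intro measurable_completion) (auto intro: borel_measurable_continuous_onI)
      qed (use g in auto)
      show "integrable lebesgue (\<lambda>x. norm (g x))" using g by auto
      show "AE x in lebesgue. (\<lambda>n. box_bump l u n x *\<^sub>R g x) \<longlonglongrightarrow> indicator (box l u) x *\<^sub>R g x"
      proof (intro AE_I2 tendsto_scaleR tendsto_const)
        show "(\<lambda>n. box_bump l u n x) \<longlonglongrightarrow> indicator (box l u) x" for x
          using box_bump_tendsto[of x l u] box_bump_eq_0[of x l u] by (cases "x \<in> box l u") auto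
      qed
      show "AE x in lebesgue. norm (box_bump l u n x *\<^sub>R g x) \<le> norm (g x)" for n
        using box_bump_bounds[of l u n] by (auto intro!: AE_I2 mult_left_le_one_le)
    qed
    moreover have "(LINT x|lebesgue. box_bump l u n x *\<^sub>R g x) = 0" for n
    proof -
      have "(LINT x|lebesgue. box_bump l u n x *\<^sub>R g x) = (LINT x|lebesgue_on \<Omega>. box_bump l u n x *\<^sub>R G x)"
        using \<Omega>l by (subst integral_restrict_space)
          (auto simp: g_def intro!: Bochner_Integration.integral_cong)
      then show ?thesis using zero[OF test_function_box_bump[OF that]] by simp
    qed
    ultimately have "(LINT x|lebesgue. indicator (box l u) x *\<^sub>R g x) = 0"
      using LIMSEQ_unique[of "\<lambda>n. 0"] by auto
    then have "(LINT x|lebesgue_on (box l u). g x) = 0"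
      by (subst integral_restrict_space) auto
    moreover have "integrable (lebesgue_on (box l u)) g"
      using g by (subst integrable_restrict_space) (auto intro: integrable_mult_indicator)
    ultimately have "integral (box l u) g = 0"
      by (simp add: lebesgue_integral_eq_integral)
    then show ?thesis by (simp add: integral_open_interval)
  qed
  have "g integrable_on cbox a b" for a b
    using integrable_on_subcbox[OF integrable_on_lebesgue[OF g]] by simp
  then obtain N where N: "negligible N"
     "\<And>x e. \<lbrakk>x \<notin> N; 0 < e\<rbrakk> \<Longrightarrow> \<exists>d>0. \<forall>h. 0 < h \<and> h < d \<longrightarrow>
               norm (integral (cbox x (x + h *\<^sub>R One)) g /\<^sub>R h ^ DIM('a) - g x) < e"
    using integrable_ccontinuous_explicit[of g] by metis
  have "G x = 0" if x: "x \<in> \<Omega>" "x \<notin> N" for x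
  proof (rule ccontr)
    assume "G x \<noteq> 0"
    then obtain d where d: "d > 0" "\<And>h. 0 < h \<and> h < d \<Longrightarrow>
          norm (integral (cbox x (x + h *\<^sub>R One)) g /\<^sub>R h ^ DIM('a) - g x) < norm (G x)"
      using N(2)[OF x(2), of "norm (G x)"] by auto
    obtain r where r: "r > 0" "ball x r \<subseteq> \<Omega>"
      using \<Omega> x by (auto simp: open_contains_ball)
    define h where "h = min (d/2) (r / (2 * DIM('a)))"
    have h: "0 < h" "h < d" "h * DIM('a) < r"
      using d r by (auto simp: h_def min_def field_simps)
    have "cbox x (x + h *\<^sub>R One) \<subseteq> \<Omega>"
    proof
      fix y assume y: "y \<in> cbox x (x + h *\<^sub>R One)"
      have "dist x y \<le> (\<Sum>b\<in>Basis. \<bar>(y - x) \<bullet> b\<bar>)"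
        unfolding dist_norm norm_minus_commute[of x] by (rule norm_le_l1)
      also have "\<dots> \<le> (\<Sum>b\<in>(Basis::'a set). h)"
        using y by (intro sum_mono) (auto simp: mem_box inner_simps)
      also have "\<dots> < r" using h by (simp add: mult.commute)
      finally show "y \<in> \<Omega>" using r by auto
    qed
    from box0[OF this] d(2)[of h] h x show False by (simp add: g_def)
  qed
  then have "AE x in lebesgue. x \<in> \<Omega> \<longrightarrow> G x = 0"
    using N(1) by (intro AE_I'[of N]) (auto simp: negligible_iff_null_sets)
  then show ?thesis using \<Omega>l by (subst AE_restrict_space_iff) auto
qed

lemma integral_gradient_eq_0:
  fixes \<psi> :: "'a::euclidean_space \<Rightarrow> real"
  assumes D: "\<And>x. GDERIV \<psi> x :> D x" and cont: "continuous_on UNIV D"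
    and outside: "\<And>x. x \<notin> cball 0 r \<Longrightarrow> \<psi> x = 0"
  shows "(LINT x|lborel. D x) = 0"
proof -
  have D0: "D x = 0" if "x \<notin> cball 0 r" for x
  proof -
    have "GDERIV (\<lambda>_. 0) x :> 0" by (rule GDERIV_const)
    moreover have "GDERIV (\<lambda>_. 0) x :> D x"
      unfolding gderiv_def
      by (rule has_derivative_transform_within_open[of \<psi> _ _ _ "- cball 0 r"])
        (use D[of x] that outside in \<open>auto simp: gderiv_def\<close>)
    ultimately show ?thesis by (metis GDERIV_unique)
  qed
  have "bounded (D ` cball 0 r)"
    by (intro compact_imp_bounded compact_continuous_image continuous_on_subset[OF cont]) auto
  then obtain M where M: "M > 0" "\<And>x. x \<in> cball 0 r \<Longrightarrow> norm (D x) \<le> M"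
    unfolding bounded_pos by blast
  have M': "norm (D x) \<le> M" for x
    using M D0 by (cases "x \<in> cball 0 r") auto
  have lip: "\<bar>\<psi> x - \<psi> y\<bar> \<le> M * norm (x - y)" for x y
  proof -
    have "norm (\<psi> x - \<psi> y) \<le> M * norm (x - y)"
    proof (rule differentiable_bound[of UNIV \<psi> "\<lambda>x h. h \<bullet> D x"])
      show "onorm (\<lambda>h. h \<bullet> D x) \<le> M" for x
      proof (rule onorm_le)
        show "norm (h \<bullet> D x) \<le> M * norm h" for h
          using Cauchy_Schwarz_ineq2[of h "D x"] mult_left_mono[OF M'[of x] norm_ge_zero[of h]]
          by (simp add: mult.commute)
      qed
    qed (use D in \<open>auto simp: gderiv_def\<close>)
    then show ?thesis by simp
  qed
  have \<psi>m: "\<psi> \<in> borel_measurable borel"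
    using D by (intro borel_measurable_continuous_onI) (auto simp: continuous_on_eq_continuous_at intro: GDERIV_isCont)
  have \<psi>i: "integrable lborel \<psi>"
  proof -
    have "integrable lborel (\<lambda>x. indicator (cball 0 r) x *\<^sub>R \<psi> x)"
      by (rule borel_integrable_compact) (use D in \<open>auto simp: continuous_on_eq_continuous_at
          intro!: continuous_at_imp_continuous_on intro: GDERIV_isCont\<close>)
    also have "(\<lambda>x. indicator (cball 0 r) x *\<^sub>R \<psi> x) = \<psi>"
      using outside by (auto simp: indicator_def fun_eq_iff)
    finally show ?thesis .
  qed
  have Di: "integrable lborel D"
  proof -
    have "integrable lborel (\<lambda>x. indicator (cball 0 r) x *\<^sub>R D x)"
      by (rule borel_integrable_compact) (use cont in \<open>auto intro: continuous_on_subset\<close>)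
    also have "(\<lambda>x. indicator (cball 0 r) x *\<^sub>R D x) = D"
      using D0 by (auto simp: indicator_def fun_eq_iff)
    finally show ?thesis .
  qed
  have "(LINT x|lborel. D x \<bullet> b) = 0" if b: "b \<in> Basis" for b
  proof -
    define s where "s n x = (\<psi> (x + (1 / real (Suc n)) *\<^sub>R b) - \<psi> x) * real (Suc n)" for n x
    have shift: "integrable lborel (\<lambda>x. \<psi> (x + c))" "(LINT x|lborel. \<psi> (x + c)) = (LINT x|lborel. \<psi> x)" for c
    proof -
      have d: "distr lborel borel ((+) c) = lborel" by (rule lborel_distr_plus)
      have "integrable (distr lborel borel ((+) c)) \<psi>" using \<psi>i d by simp
      then show "integrable lborel (\<lambda>x. \<psi> (x + c))"
        using \<psi>m by (subst (asm) integrable_distr_eq) (auto simp: add.commute)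
      have "(LINT x|lborel. \<psi> x) = (LINT x|distr lborel borel ((+) c). \<psi> x)" using d by simp
      also have "\<dots> = (LINT x|lborel. \<psi> (c + x))"
        using \<psi>m by (subst integral_distr) auto
      finally show "(LINT x|lborel. \<psi> (x + c)) = (LINT x|lborel. \<psi> x)" by (simp add: add.commute)
    qed
    have s0: "(LINT x|lborel. s n x) = 0" for n
      unfolding s_def using shift[of "(1 / real (Suc n)) *\<^sub>R b"] \<psi>i by simp
    have "(\<lambda>n. LINT x|lborel. s n x) \<longlonglongrightarrow> (LINT x|lborel. D x \<bullet> b)"
    proof (rule integral_dominated_convergence[where w="\<lambda>x. indicator (cball 0 (r + 1)) x *\<^sub>R M"])
      show "(\<lambda>x. D x \<bullet> b) \<in> borel_measurable lborel" using Di by auto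
      show "s n \<in> borel_measurable lborel" for n
        unfolding s_def using shift(1)[of "(1 / real (Suc n)) *\<^sub>R b"] \<psi>i by (auto intro!: borel_measurable_times)
      show "integrable lborel (\<lambda>x. indicator (cball (0::'a) (r + 1)) x *\<^sub>R M)"
        by (rule borel_integrable_compact) auto
      show "AE x in lborel. (\<lambda>n. s n x) \<longlonglongrightarrow> D x \<bullet> b"
      proof (rule AE_I2)
        fix x
        have "((\<lambda>t. x + t *\<^sub>R b) has_derivative (\<lambda>t. t *\<^sub>R b)) (at 0)"
          by (auto intro!: derivative_eq_intros)
        then have "((\<lambda>t. \<psi> (x + t *\<^sub>R b)) has_derivative (\<lambda>t. (t *\<^sub>R b) \<bullet> D x)) (at 0)"
          using D[of x] unfolding gderiv_def
          by (rule has_derivative_compose[where f="\<lambda>t. x + t *\<^sub>R b" and g=\<psi> and x=0 and s=UNIV, simplified])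
        then have "DERIV (\<lambda>t. \<psi> (x + t *\<^sub>R b)) 0 :> b \<bullet> D x"
          by (simp add: has_field_derivative_def mult_commute_abs)
        then have "((\<lambda>t. (\<psi> (x + t *\<^sub>R b) - \<psi> x) / t) \<longlongrightarrow> b \<bullet> D x) (at 0)"
          by (simp add: DERIV_def)
        moreover have "filterlim (\<lambda>n. 1 / real (Suc n)) (at 0) sequentially"
          unfolding filterlim_at using LIMSEQ_Suc[OF lim_1_over_n[where 'a=real]] by auto
        ultimately have "(\<lambda>n. (\<psi> (x + (1 / real (Suc n)) *\<^sub>R b) - \<psi> x) / (1 / real (Suc n))) \<longlonglongrightarrow> b \<bullet> D x"
          by (rule filterlim_compose)
        then show "(\<lambda>n. s n x) \<longlonglongrightarrow> D x \<bullet> b"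
          by (simp add: s_def inner_commute)
      qed
      show "AE x in lborel. norm (s n x) \<le> indicator (cball 0 (r + 1)) x *\<^sub>R M" for n
      proof (rule AE_I2)
        fix x
        let ?y = "x + (1 / real (Suc n)) *\<^sub>R b"
        have y: "norm (?y - x) = 1 / real (Suc n)" using b by simp
        show "norm (s n x) \<le> indicator (cball 0 (r + 1)) x *\<^sub>R M"
        proof (cases "x \<in> cball 0 (r + 1)")
          case True
          have "norm (s n x) = \<bar>\<psi> ?y - \<psi> x\<bar> * real (Suc n)" by (simp add: s_def abs_mult)
          also have "\<dots> \<le> (M * (1 / real (Suc n))) * real (Suc n)"
            using lip[of ?y x] y by (intro mult_right_mono) auto
          finally show ?thesis using True by simp
        next
          case False
          have "norm x \<le> norm ?y + norm (?y - x)"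
            using norm_triangle_ineq4[of ?y "?y - x"] by simp
          moreover have "1 / real (Suc n) \<le> 1" by simp
          ultimately have "norm ?y > r" using False y unfolding mem_cball_0 by linarith
          then have "\<psi> ?y = 0" "\<psi> x = 0" using False by (auto intro!: outside)
          then show ?thesis using False by (simp add: s_def)
        qed
      qed
    qed
    with s0 show ?thesis by (simp add: LIMSEQ_const_iff)
  qed
  then have "(LINT x|lborel. D x) \<bullet> b = 0" if "b \<in> Basis" for b
    using that integral_inner_left[of b lborel D] Di by simp
  then show ?thesis
    by (simp add: euclidean_eq_iff[where 'a='a])
qed

lemma test_function_outside:
  assumes "test_function \<Omega> \<phi>" "x \<notin> \<Omega>" "GDERIV \<phi> x :> D"
  shows "\<phi> x = 0" "D = 0"
proof -
  have x: "x \<notin> supp \<phi>" using assms by (auto simp: test_function_def)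
  have out: "\<phi> y = 0" if "y \<notin> supp \<phi>" for y
    using that closure_subset[of "{x. \<phi> x \<noteq> 0}"] by (auto simp: supp_def)
  show "\<phi> x = 0" using out x by simp
  have "GDERIV (\<lambda>_. 0) x :> D"
    unfolding gderiv_def
  proof (rule has_derivative_transform_within_open)
    show "(\<phi> has_derivative (\<lambda>h. h \<bullet> D)) (at x)" using assms(3) by (simp add: gderiv_def)
    show "open (- supp \<phi>)" by (simp add: supp_def open_Compl)
  qed (use x out in auto)
  from GDERIV_unique[OF this GDERIV_const] show "D = 0" .
qed

lemma test_function_gradient_continuous:
  assumes "test_function \<Omega> \<phi>" "\<And>x. GDERIV \<phi> x :> D x"
  shows "continuous_on UNIV \<phi>" "continuous_on UNIV D"
proof -
  obtain G where "\<And>x. GDERIV \<phi> x :> G x" "continuous_on UNIV G"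
    using assms(1) smooth_imp_C1 by (auto simp: test_function_def)
  moreover have "D = G" using assms(2) calculation(1) GDERIV_unique by blast
  ultimately show "continuous_on UNIV D" by simp
  show "continuous_on UNIV \<phi>"
    using assms(2) by (auto simp: continuous_on_eq_continuous_at intro: GDERIV_isCont)
qed

lemma continuous_in_L2:
  fixes v :: "'a::euclidean_space \<Rightarrow> 'b::euclidean_space"
  assumes "continuous_on UNIV v" "bounded \<Omega>" "open \<Omega>"
  shows "v \<in> L2 \<Omega>"
proof -
  have "bounded (v ` closure \<Omega>)"
    using assms by (intro compact_imp_bounded compact_continuous_image continuous_on_subset[OF assms(1)]) auto
  then obtain c where c: "\<And>x. x \<in> \<Omega> \<Longrightarrow> norm (v x) \<le> c"
    using closure_subset[of \<Omega>] unfolding bounded_iff by blast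
  show ?thesis
  proof (rule bounded_in_L2[where c=c])
    show "v \<in> borel_measurable (lebesgue_on \<Omega>)"
      using assms(1) by (intro measurable_restrict_space1 measurable_completion) (auto intro: borel_measurable_continuous_onI)
    show "AE x in lebesgue_on \<Omega>. norm (v x) \<le> c" using c by (intro AE_I2) auto
    show "\<Omega> \<in> lmeasurable" using assms by (simp add: lmeasurable_open)
  qed
qed

lemma weak_gradient_classical:
  fixes w :: "'a::euclidean_space \<Rightarrow> real"
  assumes \<Omega>: "open \<Omega>" "bounded \<Omega>"
    and D: "\<And>x. GDERIV w x :> D x" and cont: "continuous_on UNIV D"
  shows "weak_gradient \<Omega> w D"
  unfolding weak_gradient_def
proof (intro conjI allI impI)
  show DL2: "D \<in> L2 \<Omega>" by (rule continuous_in_L2) fact+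
  have wc: "continuous_on UNIV w"
    using D by (auto simp: continuous_on_eq_continuous_at intro: GDERIV_isCont)
  have wL2: "w \<in> L2 \<Omega>" by (rule continuous_in_L2) fact+
  fix \<phi> D' assume \<phi>: "test_function \<Omega> \<phi> \<and> (\<forall>x. GDERIV \<phi> x :> D' x)"
  have \<phi>c: "continuous_on UNIV \<phi>" "continuous_on UNIV D'"
    using \<phi> test_function_gradient_continuous by blast+
  obtain r where r: "\<Omega> \<subseteq> cball 0 r"
    using bounded_subset_ballD[OF \<Omega>(2), of 0] by (meson ball_subset_cball order_trans)
  let ?E = "\<lambda>x. w x *\<^sub>R D' x + \<phi> x *\<^sub>R D x"
  have "(LINT x|lborel. ?E x) = 0"
  proof (rule integral_gradient_eq_0)
    show "GDERIV (\<lambda>x. w x * \<phi> x) x :> ?E x" for x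
      using D \<phi> by (auto intro: GDERIV_mult)
    show "continuous_on UNIV ?E"
      by (intro continuous_intros wc \<phi>c cont)
    show "x \<notin> cball 0 r \<Longrightarrow> w x * \<phi> x = 0" for x
      using \<phi> test_function_outside(1)[of \<Omega> \<phi> x] r by (metis mult_zero_right subsetD)
  qed
  moreover have "(LINT x|lebesgue_on \<Omega>. ?E x) = (LINT x|lborel. ?E x)"
  proof -
    have E: "?E \<in> borel_measurable borel"
      by (intro borel_measurable_continuous_onI continuous_intros wc \<phi>c cont)
    have "(LINT x|lebesgue_on \<Omega>. ?E x) = (LINT x|lebesgue. indicator \<Omega> x *\<^sub>R ?E x)"
      using \<Omega>(1) by (subst integral_restrict_space) auto
    also have "\<dots> = (LINT x|lebesgue. ?E x)"
    proof (intro Bochner_Integration.integral_cong refl)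
      have "\<phi> x = 0 \<and> D' x = 0" if "x \<notin> \<Omega>" for x
        using \<phi> that test_function_outside[of \<Omega> \<phi> x "D' x"] by blast
      then show "indicator \<Omega> x *\<^sub>R ?E x = ?E x" for x
        by (cases "x \<in> \<Omega>") auto
    qed
    also have "\<dots> = (LINT x|lborel. ?E x)"
      using E by (subst integral_completion) auto
    finally show ?thesis .
  qed
  ultimately have "0 = (LINT x|lebesgue_on \<Omega>. ?E x)" by simp
  also have "\<dots> = (LINT x|lebesgue_on \<Omega>. w x *\<^sub>R D' x) + (LINT x|lebesgue_on \<Omega>. \<phi> x *\<^sub>R D x)"
  proof (rule Bochner_Integration.integral_add)
    have L: "\<Omega> \<in> lmeasurable" using \<Omega> by (simp add: lmeasurable_open)
    show "integrable (lebesgue_on \<Omega>) (\<lambda>x. w x *\<^sub>R D' x)"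
      by (intro L2_imp_integrable[OF _ L] continuous_in_L2 continuous_intros wc \<phi>c \<Omega>)
    show "integrable (lebesgue_on \<Omega>) (\<lambda>x. \<phi> x *\<^sub>R D x)"
      by (intro L2_imp_integrable[OF _ L] continuous_in_L2 continuous_intros cont \<phi>c \<Omega>)
  qed
  finally show "(LINT x|lebesgue_on \<Omega>. w x *\<^sub>R D' x) = - (LINT x|lebesgue_on \<Omega>. \<phi> x *\<^sub>R D x)"
    by (simp add: add_eq_0_iff)
qed

lemma weak_gradient_unique:
  assumes \<Omega>: "open \<Omega>" "bounded \<Omega>" and G: "weak_gradient \<Omega> v G" "weak_gradient \<Omega> v G'"
  shows "AE x in lebesgue_on \<Omega>. G x = G' x"
proof -
  have L: "G \<in> L2 \<Omega>" "G' \<in> L2 \<Omega>" using G by (auto simp: weak_gradient_def)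
  have "AE x in lebesgue_on \<Omega>. G x - G' x = 0"
  proof (rule fundamental_lemma[OF \<Omega>(1)])
    show "integrable (lebesgue_on \<Omega>) (\<lambda>x. G x - G' x)"
      using L \<Omega> by (intro L2_imp_integrable L2_diff) (auto simp: lmeasurable_open)
    fix \<phi> assume \<phi>: "test_function \<Omega> \<phi>"
    then obtain D where D: "\<And>x. GDERIV \<phi> x :> D x"
      using smooth_imp_C1[of \<phi>] unfolding test_function_def by metis
    have "continuous_on UNIV \<phi>" using \<phi> D by (rule test_function_gradient_continuous)
    note i = L2_scaleR_integrable[OF continuous_in_L2[OF this \<Omega>(2,1)]]
    have "(LINT x|lebesgue_on \<Omega>. \<phi> x *\<^sub>R G x) = (LINT x|lebesgue_on \<Omega>. \<phi> x *\<^sub>R G' x)"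
    proof -
      have "(LINT x|lebesgue_on \<Omega>. v x *\<^sub>R D x) = - (LINT x|lebesgue_on \<Omega>. \<phi> x *\<^sub>R G x)"
        using G(1) \<phi> D unfolding weak_gradient_def by blast
      moreover have "(LINT x|lebesgue_on \<Omega>. v x *\<^sub>R D x) = - (LINT x|lebesgue_on \<Omega>. \<phi> x *\<^sub>R G' x)"
        using G(2) \<phi> D unfolding weak_gradient_def by blast
      ultimately show ?thesis by (simp only: neg_equal_iff_equal)
    qed
    then show "(LINT x|lebesgue_on \<Omega>. \<phi> x *\<^sub>R (G x - G' x)) = 0"
      using i[OF L(1)] i[OF L(2)] by (simp add: scaleR_diff_right)
  qed
  then show ?thesis by eventually_elim simp
qed

lemma weak_gradient_add_scaleR:
  assumes \<Omega>: "open \<Omega>" "bounded \<Omega>" and "v \<in> L2 \<Omega>" "w \<in> L2 \<Omega>"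
    and G: "weak_gradient \<Omega> v G" "weak_gradient \<Omega> w G'"
  shows "weak_gradient \<Omega> (\<lambda>x. a * v x + b * w x) (\<lambda>x. a *\<^sub>R G x + b *\<^sub>R G' x)"
  unfolding weak_gradient_def
proof (intro conjI allI impI)
  have L: "G \<in> L2 \<Omega>" "G' \<in> L2 \<Omega>" using G by (auto simp: weak_gradient_def)
  then show "(\<lambda>x. a *\<^sub>R G x + b *\<^sub>R G' x) \<in> L2 \<Omega>" by (intro L2_add L2_scaleR)
  fix \<phi> D assume \<phi>: "test_function \<Omega> \<phi> \<and> (\<forall>x. GDERIV \<phi> x :> D x)"
  have c: "continuous_on UNIV \<phi>" "continuous_on UNIV D"
    using \<phi> test_function_gradient_continuous by blast+
  note i = L2_scaleR_integrable[OF continuous_in_L2[OF c(1) \<Omega>(2,1)]]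
  note j = L2_scaleR_integrable[OF _ continuous_in_L2[OF c(2) \<Omega>(2,1)]]
  have "(LINT x|lebesgue_on \<Omega>. (a * v x + b * w x) *\<^sub>R D x)
     = (LINT x|lebesgue_on \<Omega>. a *\<^sub>R (v x *\<^sub>R D x) + b *\<^sub>R (w x *\<^sub>R D x))"
    by (simp add: scaleR_add_left)
  also have "\<dots> = a *\<^sub>R (LINT x|lebesgue_on \<Omega>. v x *\<^sub>R D x) + b *\<^sub>R (LINT x|lebesgue_on \<Omega>. w x *\<^sub>R D x)"
    using j[OF assms(3)] j[OF assms(4)] by (simp del: scaleR_scaleR)
  also have "\<dots> = - (a *\<^sub>R (LINT x|lebesgue_on \<Omega>. \<phi> x *\<^sub>R G x) + b *\<^sub>R (LINT x|lebesgue_on \<Omega>. \<phi> x *\<^sub>R G' x))"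
    using G \<phi> by (simp add: weak_gradient_def)
  also have "a *\<^sub>R (LINT x|lebesgue_on \<Omega>. \<phi> x *\<^sub>R G x) + b *\<^sub>R (LINT x|lebesgue_on \<Omega>. \<phi> x *\<^sub>R G' x)
     = (LINT x|lebesgue_on \<Omega>. a *\<^sub>R (\<phi> x *\<^sub>R G x) + b *\<^sub>R (\<phi> x *\<^sub>R G' x))"
    using i[OF L(1)] i[OF L(2)] by (simp del: scaleR_scaleR)
  also have "\<dots> = (LINT x|lebesgue_on \<Omega>. \<phi> x *\<^sub>R (a *\<^sub>R G x + b *\<^sub>R G' x))"
    by (simp add: scaleR_add_right mult.commute)
  finally show "(LINT x|lebesgue_on \<Omega>. (a * v x + b * w x) *\<^sub>R D x)
      = - (LINT x|lebesgue_on \<Omega>. \<phi> x *\<^sub>R (a *\<^sub>R G x + b *\<^sub>R G' x))" .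
qed

lemma weak_gradient_grad: "v \<in> H1 \<Omega> \<Longrightarrow> weak_gradient \<Omega> v (grad \<Omega> v)"
  using someI_ex[of "weak_gradient \<Omega> v"] by (simp add: H1_def grad_def)

lemma H1_imp_L2: "v \<in> H1 \<Omega> \<Longrightarrow> v \<in> L2 \<Omega>"
  by (simp add: H1_def)

lemma grad_in_L2: "v \<in> H1 \<Omega> \<Longrightarrow> grad \<Omega> v \<in> L2 \<Omega>"
  using weak_gradient_grad by (auto simp: weak_gradient_def)

lemma grad_eq_AE:
  assumes "open \<Omega>" "bounded \<Omega>" "weak_gradient \<Omega> v G"
  shows "AE x in lebesgue_on \<Omega>. grad \<Omega> v x = G x"
  using weak_gradient_unique[OF assms(1,2) _ assms(3)] assms(3)
    someI[of "weak_gradient \<Omega> v" G] unfolding grad_def by blast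

lemma H1_lincomb:
  assumes "open \<Omega>" "bounded \<Omega>" "v \<in> H1 \<Omega>" "w \<in> H1 \<Omega>"
  shows "(\<lambda>x. a * v x + b * w x) \<in> H1 \<Omega>"
    and "AE x in lebesgue_on \<Omega>. grad \<Omega> (\<lambda>x. a * v x + b * w x) x = a *\<^sub>R grad \<Omega> v x + b *\<^sub>R grad \<Omega> w x"
proof -
  note wg = weak_gradient_add_scaleR[OF assms(1,2) H1_imp_L2 H1_imp_L2 weak_gradient_grad weak_gradient_grad,
      OF assms(3,4,3,4), of a b]
  show "(\<lambda>x. a * v x + b * w x) \<in> H1 \<Omega>"
    using wg assms by (auto simp: H1_def intro!: L2_add L2_cmult)
  show "AE x in lebesgue_on \<Omega>. grad \<Omega> (\<lambda>x. a * v x + b * w x) x = a *\<^sub>R grad \<Omega> v x + b *\<^sub>R grad \<Omega> w x"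
    by (rule grad_eq_AE[OF assms(1,2) wg])
qed

section \<open>Poincare's inequality\<close>

lemma segment_difference_bound:
  fixes w :: "'a::euclidean_space \<Rightarrow> real"
  assumes D: "\<And>x. GDERIV w x :> D x" and cont: "continuous_on UNIV D" and "a \<ge> 0"
  shows "ennreal ((w (x + a *\<^sub>R h) - w x)\<^sup>2)
     \<le> ennreal (a * (norm h)\<^sup>2) * (\<integral>\<^sup>+t. indicator {0..a} t * ennreal ((norm (D (x + t *\<^sub>R h)))\<^sup>2) \<partial>lborel)"
proof -
  define g where "g t = h \<bullet> D (x + t *\<^sub>R h)" for t
  have gc: "continuous_on UNIV g"
    unfolding g_def by (intro continuous_intros continuous_on_compose2[OF cont]) auto
  have gm [measurable]: "g \<in> borel_measurable borel"
    using gc by (rule borel_measurable_continuous_onI)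
  have Dm [measurable]: "(\<lambda>t. D (x + t *\<^sub>R h)) \<in> borel_measurable borel"
    by (intro borel_measurable_continuous_onI continuous_intros continuous_on_compose2[OF cont]) auto
  have deriv: "DERIV (\<lambda>t. w (x + t *\<^sub>R h)) t :> g t" for t
  proof -
    have "((\<lambda>t. x + t *\<^sub>R h) has_derivative (\<lambda>t. t *\<^sub>R h)) (at t)"
      by (auto intro!: derivative_eq_intros)
    from has_derivative_compose[OF this D[of "x + t *\<^sub>R h", unfolded gderiv_def]]
    show ?thesis by (simp add: has_field_derivative_def mult_commute_abs g_def)
  qed
  have bo: "has_bochner_integral lborel (\<lambda>t. g t * indicator {0..a} t) (w (x + a *\<^sub>R h) - w (x + 0 *\<^sub>R h))"
    by (rule has_bochner_integral_FTC_Icc_real)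
      (use deriv gc \<open>a \<ge> 0\<close> in \<open>auto simp: continuous_on_eq_continuous_at\<close>)
  have "ennreal \<bar>w (x + a *\<^sub>R h) - w x\<bar> \<le> (\<integral>\<^sup>+t. norm (g t * indicator {0..a} t) \<partial>lborel)"
    using has_bochner_integral_norm_bound[OF bo] by simp
  also have "\<dots> = (\<integral>\<^sup>+t. (indicator {0..a} t * ennreal \<bar>g t\<bar>) * indicator {0..a} t \<partial>lborel)"
    by (intro nn_integral_cong) (auto simp: indicator_def)
  finally have "(ennreal \<bar>w (x + a *\<^sub>R h) - w x\<bar>)\<^sup>2 \<le> \<dots>\<^sup>2"
    by (rule power_mono) simp
  also have "\<dots> \<le> (\<integral>\<^sup>+t. (indicator {0..a} t * ennreal \<bar>g t\<bar>)\<^sup>2 \<partial>lborel) * (\<integral>\<^sup>+t. (indicator {0..a} t)\<^sup>2 \<partial>lborel)"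
    by (rule Cauchy_Schwarz_nn_integral) measurable
  also have "(\<integral>\<^sup>+t. (indicator {0..a} t)\<^sup>2 \<partial>(lborel::real measure)) = ennreal a"
  proof -
    have "(\<integral>\<^sup>+t. (indicator {0..a} t)\<^sup>2 \<partial>(lborel::real measure)) = (\<integral>\<^sup>+t. indicator {0..a} t \<partial>lborel)"
      by (intro nn_integral_cong) (auto simp: indicator_def)
    then show ?thesis using \<open>a \<ge> 0\<close> by simp
  qed
  also have "(\<integral>\<^sup>+t. (indicator {0..a} t * ennreal \<bar>g t\<bar>)\<^sup>2 \<partial>lborel)
      \<le> (\<integral>\<^sup>+t. ennreal ((norm h)\<^sup>2) * (indicator {0..a} t * ennreal ((norm (D (x + t *\<^sub>R h)))\<^sup>2)) \<partial>lborel)"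
  proof (rule nn_integral_mono)
    fix t
    have "\<bar>g t\<bar> \<le> norm h * norm (D (x + t *\<^sub>R h))"
      unfolding g_def by (rule Cauchy_Schwarz_ineq2)
    then have "\<bar>g t\<bar>\<^sup>2 \<le> (norm h * norm (D (x + t *\<^sub>R h)))\<^sup>2"
      by (rule power_mono) simp
    then have "ennreal (\<bar>g t\<bar>\<^sup>2) \<le> ennreal ((norm h)\<^sup>2) * ennreal ((norm (D (x + t *\<^sub>R h)))\<^sup>2)"
      by (simp add: power_mult_distrib flip: ennreal_mult)
    then show "(indicator {0..a} t * ennreal \<bar>g t\<bar>)\<^sup>2
      \<le> ennreal ((norm h)\<^sup>2) * (indicator {0..a} t * ennreal ((norm (D (x + t *\<^sub>R h)))\<^sup>2))"
      by (auto simp: indicator_def ennreal_power)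
  qed
  also have "\<dots> = ennreal ((norm h)\<^sup>2) * (\<integral>\<^sup>+t. indicator {0..a} t * ennreal ((norm (D (x + t *\<^sub>R h)))\<^sup>2) \<partial>lborel)"
    by (rule nn_integral_cmult) measurable
  finally have "(ennreal \<bar>w (x + a *\<^sub>R h) - w x\<bar>)\<^sup>2 \<le> ennreal ((norm h)\<^sup>2) *
      (\<integral>\<^sup>+t. indicator {0..a} t * ennreal ((norm (D (x + t *\<^sub>R h)))\<^sup>2) \<partial>lborel) * ennreal a"
    by (simp add: mult_right_mono)
  then show ?thesis
    using \<open>a \<ge> 0\<close> by (simp add: ennreal_power ennreal_mult mult_ac)
qed

lemma nn_integral_contraction_le:
  fixes y :: "'a::euclidean_space"
  assumes [measurable]: "F \<in> borel_measurable borel" and t: "0 \<le> t" "t \<le> 1/2"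
  shows "(\<integral>\<^sup>+x. F (x + t *\<^sub>R (y - x)) \<partial>lborel) \<le> 2 ^ DIM('a) * (\<integral>\<^sup>+x. F x \<partial>lborel)"
proof -
  let ?c = "1 - t"
  have c: "?c \<noteq> 0" "?c \<ge> 1/2" using t by auto
  have "(\<integral>\<^sup>+x. F x \<partial>lborel)
      = (\<integral>\<^sup>+x. F x \<partial>density (distr lborel borel (\<lambda>x. t *\<^sub>R y + ?c *\<^sub>R x)) (\<lambda>_. ennreal (\<bar>?c\<bar> ^ DIM('a))))"
    using lborel_affine[OF c(1), of "t *\<^sub>R y"] by simp
  also have "\<dots> = (\<integral>\<^sup>+x. ennreal (?c ^ DIM('a)) * F (t *\<^sub>R y + ?c *\<^sub>R x) \<partial>lborel)"
    using c by (simp add: nn_integral_density nn_integral_distr)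
  also have "\<dots> = ennreal (?c ^ DIM('a)) * (\<integral>\<^sup>+x. F (x + t *\<^sub>R (y - x)) \<partial>lborel)"
    by (subst nn_integral_cmult) (auto simp: algebra_simps intro!: arg_cong2[where f="(*)"] nn_integral_cong)
  finally have "2 ^ DIM('a) * (\<integral>\<^sup>+x. F x \<partial>lborel)
       = ennreal (2 ^ DIM('a) * ?c ^ DIM('a)) * (\<integral>\<^sup>+x. F (x + t *\<^sub>R (y - x)) \<partial>lborel)"
    using c by (simp add: ennreal_mult mult.assoc flip: ennreal_power)
  moreover have "1 \<le> 2 ^ DIM('a) * ?c ^ DIM('a)"
    using c by (simp add: one_le_power flip: power_mult_distrib)
  ultimately show ?thesis
    using mult_right_mono[of 1 "ennreal (2 ^ DIM('a) * ?c ^ DIM('a))" "\<integral>\<^sup>+x. F (x + t *\<^sub>R (y - x)) \<partial>lborel"]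
    by simp
qed

abbreviation sq_dist :: "'a::euclidean_space set \<Rightarrow> ('a \<Rightarrow> real) \<Rightarrow> real \<Rightarrow> ennreal" where
  "sq_dist A w c \<equiv> (\<integral>\<^sup>+x. indicator A x * ennreal ((w x - c)\<^sup>2) \<partial>lborel)"

abbreviation dirichlet :: "'a::euclidean_space set \<Rightarrow> ('a \<Rightarrow> 'a) \<Rightarrow> ennreal" where
  "dirichlet A D \<equiv> (\<integral>\<^sup>+x. indicator A x * ennreal ((norm (D x))\<^sup>2) \<partial>lborel)"

definition poincare_set :: "'a::euclidean_space set \<Rightarrow> 'a set \<Rightarrow> bool" where
  "poincare_set \<Omega> A \<longleftrightarrow> (\<exists>C>0::real. \<forall>w D. (\<forall>x. GDERIV w x :> D x) \<longrightarrow> continuous_on UNIV D \<longrightarrow>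
     (\<exists>c. sq_dist A w c
          \<le> ennreal C * dirichlet \<Omega> D))"

lemma ennreal_square_diff_le:
  "ennreal ((a - c)\<^sup>2) \<le> 2 * ennreal ((a - b)\<^sup>2) + 2 * ennreal ((b - c)\<^sup>2)"
proof -
  have "(a - c)\<^sup>2 \<le> 2 * (a - b)\<^sup>2 + 2 * (b - c)\<^sup>2"
    using zero_le_power2[of "(a - b) - (b - c)"] by (simp add: power2_eq_square algebra_simps)
  then have "ennreal ((a - c)\<^sup>2) \<le> ennreal (2 * (a - b)\<^sup>2 + 2 * (b - c)\<^sup>2)"
    by (rule ennreal_leI)
  also have "\<dots> = 2 * ennreal ((a - b)\<^sup>2) + 2 * ennreal ((b - c)\<^sup>2)"
    by (simp add: ennreal_mult)
  finally show ?thesis .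
qed

text \<open>The values of \<open>w\<close> at two points are compared through the midpoint: then in each of the two
  differences only points at distance at least a half from one fixed end point of the segment occur, and the
  substitution that replaces the other end point by the point on the segment has a bounded Jacobian.\<close>

lemma poincare_set_convex:
  fixes A :: "'a::euclidean_space set"
  assumes A: "open A" "convex A" "bounded A" "A \<noteq> {}" "A \<subseteq> \<Omega>" and \<Omega>: "open \<Omega>"
  shows "poincare_set \<Omega> A"
proof -
  obtain r where r: "r > 0" "\<And>x y. x \<in> A \<Longrightarrow> y \<in> A \<Longrightarrow> norm (y - x) \<le> r"
  proof -
    obtain b where "b > 0" "\<And>x. x \<in> A \<Longrightarrow> norm x \<le> b" using A(3) bounded_pos by metis
    then have "norm (y - x) \<le> 2 * b" if "x \<in> A" "y \<in> A" for x y
      using \<open>\<And>x. x \<in> A \<Longrightarrow> norm x \<le> b\<close>[OF that(1)] \<open>\<And>x. x \<in> A \<Longrightarrow> norm x \<le> b\<close>[OF that(2)]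
        norm_triangle_ineq4[of y x] by linarith
    then show thesis using that[of "2 * b"] \<open>b > 0\<close> by simp
  qed
  define K where "K = 1/2 * r\<^sup>2 * (2 ^ DIM('a) * (1/2))"
  have K: "K > 0" using r by (simp add: K_def)
  have Am [measurable]: "A \<in> sets borel" using A by simp
  have \<Omega>m [measurable]: "\<Omega> \<in> sets borel" using \<Omega> by simp
  have Afin: "emeasure lborel A < \<infinity>" using emeasure_bounded_finite[OF A(3)] by simp
  have Apos: "emeasure lborel A \<noteq> 0"
    using open_not_negligible[OF A(1,4)] by (auto simp: negligible_iff_null_sets null_sets_def null_sets_completion_iff)
  show ?thesis
    unfolding poincare_set_def
  proof (rule exI[of _ "4 * K"], intro conjI allI impI)
    show "4 * K > 0" using K by simp
    fix w :: "'a \<Rightarrow> real" and D assume D: "\<forall>x. GDERIV w x :> D x" and cont: "continuous_on UNIV D"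
    have Dm [measurable]: "D \<in> borel_measurable borel" by (rule borel_measurable_continuous_onI[OF cont])
    have wm [measurable]: "w \<in> borel_measurable borel"
      using D by (intro borel_measurable_continuous_onI) (auto simp: continuous_on_eq_continuous_at intro: GDERIV_isCont)
    define G where "G = dirichlet \<Omega> D"
    have mid: "(\<integral>\<^sup>+x. indicator A x * ennreal ((w (x + (1/2) *\<^sub>R (y - x)) - w x)\<^sup>2) \<partial>lborel) \<le> ennreal K * G"
      if y: "y \<in> A" for y
    proof -
      let ?F = "\<lambda>z. indicator A z * ennreal ((norm (D z))\<^sup>2)"
      have "(\<integral>\<^sup>+x. indicator A x * ennreal ((w (x + (1/2) *\<^sub>R (y - x)) - w x)\<^sup>2) \<partial>lborel)
          \<le> (\<integral>\<^sup>+x. ennreal (1/2 * r\<^sup>2) * (\<integral>\<^sup>+t. indicator {0..1/2} t * ?F (x + t *\<^sub>R (y - x)) \<partial>lborel) \<partial>lborel)"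
      proof (rule nn_integral_mono)
        fix x
        show "indicator A x * ennreal ((w (x + (1/2) *\<^sub>R (y - x)) - w x)\<^sup>2)
          \<le> ennreal (1/2 * r\<^sup>2) * (\<integral>\<^sup>+t. indicator {0..1/2} t * ?F (x + t *\<^sub>R (y - x)) \<partial>lborel)"
        proof (cases "x \<in> A")
          case True
          have seg: "x + t *\<^sub>R (y - x) \<in> A" if "t \<in> {0..1/2}" for t
            using convexD_alt[OF A(2) True y, of t] that by (simp add: algebra_simps)
          have "ennreal ((w (x + (1/2) *\<^sub>R (y - x)) - w x)\<^sup>2)
              \<le> ennreal (1/2 * (norm (y - x))\<^sup>2) *
                (\<integral>\<^sup>+t. indicator {0..1/2} t * ennreal ((norm (D (x + t *\<^sub>R (y - x))))\<^sup>2) \<partial>lborel)"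
            by (rule segment_difference_bound) (use D cont in auto)
          also have "\<dots> \<le> ennreal (1/2 * r\<^sup>2) *
                (\<integral>\<^sup>+t. indicator {0..1/2} t * ?F (x + t *\<^sub>R (y - x)) \<partial>lborel)"
          proof (rule mult_mono[OF _ nn_integral_mono])
            show "ennreal (1/2 * (norm (y - x))\<^sup>2) \<le> ennreal (1/2 * r\<^sup>2)"
              using r(2)[OF True y] by (intro ennreal_leI) (simp add: power_mono)
            show "indicator {0..1/2} t * ennreal ((norm (D (x + t *\<^sub>R (y - x))))\<^sup>2)
                \<le> indicator {0..1/2} t * ?F (x + t *\<^sub>R (y - x))" for t
              using seg[of t] by (auto simp: indicator_def)
          qed auto
          finally show ?thesis using True by simp
        qed simp
      qed
      also have "\<dots> = ennreal (1/2 * r\<^sup>2) *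
           (\<integral>\<^sup>+x. (\<integral>\<^sup>+t. indicator {0..1/2} t * ?F (x + t *\<^sub>R (y - x)) \<partial>lborel) \<partial>lborel)"
        by (rule nn_integral_cmult) measurable
      also have "(\<integral>\<^sup>+x. (\<integral>\<^sup>+t. indicator {0..1/2} t * ?F (x + t *\<^sub>R (y - x)) \<partial>lborel) \<partial>lborel)
          = (\<integral>\<^sup>+t. (\<integral>\<^sup>+x. indicator {0..1/2} t * ?F (x + t *\<^sub>R (y - x)) \<partial>lborel) \<partial>lborel)"
        by (rule lborel_pair.Fubini'[symmetric]) measurable
      also have "\<dots> \<le> (\<integral>\<^sup>+t. indicator {0..1/2} t * (2 ^ DIM('a) * G) \<partial>(lborel :: real measure))"
      proof (rule nn_integral_mono)
        fix t :: real
        show "(\<integral>\<^sup>+x. indicator {0..1/2} t * ?F (x + t *\<^sub>R (y - x)) \<partial>lborel)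
            \<le> indicator {0..1/2} t * (2 ^ DIM('a) * G)"
        proof (cases "t \<in> {0..1/2}")
          case True
          have "(\<integral>\<^sup>+x. ?F (x + t *\<^sub>R (y - x)) \<partial>lborel) \<le> 2 ^ DIM('a) * (\<integral>\<^sup>+x. ?F x \<partial>lborel)"
            by (rule nn_integral_contraction_le) (use True in auto)
          also have "\<dots> \<le> 2 ^ DIM('a) * G"
            unfolding G_def using A(5) by (intro mult_left_mono nn_integral_mono) (auto simp: indicator_def)
          finally show ?thesis using True by simp
        qed simp
      qed
      also have "\<dots> = 2 ^ DIM('a) * G * ennreal (1/2)"
        by (subst nn_integral_multc) (auto simp: mult.commute)
      finally have "(\<integral>\<^sup>+x. indicator A x * ennreal ((w (x + (1/2) *\<^sub>R (y - x)) - w x)\<^sup>2) \<partial>lborel)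
          \<le> ennreal (1/2 * r\<^sup>2) * (2 ^ DIM('a) * G * ennreal (1/2))"
        by (simp add: mult_left_mono)
      moreover have "ennreal K = ennreal (1/2 * r\<^sup>2) * (ennreal (2 ^ DIM('a)) * ennreal (1/2))"
        unfolding K_def by (simp only: ennreal_mult[symmetric] zero_le_power2 zero_le_power zero_le_numeral
            mult_nonneg_nonneg divide_nonneg_nonneg zero_le_one)
      moreover have "(2::ennreal) ^ DIM('a) = ennreal (2 ^ DIM('a))"
        by (simp flip: ennreal_power)
      ultimately show ?thesis
        by (simp only: mult_ac)
    qed
    define h where "h y = (\<integral>\<^sup>+x. indicator A x * ennreal ((w x - w y)\<^sup>2) \<partial>lborel)" for y
    have hm [measurable]: "h \<in> borel_measurable borel" unfolding h_def by measurable
    have int_h: "(\<integral>\<^sup>+y. indicator A y * h y \<partial>lborel) \<le> (\<integral>\<^sup>+y. indicator A y * ennreal (4 * K) * G \<partial>lborel)"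
    proof -
      let ?m = "\<lambda>x y. x + (1/2) *\<^sub>R (y - x) :: 'a"
      let ?q = "\<lambda>x y. indicator A x * indicator A y * ennreal ((w (?m x y) - w x)\<^sup>2)"
      have sym: "?m x y = ?m y x" for x y by (simp add: algebra_simps flip: scaleR_add_left)
      have Q: "(\<integral>\<^sup>+y. \<integral>\<^sup>+x. ?q x y \<partial>lborel \<partial>lborel) \<le> (\<integral>\<^sup>+y. indicator A y * (ennreal K * G) \<partial>lborel)"
      proof (rule nn_integral_mono)
        fix y
        show "(\<integral>\<^sup>+x. ?q x y \<partial>lborel) \<le> indicator A y * (ennreal K * G)"
          using mid[of y] by (cases "y \<in> A") auto
      qed
      have "(\<integral>\<^sup>+y. indicator A y * h y \<partial>lborel)
          = (\<integral>\<^sup>+y. \<integral>\<^sup>+x. indicator A y * (indicator A x * ennreal ((w x - w y)\<^sup>2)) \<partial>lborel \<partial>lborel)"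
        unfolding h_def by (intro nn_integral_cong nn_integral_cmult[symmetric]) measurable
      also have "\<dots> \<le> (\<integral>\<^sup>+y. \<integral>\<^sup>+x. 2 * ?q x y + 2 * ?q y x \<partial>lborel \<partial>lborel)"
      proof (intro nn_integral_mono)
        fix x y
        show "indicator A y * (indicator A x * ennreal ((w x - w y)\<^sup>2)) \<le> 2 * ?q x y + 2 * ?q y x"
          using ennreal_square_diff_le[of "w x" "w y" "w (?m x y)"] sym[of x y]
          by (auto simp: indicator_def power2_commute[of "w x"])
      qed
      also have "\<dots> = (\<integral>\<^sup>+y. (\<integral>\<^sup>+x. 2 * ?q x y \<partial>lborel) + (\<integral>\<^sup>+x. 2 * ?q y x \<partial>lborel) \<partial>lborel)"
        by (intro nn_integral_cong nn_integral_add) measurable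
      also have "\<dots> = (\<integral>\<^sup>+y. (\<integral>\<^sup>+x. 2 * ?q x y \<partial>lborel) \<partial>lborel) + (\<integral>\<^sup>+y. (\<integral>\<^sup>+x. 2 * ?q y x \<partial>lborel) \<partial>lborel)"
        by (intro nn_integral_add) measurable
      also have "(\<integral>\<^sup>+y. (\<integral>\<^sup>+x. 2 * ?q y x \<partial>lborel) \<partial>lborel) = (\<integral>\<^sup>+y. (\<integral>\<^sup>+x. 2 * ?q x y \<partial>lborel) \<partial>lborel)"
        by (rule lborel_pair.Fubini'[symmetric]) measurable
      also have "(\<integral>\<^sup>+y. (\<integral>\<^sup>+x. 2 * ?q x y \<partial>lborel) \<partial>lborel) = 2 * (\<integral>\<^sup>+y. (\<integral>\<^sup>+x. ?q x y \<partial>lborel) \<partial>lborel)"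
      proof -
        have "(\<integral>\<^sup>+y. (\<integral>\<^sup>+x. 2 * ?q x y \<partial>lborel) \<partial>lborel) = (\<integral>\<^sup>+y. 2 * (\<integral>\<^sup>+x. ?q x y \<partial>lborel) \<partial>lborel)"
          by (intro nn_integral_cong nn_integral_cmult) measurable
        also have "\<dots> = 2 * (\<integral>\<^sup>+y. (\<integral>\<^sup>+x. ?q x y \<partial>lborel) \<partial>lborel)"
          by (rule nn_integral_cmult) measurable
        finally show ?thesis .
      qed
      also have "2 * (\<integral>\<^sup>+y. (\<integral>\<^sup>+x. ?q x y \<partial>lborel) \<partial>lborel) + 2 * (\<integral>\<^sup>+y. (\<integral>\<^sup>+x. ?q x y \<partial>lborel) \<partial>lborel)
         = 4 * (\<integral>\<^sup>+y. (\<integral>\<^sup>+x. ?q x y \<partial>lborel) \<partial>lborel)"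
        by (simp flip: distrib_right)
      also have "\<dots> \<le> 4 * (\<integral>\<^sup>+y. indicator A y * (ennreal K * G) \<partial>lborel)"
        by (intro mult_left_mono Q) simp
      also have "\<dots> = (\<integral>\<^sup>+y. 4 * (indicator A y * (ennreal K * G)) \<partial>lborel)"
        by (rule nn_integral_cmult[symmetric]) measurable
      also have "\<dots> = (\<integral>\<^sup>+y. indicator A y * ennreal (4 * K) * G \<partial>lborel)"
        using K by (intro nn_integral_cong) (simp add: ennreal_mult mult_ac)
      finally show ?thesis .
    qed
    have "\<exists>y. h y \<le> ennreal (4 * K) * G"
    proof (rule ccontr)
      assume "\<not> ?thesis"
      then have less: "ennreal (4 * K) * G < h y" for y by (simp add: not_le)
      from less[of undefined] have fin: "ennreal (4 * K) * G < \<infinity>"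
        using less_le_trans by fastforce
      have "(\<integral>\<^sup>+y. indicator A y * ennreal (4 * K) * G \<partial>lborel) < (\<integral>\<^sup>+y. indicator A y * h y \<partial>lborel)"
      proof (rule nn_integral_less)
        have "(\<integral>\<^sup>+y. indicator A y * ennreal (4 * K) * G \<partial>lborel) = emeasure lborel A * (ennreal (4 * K) * G)"
          unfolding mult.assoc by (subst nn_integral_multc) auto
        also have "\<dots> < \<infinity>" using Afin fin by (simp add: ennreal_mult_less_top)
        finally show "(\<integral>\<^sup>+y. indicator A y * ennreal (4 * K) * G \<partial>lborel) \<noteq> \<infinity>" by simp
        show "AE y in lborel. indicator A y * ennreal (4 * K) * G \<le> indicator A y * h y"
          using less by (intro AE_I2) (auto simp: indicator_def less_imp_le)
        show "\<not> (AE y in lborel. indicator A y * h y \<le> indicator A y * ennreal (4 * K) * G)"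
        proof
          assume "AE y in lborel. indicator A y * h y \<le> indicator A y * ennreal (4 * K) * G"
          then have "AE y in lborel. y \<notin> A"
          proof eventually_elim
            case (elim y)
            then show ?case using less[of y] by (auto simp: indicator_def not_le split: if_splits)
          qed
          then show False
            using Apos by (subst (asm) AE_iff_null) (auto simp: null_sets_def)
        qed
      qed measurable
      then show False using int_h by simp
    qed
    then obtain y where "h y \<le> ennreal (4 * K) * G" ..
    then show "\<exists>c. sq_dist A w c
          \<le> ennreal (4 * K) * dirichlet \<Omega> D"
      unfolding h_def G_def by blast
  qed
qed

lemma poincare_set_Un:
  fixes A B :: "'a::euclidean_space set"
  assumes A: "open A" "bounded A" "poincare_set \<Omega> A" and B: "open B" "bounded B" "poincare_set \<Omega> B"
    and AB: "A \<inter> B \<noteq> {}"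
  shows "poincare_set \<Omega> (A \<union> B)"
proof -
  obtain C1 where C1: "C1 > 0" "\<And>w D. (\<forall>x. GDERIV w x :> D x) \<Longrightarrow> continuous_on UNIV D \<Longrightarrow>
     \<exists>c. sq_dist A w c
          \<le> ennreal C1 * dirichlet \<Omega> D"
    using A(3) unfolding poincare_set_def by blast
  obtain C2 where C2: "C2 > 0" "\<And>w D. (\<forall>x. GDERIV w x :> D x) \<Longrightarrow> continuous_on UNIV D \<Longrightarrow>
     \<exists>c. sq_dist B w c
          \<le> ennreal C2 * dirichlet \<Omega> D"
    using B(3) unfolding poincare_set_def by blast
  have [measurable]: "A \<in> sets borel" "B \<in> sets borel" using A B by auto
  have "emeasure lborel (A \<inter> B) \<noteq> 0"
    using open_not_negligible[of "A \<inter> B"] A B AB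
    by (auto simp: negligible_iff_null_sets null_sets_def null_sets_completion_iff)
  moreover have ABfin: "emeasure lborel (A \<inter> B) < \<infinity>"
    using emeasure_bounded_finite[of "A \<inter> B"] A(2) by (simp add: bounded_Int)
  ultimately obtain m where m: "m > 0" "emeasure lborel (A \<inter> B) = ennreal m"
    by (metis ennreal_cases ennreal_0 infinity_ennreal_def less_irrefl order_le_less)
  obtain b where b: "b \<ge> 0" "emeasure lborel B = ennreal b"
    using emeasure_bounded_finite[OF B(2)] by (metis ennreal_cases infinity_ennreal_def less_irrefl)
  define C where "C = C1 + 2 * C2 + 4 * (C1 + C2) / m * b"
  have C: "C > 0" using C1 C2 m b by (auto simp: C_def intro!: add_pos_nonneg)
  show ?thesis
    unfolding poincare_set_def
  proof (rule exI[of _ C], intro conjI allI impI C)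
    fix w :: "'a \<Rightarrow> real" and D assume D: "\<forall>x. GDERIV w x :> D x" and cont: "continuous_on UNIV D"
    have wm [measurable]: "w \<in> borel_measurable borel"
      using D by (intro borel_measurable_continuous_onI) (auto simp: continuous_on_eq_continuous_at intro: GDERIV_isCont)
    define G where "G = dirichlet \<Omega> D"
    define I where "I S c = sq_dist S w c" for S c
    show "\<exists>c. I (A \<union> B) c \<le> ennreal C * G"
    proof (cases "G = \<infinity>")
      case True
      then show ?thesis using C by (simp add: ennreal_mult_top)
    next
      case False
      then obtain g where g: "g \<ge> 0" "G = ennreal g" by (cases G) auto
      obtain c1 where c1: "I A c1 \<le> ennreal C1 * G" using C1(2)[OF D cont] unfolding I_def G_def by blast
      obtain c2 where c2: "I B c2 \<le> ennreal C2 * G" using C2(2)[OF D cont] unfolding I_def G_def by blast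
      have "ennreal m * ennreal ((c1 - c2)\<^sup>2) = (\<integral>\<^sup>+x. indicator (A \<inter> B) x * ennreal ((c1 - c2)\<^sup>2) \<partial>lborel)"
        using m by (subst nn_integral_multc) auto
      also have "\<dots> \<le> (\<integral>\<^sup>+x. 2 * (indicator A x * ennreal ((w x - c1)\<^sup>2)) + 2 * (indicator B x * ennreal ((w x - c2)\<^sup>2)) \<partial>lborel)"
      proof (rule nn_integral_mono)
        show "indicator (A \<inter> B) x * ennreal ((c1 - c2)\<^sup>2)
          \<le> 2 * (indicator A x * ennreal ((w x - c1)\<^sup>2)) + 2 * (indicator B x * ennreal ((w x - c2)\<^sup>2))" for x
          using ennreal_square_diff_le[of c1 c2 "w x"] by (auto simp: indicator_def power2_commute[of c1])
      qed
      also have "\<dots> = 2 * I A c1 + 2 * I B c2"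
        unfolding I_def by (simp add: nn_integral_add nn_integral_cmult)
      also have "\<dots> \<le> 2 * (ennreal C1 * G) + 2 * (ennreal C2 * G)"
        by (intro add_mono mult_left_mono c1 c2) auto
      also have "\<dots> = ennreal (2 * (C1 + C2) * g)"
        using C1 C2 g by (simp add: distrib_right distrib_left flip: ennreal_mult ennreal_plus ennreal_numeral)
      finally have "m * (c1 - c2)\<^sup>2 \<le> 2 * (C1 + C2) * g"
        using m C1 C2 g by (subst (asm) ennreal_mult[symmetric]) (auto simp: ennreal_le_iff)
      then have dc: "(c1 - c2)\<^sup>2 \<le> 2 * (C1 + C2) / m * g"
        using m by (simp add: field_simps)
      have "I (A \<union> B) c1 \<le> (\<integral>\<^sup>+x. indicator A x * ennreal ((w x - c1)\<^sup>2) +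
           (2 * (indicator B x * ennreal ((w x - c2)\<^sup>2)) + 2 * ennreal ((c1 - c2)\<^sup>2) * indicator B x) \<partial>lborel)"
        unfolding I_def
      proof (rule nn_integral_mono)
        show "indicator (A \<union> B) x * ennreal ((w x - c1)\<^sup>2)
          \<le> indicator A x * ennreal ((w x - c1)\<^sup>2) +
           (2 * (indicator B x * ennreal ((w x - c2)\<^sup>2)) + 2 * ennreal ((c1 - c2)\<^sup>2) * indicator B x)" for x
          using ennreal_square_diff_le[of "w x" c1 c2] by (auto simp: indicator_def power2_commute[of c2])
      qed
      also have "\<dots> = I A c1 + (2 * I B c2 + 2 * ennreal ((c1 - c2)\<^sup>2) * emeasure lborel B)"
        unfolding I_def by (simp add: nn_integral_add nn_integral_cmult)
      also have "\<dots> \<le> ennreal C1 * G + (2 * (ennreal C2 * G) + 2 * ennreal (2 * (C1 + C2) / m * g) * ennreal b)"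
        unfolding b by (intro add_mono mult_left_mono mult_right_mono c1 c2 ennreal_leI dc) auto
      also have "\<dots> = ennreal C1 * ennreal g + (ennreal 2 * (ennreal C2 * ennreal g) + ennreal 2 * ennreal (2 * (C1 + C2) / m * g) * ennreal b)"
        unfolding g by simp
      also have "\<dots> = ennreal (C1 * g + (2 * (C2 * g) + 2 * (2 * (C1 + C2) / m * g) * b))"
        using C1(1) C2(1) g(1) m b(1) by (simp only: ennreal_mult' ennreal_plus ennreal_mult mult_nonneg_nonneg divide_nonneg_nonneg add_nonneg_nonneg less_imp_le zero_le_numeral)
      also have "\<dots> = ennreal C * G"
        using C g C1(1) C2(1) by (simp add: C_def field_simps flip: ennreal_mult)
      finally show ?thesis by blast
    qed
  qed
qed

lemma poincare_set_Union:
  fixes F :: "'a::euclidean_space set set"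
  assumes "finite F" "F \<noteq> {}" "\<And>A. A \<in> F \<Longrightarrow> open A \<and> bounded A \<and> y \<in> A \<and> poincare_set \<Omega> A"
  shows "poincare_set \<Omega> (\<Union>F)"
  using assms
proof (induction F rule: finite_ne_induct)
  case (insert A F)
  then have "poincare_set \<Omega> (A \<union> \<Union>F)"
    by (intro poincare_set_Un) (auto simp: bounded_Union)
  then show ?case by simp
qed simp

lemma poincare_set_connected:
  fixes \<Omega> :: "'a::euclidean_space set"
  assumes \<Omega>: "open \<Omega>" "connected \<Omega>" "bounded \<Omega>" and x: "x \<in> \<Omega>" "y \<in> \<Omega>"
  shows "\<exists>A. open A \<and> A \<subseteq> \<Omega> \<and> x \<in> A \<and> y \<in> A \<and> poincare_set \<Omega> A"
proof (rule connected_equivalence_relation[OF \<Omega>(2) x, of "\<lambda>x y. \<exists>A. open A \<and> A \<subseteq> \<Omega> \<and> x \<in> A \<and> y \<in> A \<and> poincare_set \<Omega> A"])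
  fix x y z
  assume "\<exists>A. open A \<and> A \<subseteq> \<Omega> \<and> x \<in> A \<and> y \<in> A \<and> poincare_set \<Omega> A"
    and "\<exists>A. open A \<and> A \<subseteq> \<Omega> \<and> y \<in> A \<and> z \<in> A \<and> poincare_set \<Omega> A"
  then obtain A B where "open A" "A \<subseteq> \<Omega>" "x \<in> A" "y \<in> A" "poincare_set \<Omega> A"
     "open B" "B \<subseteq> \<Omega>" "y \<in> B" "z \<in> B" "poincare_set \<Omega> B" by blast
  moreover from this have "poincare_set \<Omega> (A \<union> B)"
    by (intro poincare_set_Un) (auto intro: bounded_subset[OF \<Omega>(3)])
  ultimately show "\<exists>A. open A \<and> A \<subseteq> \<Omega> \<and> x \<in> A \<and> z \<in> A \<and> poincare_set \<Omega> A"
    by (intro exI[of _ "A \<union> B"]) auto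
next
  fix a assume "a \<in> \<Omega>"
  then obtain r where r: "r > 0" "ball a r \<subseteq> \<Omega>" using \<Omega>(1) by (auto simp: open_contains_ball)
  then have "poincare_set \<Omega> (ball a r)"
    by (intro poincare_set_convex \<Omega>) auto
  then show "\<exists>T. openin (top_of_set \<Omega>) T \<and> a \<in> T \<and> (\<forall>x\<in>T. \<exists>A. open A \<and> A \<subseteq> \<Omega> \<and> a \<in> A \<and> x \<in> A \<and> poincare_set \<Omega> A)"
    using r \<Omega>(1) by (intro exI[of _ "ball a r"]) (auto simp: openin_open_eq)
qed blast

text \<open>A Lipschitz domain lies on one side of its boundary, so it cannot have slits.\<close>

lemma lipschitz_interior_closure_subset:
  fixes \<Omega> :: "'a::euclidean_space set"
  assumes "lipschitz_boundary \<Omega>" "open \<Omega>"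
  shows "interior (closure \<Omega>) \<subseteq> \<Omega>"
proof
  fix x assume x: "x \<in> interior (closure \<Omega>)"
  show "x \<in> \<Omega>"
  proof (rule ccontr)
    assume nx: "x \<notin> \<Omega>"
    then have "x \<in> frontier \<Omega>"
      using x interior_subset assms(2) by (auto simp: frontier_def interior_open)
    with assms(1) have "\<exists>U e g L. open U \<and> x \<in> U \<and> norm e = 1 \<and> L-lipschitz_on UNIV g \<and>
        (\<forall>z\<in>U. z \<in> \<Omega> \<longleftrightarrow> (g (z - (z \<bullet> e) *\<^sub>R e) :: real) < z \<bullet> e)"
      unfolding lipschitz_boundary_def by (rule bspec)
    then obtain U e and g :: "'a \<Rightarrow> real" and L where U: "open U" "x \<in> U" "norm e = 1" "L-lipschitz_on UNIV g"
        "\<And>z. z \<in> U \<Longrightarrow> z \<in> \<Omega> \<longleftrightarrow> g (z - (z \<bullet> e) *\<^sub>R e) < z \<bullet> e"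
      by (elim exE conjE) (rule that, auto)
    have "open (U \<inter> interior (closure \<Omega>))" using U by auto
    then obtain d where d: "d > 0" "ball x d \<subseteq> U \<inter> interior (closure \<Omega>)"
      using U(2) x openE[of "U \<inter> interior (closure \<Omega>)" x] by blast
    define z where "z = x - (d/2) *\<^sub>R e"
    have "dist x z < d" using d U(3) by (simp add: z_def dist_norm)
    then have "z \<in> U \<inter> interior (closure \<Omega>)" using d by auto
    then have z: "z \<in> U" "z \<in> closure \<Omega>" using interior_subset[of "closure \<Omega>"] by auto
    have ee: "e \<bullet> e = 1" using U(3) by (simp add: norm_eq_1)
    have "z - (z \<bullet> e) *\<^sub>R e = x - (x \<bullet> e) *\<^sub>R e"
      by (simp add: z_def inner_simps ee algebra_simps)
    moreover have "x \<bullet> e \<le> g (x - (x \<bullet> e) *\<^sub>R e)" using U(5)[OF U(2)] nx by simp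
    moreover have "z \<bullet> e < x \<bullet> e" using d by (simp add: z_def inner_simps ee)
    ultimately have zg: "z \<bullet> e < g (z - (z \<bullet> e) *\<^sub>R e)" by simp
    have gc: "continuous_on UNIV g" using U(4) by (rule lipschitz_on_continuous_on)
    define V where "V = U \<inter> {y. y \<bullet> e < g (y - (y \<bullet> e) *\<^sub>R e)}"
    have "open V"
      unfolding V_def using U(1)
      by (intro open_Int open_Collect_less continuous_intros continuous_on_compose2[OF gc]) auto
    moreover have "z \<in> V" using z zg by (simp add: V_def)
    ultimately obtain y where "y \<in> \<Omega>" "y \<in> V"
      using z(2) open_Int_closure_eq_empty[of V \<Omega>] by auto
    then show False using U(5)[of y] by (auto simp: V_def)
  qed
qed

lemma poincare_set_polyhedral:
  fixes \<Omega> :: "'a::euclidean_space set"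
  assumes "polyhedral_lipschitz_domain \<Omega>"
  shows "poincare_set \<Omega> \<Omega>"
proof -
  from assms obtain P where \<Omega>: "open \<Omega>" "connected \<Omega>" "\<Omega> \<noteq> {}" "bounded \<Omega>" "lipschitz_boundary \<Omega>"
    and P: "finite P" "\<And>S. S \<in> P \<Longrightarrow> polytope S" "closure \<Omega> = \<Union>P"
    unfolding polyhedral_lipschitz_domain_def by auto
  obtain x0 where x0: "x0 \<in> \<Omega>" using \<Omega> by auto
  define Q where "Q = {S \<in> P. interior S \<noteq> {}}"
  have Q: "finite Q" using P by (simp add: Q_def)
  have int\<Omega>: "interior S \<subseteq> \<Omega>" if "S \<in> P" for S
    using lipschitz_interior_closure_subset[OF \<Omega>(5,1)] interior_mono[of S "closure \<Omega>"] P(3) that by blast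
  have "\<forall>S\<in>Q. \<exists>B. open B \<and> B \<subseteq> \<Omega> \<and> x0 \<in> B \<and> interior S \<subseteq> B \<and> poincare_set \<Omega> B"
  proof
    fix S assume S: "S \<in> Q"
    then have SP: "S \<in> P" "interior S \<noteq> {}" by (auto simp: Q_def)
    then obtain y where y: "y \<in> interior S" by auto
    obtain A where A: "open A" "A \<subseteq> \<Omega>" "x0 \<in> A" "y \<in> A" "poincare_set \<Omega> A"
      using poincare_set_connected[OF \<Omega>(1,2,4) x0, of y] int\<Omega>[OF SP(1)] y by blast
    have pS: "poincare_set \<Omega> (interior S)"
      using SP int\<Omega>[OF SP(1)] \<Omega> bounded_subset[OF \<Omega>(4)] P(2)[OF SP(1)]
      by (intro poincare_set_convex) (auto intro: convex_interior polytope_imp_convex)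
    have "poincare_set \<Omega> (A \<union> interior S)"
      using A y int\<Omega>[OF SP(1)] pS by (intro poincare_set_Un) (auto intro: bounded_subset[OF \<Omega>(4)])
    then show "\<exists>B. open B \<and> B \<subseteq> \<Omega> \<and> x0 \<in> B \<and> interior S \<subseteq> B \<and> poincare_set \<Omega> B"
      using A int\<Omega>[OF SP(1)] by (intro exI[of _ "A \<union> interior S"]) auto
  qed
  then obtain B where B: "\<And>S. S \<in> Q \<Longrightarrow> open (B S) \<and> B S \<subseteq> \<Omega> \<and> x0 \<in> B S \<and> interior S \<subseteq> B S \<and> poincare_set \<Omega> (B S)"
    by metis
  have neg: "negligible (\<Union>S\<in>P. frontier S)"
    using P by (intro negligible_Union) (auto simp: negligible_convex_frontier polytope_imp_convex)
  have cover: "\<Omega> \<subseteq> \<Union>(B ` Q) \<union> (\<Union>S\<in>P. frontier S)"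
  proof
    fix x assume "x \<in> \<Omega>"
    then obtain S where S: "S \<in> P" "x \<in> S" using P(3) closure_subset[of \<Omega>] by blast
    show "x \<in> \<Union>(B ` Q) \<union> (\<Union>S\<in>P. frontier S)"
    proof (cases "x \<in> interior S")
      case True
      then have "S \<in> Q" using S by (auto simp: Q_def)
      then show ?thesis using B[of S] True by auto
    next
      case False
      then have "x \<in> frontier S" using S closure_subset[of S] by (auto simp: frontier_def)
      then show ?thesis using S by auto
    qed
  qed
  have "Q \<noteq> {}"
  proof
    assume "Q = {}"
    then have "\<Omega> \<subseteq> (\<Union>S\<in>P. frontier S)" using cover by auto
    then have "negligible \<Omega>" by (rule negligible_subset[OF neg])
    then show False using open_not_negligible[OF \<Omega>(1,3)] by simp
  qed
  then have "poincare_set \<Omega> (\<Union>(B ` Q))"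
    using B Q by (intro poincare_set_Union[where y=x0]) (auto intro: bounded_subset[OF \<Omega>(4)])
  then obtain C where C: "C > 0" "\<And>w D. (\<forall>x. GDERIV w x :> D x) \<Longrightarrow> continuous_on UNIV D \<Longrightarrow>
     \<exists>c. sq_dist (\<Union>(B ` Q)) w c
          \<le> ennreal C * dirichlet \<Omega> D"
    unfolding poincare_set_def by blast
  have "AE x in lebesgue. x \<notin> (\<Union>S\<in>P. frontier S)"
    using neg by (intro AE_not_in) (simp add: negligible_iff_null_sets)
  then have *: "(\<integral>\<^sup>+x. indicator \<Omega> x * f x \<partial>lborel) \<le> (\<integral>\<^sup>+x. indicator (\<Union>(B ` Q)) x * f x \<partial>lborel)" for f
    unfolding nn_integral_completion[symmetric, of lborel]
    by (intro nn_integral_mono_AE, eventually_elim) (use cover in \<open>auto simp: indicator_def\<close>)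
  show ?thesis
    unfolding poincare_set_def
  proof (rule exI[of _ C], intro conjI allI impI C(1))
    fix w :: "'a \<Rightarrow> real" and D assume D: "\<forall>x. GDERIV w x :> D x" "continuous_on UNIV D"
    from C(2)[OF D] obtain c where c: "sq_dist (\<Union>(B ` Q)) w c
          \<le> ennreal C * dirichlet \<Omega> D" by (elim exE)
    show "\<exists>c. sq_dist \<Omega> w c
          \<le> ennreal C * dirichlet \<Omega> D"
      by (rule exI[of _ c], rule order_trans[OF * c])
  qed
qed

lemma L2_norm_nn_integral:
  fixes v :: "'a::euclidean_space \<Rightarrow> 'b::euclidean_space"
  assumes v: "v \<in> L2 \<Omega>" and "open \<Omega>"
  shows "(\<integral>\<^sup>+x. indicator \<Omega> x * ennreal ((norm (v x))\<^sup>2) \<partial>lborel) = ennreal ((L2_norm \<Omega> v)\<^sup>2)"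
proof -
  have "(\<integral>\<^sup>+x. indicator \<Omega> x * ennreal ((norm (v x))\<^sup>2) \<partial>lborel) = (\<integral>\<^sup>+x. ennreal ((norm (v x))\<^sup>2) * indicator \<Omega> x \<partial>lebesgue)"
    by (simp add: nn_integral_completion mult.commute)
  also have "\<dots> = (\<integral>\<^sup>+x. ennreal ((norm (v x))\<^sup>2) \<partial>lebesgue_on \<Omega>)"
    using assms(2) by (subst nn_integral_restrict_space) auto
  also have "\<dots> = ennreal (LINT x|lebesgue_on \<Omega>. (norm (v x))\<^sup>2)"
    using L2_D(2)[OF v] by (intro nn_integral_eq_integral) auto
  also have "(LINT x|lebesgue_on \<Omega>. (norm (v x))\<^sup>2) = (L2_norm \<Omega> v)\<^sup>2"
  proof -
    have "0 \<le> (LINT x|lebesgue_on \<Omega>. (norm (v x))\<^sup>2)"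
      by (intro integral_nonneg_AE) auto
    then show ?thesis by (simp only: L2_norm_def real_sqrt_pow2)
  qed
  finally show ?thesis .
qed

lemma smooth_in_H1:
  assumes \<Omega>: "open \<Omega>" "bounded \<Omega>" and w: "smooth w"
  shows "w \<in> H1 \<Omega>"
proof -
  obtain D where D: "\<And>x. GDERIV w x :> D x" "continuous_on UNIV D" using smooth_imp_C1[OF w] by blast
  have "continuous_on UNIV w" using w Ck_imp_continuous by (auto simp: smooth_def)
  then show ?thesis
    using weak_gradient_classical[OF \<Omega> D] continuous_in_L2[OF _ \<Omega>(2,1)] by (auto simp: H1_def)
qed

lemma poincare_smooth:
  fixes \<Omega> :: "'a::euclidean_space set"
  assumes "polyhedral_lipschitz_domain \<Omega>"
  obtains C where "C \<ge> 0"
    "\<And>w. smooth w \<Longrightarrow> \<exists>c. L2_norm \<Omega> (\<lambda>x. w x - c) \<le> C * L2_norm \<Omega> (grad \<Omega> w)"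
proof -
  have \<Omega>: "open \<Omega>" "bounded \<Omega>" using assms by (auto simp: polyhedral_lipschitz_domain_def)
  obtain C where C: "C > 0" "\<And>w D. (\<forall>x. GDERIV w x :> D x) \<Longrightarrow> continuous_on UNIV D \<Longrightarrow>
     \<exists>c. sq_dist \<Omega> w c
          \<le> ennreal C * dirichlet \<Omega> D"
    using poincare_set_polyhedral[OF assms] unfolding poincare_set_def by blast
  show thesis
  proof (rule that[of "sqrt C"])
    show "sqrt C \<ge> 0" using C by simp
    fix w :: "'a \<Rightarrow> real" assume w: "smooth w"
    obtain D where D: "\<And>x. GDERIV w x :> D x" "continuous_on UNIV D" using smooth_imp_C1[OF w] by blast
    have wc: "continuous_on UNIV w" using w Ck_imp_continuous by (auto simp: smooth_def)
    obtain c where c: "sq_dist \<Omega> w c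
          \<le> ennreal C * dirichlet \<Omega> D"
      using C(2) D by blast
    have L: "(\<lambda>x. w x - c) \<in> L2 \<Omega>" "D \<in> L2 \<Omega>"
      by (intro continuous_in_L2 continuous_intros wc D \<Omega>)+
    have "ennreal ((L2_norm \<Omega> (\<lambda>x. w x - c))\<^sup>2) \<le> ennreal C * ennreal ((L2_norm \<Omega> D)\<^sup>2)"
      using c L2_norm_nn_integral[OF L(1) \<Omega>(1)] L2_norm_nn_integral[OF L(2) \<Omega>(1)] by simp
    also have "\<dots> = ennreal ((sqrt C * L2_norm \<Omega> D)\<^sup>2)"
      using C(1) by (simp add: power_mult_distrib flip: ennreal_mult)
    finally have "(L2_norm \<Omega> (\<lambda>x. w x - c))\<^sup>2 \<le> (sqrt C * L2_norm \<Omega> D)\<^sup>2"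
      by (subst (asm) ennreal_le_iff) auto
    then have "L2_norm \<Omega> (\<lambda>x. w x - c) \<le> sqrt C * L2_norm \<Omega> D"
      by (rule power2_le_imp_le) (use C in simp)
    also have "L2_norm \<Omega> D = L2_norm \<Omega> (grad \<Omega> w)"
    proof (rule L2_norm_cong_AE)
      show "AE x in lebesgue_on \<Omega>. D x = grad \<Omega> w x"
        using grad_eq_AE[OF \<Omega> weak_gradient_classical[OF \<Omega> D]] by eventually_elim simp
      show "D \<in> borel_measurable (lebesgue_on \<Omega>)" using L2_D[OF L(2)] by simp
      show "grad \<Omega> w \<in> borel_measurable (lebesgue_on \<Omega>)"
        using L2_D(1)[OF grad_in_L2[OF smooth_in_H1[OF \<Omega> w]]] .
    qed
    finally show "\<exists>c. L2_norm \<Omega> (\<lambda>x. w x - c) \<le> sqrt C * L2_norm \<Omega> (grad \<Omega> w)" by blast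
  qed
qed

lemma H1_inner_eq:
  assumes "v \<in> H1 \<Omega>" "w \<in> H1 \<Omega>"
  shows "H1_inner \<Omega> v w = (LINT x|lebesgue_on \<Omega>. grad \<Omega> v x \<bullet> grad \<Omega> w x) + (LINT x|lebesgue_on \<Omega>. v x * w x)"
  unfolding H1_inner_def using assms
  by (intro Bochner_Integration.integral_add L2_inner_integrable L2_mult_integrable grad_in_L2 H1_imp_L2)

lemma H1_norm_eq:
  assumes "v \<in> H1 \<Omega>"
  shows "H1_norm \<Omega> v = sqrt ((L2_norm \<Omega> (grad \<Omega> v))\<^sup>2 + (L2_norm \<Omega> v)\<^sup>2)"
  by (simp only: H1_norm_def H1_inner_eq[OF assms assms] L2_norm_power2 inner_real_def)

lemma H1_norm_ge:
  assumes "v \<in> H1 \<Omega>"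
  shows "L2_norm \<Omega> v \<le> H1_norm \<Omega> v" "L2_norm \<Omega> (grad \<Omega> v) \<le> H1_norm \<Omega> v"
  unfolding H1_norm_eq[OF assms] by (auto intro: real_le_rsqrt)

lemma H1_norm_le:
  assumes "v \<in> H1 \<Omega>"
  shows "H1_norm \<Omega> v \<le> L2_norm \<Omega> (grad \<Omega> v) + L2_norm \<Omega> v"
  unfolding H1_norm_eq[OF assms] by (intro sqrt_sum_squares_le_sum) auto

lemma L2_norm_grad_lincomb:
  assumes "open \<Omega>" "bounded \<Omega>" "v \<in> H1 \<Omega>" "w \<in> H1 \<Omega>"
  shows "L2_norm \<Omega> (grad \<Omega> (\<lambda>x. a * v x + b * w x)) = L2_norm \<Omega> (\<lambda>x. a *\<^sub>R grad \<Omega> v x + b *\<^sub>R grad \<Omega> w x)"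
  using assms
  by (intro L2_norm_cong_AE H1_lincomb(2) L2_D(1)[OF grad_in_L2] L2_D(1)[OF L2_add] L2_scaleR grad_in_L2 H1_lincomb(1))

lemma grad_const_AE:
  assumes "open \<Omega>" "bounded \<Omega>"
  shows "AE x in lebesgue_on \<Omega>. grad \<Omega> (\<lambda>x. c) x = 0"
  by (rule grad_eq_AE[OF assms weak_gradient_classical[OF assms]]) (auto simp: GDERIV_const)

text \<open>The constant function \<open>1\<close> is in \<^term>\<open>H1D \<Omega> \<Gamma>D\<close> iff \<open>\<Gamma>D\<close> has zero capacity; only otherwise the norm of the
  gradient controls the function itself.\<close>

lemma poincare_CinfD:
  fixes \<Omega> \<Gamma>D :: "'a::euclidean_space set"
  assumes dom: "polyhedral_lipschitz_domain \<Omega>"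
  obtains C where "C \<ge> 0"
    "\<And>w. w \<in> CinfD \<Gamma>D \<Longrightarrow> \<exists>c. L2_norm \<Omega> (\<lambda>x. w x - c) \<le> C * L2_norm \<Omega> (grad \<Omega> w) \<and>
        ((\<lambda>x. 1) \<notin> H1D \<Omega> \<Gamma>D \<longrightarrow> c = 0)"
proof -
  have \<Omega>: "open \<Omega>" "bounded \<Omega>" using assms by (auto simp: polyhedral_lipschitz_domain_def)
  obtain C where C: "C \<ge> 0"
    "\<And>w. smooth w \<Longrightarrow> \<exists>c. L2_norm \<Omega> (\<lambda>x. w x - c) \<le> C * L2_norm \<Omega> (grad \<Omega> w)"
    using poincare_smooth[OF dom] by blast
  have sm: "smooth w" if "w \<in> CinfD \<Gamma>D" for w using that by (simp add: CinfD_def)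
  show thesis
  proof (cases "(\<lambda>x. 1) \<in> H1D \<Omega> \<Gamma>D")
    case True
    then show thesis using that[OF C(1)] C(2) sm by blast
  next
    case False
    have one: "(\<lambda>x. 1) \<in> H1 \<Omega>" by (rule smooth_in_H1[OF \<Omega> smooth_const])
    from False one obtain \<epsilon> where \<epsilon>: "\<epsilon> > 0" "\<And>w. w \<in> CinfD \<Gamma>D \<Longrightarrow> \<epsilon> \<le> H1_norm \<Omega> (\<lambda>x. 1 - w x)"
      unfolding H1D_def by (auto simp: not_less)
    define m where "m = L2_norm \<Omega> (\<lambda>x::'a. 1::real)"
    have m: "m \<ge> 0" by (simp add: m_def)
    define C' where "C' = C + (1 + C) / \<epsilon> * m"
    show thesis
    proof (rule that[of C'])
      show "C' \<ge> 0" using C \<epsilon> m by (simp add: C'_def)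
      fix w assume w: "w \<in> CinfD \<Gamma>D"
      have wH: "w \<in> H1 \<Omega>" by (rule smooth_in_H1[OF \<Omega> sm[OF w]])
      obtain c where c: "L2_norm \<Omega> (\<lambda>x. w x - c) \<le> C * L2_norm \<Omega> (grad \<Omega> w)" using C(2) sm w by blast
      have cb: "\<bar>c\<bar> * \<epsilon> \<le> (1 + C) * L2_norm \<Omega> (grad \<Omega> w)"
      proof (cases "c = 0")
        case True
        then show ?thesis using C by simp
      next
        case False
        let ?w = "\<lambda>x. (1/c) * w x"
        let ?z = "\<lambda>x. 1 * 1 + (-1/c) * w x"
        have z: "?z \<in> H1 \<Omega>" by (rule H1_lincomb(1)[OF \<Omega> one wH])
        have "supp ?w = supp w" using False by (simp add: supp_def)
        then have "?w \<in> CinfD \<Gamma>D" using w smooth_cmult[of w "1/c"] by (simp add: CinfD_def)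
        from \<epsilon>(2)[OF this] have "\<epsilon> \<le> H1_norm \<Omega> ?z" by simp
        also have "\<dots> \<le> L2_norm \<Omega> (grad \<Omega> ?z) + L2_norm \<Omega> ?z" by (rule H1_norm_le[OF z])
        also have "L2_norm \<Omega> (grad \<Omega> ?z) = L2_norm \<Omega> (\<lambda>x. (-1/c) *\<^sub>R grad \<Omega> w x)"
        proof (rule L2_norm_cong_AE)
          show "AE x in lebesgue_on \<Omega>. grad \<Omega> ?z x = (-1/c) *\<^sub>R grad \<Omega> w x"
            using H1_lincomb(2)[OF \<Omega> one wH, of 1 "-1/c"] grad_const_AE[OF \<Omega>, of 1]
            by eventually_elim simp
        qed (use L2_D(1)[OF grad_in_L2[OF z]] L2_D(1)[OF L2_scaleR[OF grad_in_L2[OF wH]]] in auto)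
        also have "\<dots> = 1 / \<bar>c\<bar> * L2_norm \<Omega> (grad \<Omega> w)" unfolding L2_norm_scaleR by simp
        also have "?z = (\<lambda>x. (-1/c) * (w x - c))" using False by (simp add: field_simps fun_eq_iff)
        also have "L2_norm \<Omega> \<dots> = 1 / \<bar>c\<bar> * L2_norm \<Omega> (\<lambda>x. w x - c)"
          unfolding L2_norm_cmult by simp
        also have "1 / \<bar>c\<bar> * L2_norm \<Omega> (grad \<Omega> w) + 1 / \<bar>c\<bar> * L2_norm \<Omega> (\<lambda>x. w x - c)
            \<le> 1 / \<bar>c\<bar> * L2_norm \<Omega> (grad \<Omega> w) + 1 / \<bar>c\<bar> * (C * L2_norm \<Omega> (grad \<Omega> w))"
          using c by (intro add_left_mono mult_left_mono) auto
        finally show ?thesis using False by (simp add: field_simps)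
      qed
      have "L2_norm \<Omega> w \<le> L2_norm \<Omega> (\<lambda>x. c * 1) + L2_norm \<Omega> (\<lambda>x. w x - c * 1)"
        using L2_norm_triangle_diff[OF H1_imp_L2[OF wH] L2_cmult[OF H1_imp_L2[OF one], of c]] .
      also have "\<dots> \<le> \<bar>c\<bar> * m + C * L2_norm \<Omega> (grad \<Omega> w)"
        using c unfolding L2_norm_cmult m_def by simp
      also have "\<bar>c\<bar> * m \<le> (1 + C) * L2_norm \<Omega> (grad \<Omega> w) / \<epsilon> * m"
        using cb \<epsilon> m by (intro mult_right_mono) (auto simp: pos_le_divide_eq)
      finally have "L2_norm \<Omega> w \<le> C' * L2_norm \<Omega> (grad \<Omega> w)"
        by (simp add: C'_def algebra_simps add_divide_distrib)
      then show "\<exists>c. L2_norm \<Omega> (\<lambda>x. w x - c) \<le> C' * L2_norm \<Omega> (grad \<Omega> w) \<and> ((\<lambda>x. 1) \<notin> H1D \<Omega> \<Gamma>D \<longrightarrow> c = 0)"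
        by (intro exI[of _ 0]) simp
    qed
  qed
qed

text \<open>The slack \<open>\<epsilon>\<close> spares the passage to the limit of the constants \<open>c\<close>.\<close>

lemma poincare_H1D:
  fixes \<Omega> \<Gamma>D :: "'a::euclidean_space set"
  assumes dom: "polyhedral_lipschitz_domain \<Omega>"
  obtains C where "C \<ge> 0"
    "\<And>v \<epsilon>. v \<in> H1D \<Omega> \<Gamma>D \<Longrightarrow> \<epsilon> > 0 \<Longrightarrow> \<exists>c. L2_norm \<Omega> (\<lambda>x. v x - c) \<le> C * L2_norm \<Omega> (grad \<Omega> v) + \<epsilon> \<and>
        ((\<lambda>x. 1) \<notin> H1D \<Omega> \<Gamma>D \<longrightarrow> c = 0)"
proof -
  have \<Omega>: "open \<Omega>" "bounded \<Omega>" using assms by (auto simp: polyhedral_lipschitz_domain_def)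
  obtain C where C: "C \<ge> 0"
    "\<And>w. w \<in> CinfD \<Gamma>D \<Longrightarrow> \<exists>c. L2_norm \<Omega> (\<lambda>x. w x - c) \<le> C * L2_norm \<Omega> (grad \<Omega> w) \<and>
        ((\<lambda>x. 1) \<notin> H1D \<Omega> \<Gamma>D \<longrightarrow> c = 0)"
    using poincare_CinfD[OF dom, of \<Gamma>D] by blast
  show thesis
  proof (rule that[OF C(1)])
    fix v and \<epsilon> :: real assume v: "v \<in> H1D \<Omega> \<Gamma>D" and "\<epsilon> > 0"
    define \<delta> where "\<delta> = \<epsilon> / (1 + C)"
    have \<delta>: "\<delta> > 0" using \<open>\<epsilon> > 0\<close> C by (simp add: \<delta>_def)
    from v \<delta> obtain w where w: "w \<in> CinfD \<Gamma>D" "H1_norm \<Omega> (\<lambda>x. v x - w x) < \<delta>" unfolding H1D_def by blast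
    have vH: "v \<in> H1 \<Omega>" using v by (simp add: H1D_def)
    have wH: "w \<in> H1 \<Omega>" using w by (intro smooth_in_H1[OF \<Omega>]) (simp add: CinfD_def)
    have vw: "(\<lambda>x. v x - w x) \<in> H1 \<Omega>" using H1_lincomb(1)[OF \<Omega> vH wH, of 1 "-1"] by simp
    have 1: "L2_norm \<Omega> (\<lambda>x. v x - w x) \<le> \<delta>" using H1_norm_ge(1)[OF vw] w(2) by simp
    have 2: "L2_norm \<Omega> (\<lambda>x. grad \<Omega> v x - grad \<Omega> w x) \<le> \<delta>"
      using L2_norm_grad_lincomb[OF \<Omega> vH wH, of 1 "-1"] H1_norm_ge(2)[OF vw] w(2) by simp
    obtain c where c: "L2_norm \<Omega> (\<lambda>x. w x - c) \<le> C * L2_norm \<Omega> (grad \<Omega> w)" "(\<lambda>x. 1) \<notin> H1D \<Omega> \<Gamma>D \<longrightarrow> c = 0"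
      using C(2)[OF w(1)] by blast
    have cL: "(\<lambda>x. c) \<in> L2 \<Omega>" using H1_imp_L2[OF smooth_in_H1[OF \<Omega> smooth_const]] .
    have "L2_norm \<Omega> (\<lambda>x. v x - c) \<le> L2_norm \<Omega> (\<lambda>x. w x - c) + L2_norm \<Omega> (\<lambda>x. v x - w x)"
      using L2_norm_triangle_diff[OF L2_diff[OF H1_imp_L2[OF vH] cL] L2_diff[OF H1_imp_L2[OF wH] cL]] by simp
    also have "\<dots> \<le> C * L2_norm \<Omega> (grad \<Omega> w) + \<delta>" using 1 c by simp
    also have "L2_norm \<Omega> (grad \<Omega> w) \<le> L2_norm \<Omega> (grad \<Omega> v) + \<delta>"
      using L2_norm_triangle_diff[OF grad_in_L2[OF wH] grad_in_L2[OF vH]] 2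
        L2_norm_minus_commute[of \<Omega> "grad \<Omega> w" "grad \<Omega> v"] by linarith
    then have "C * L2_norm \<Omega> (grad \<Omega> w) + \<delta> \<le> C * (L2_norm \<Omega> (grad \<Omega> v) + \<delta>) + \<delta>"
      using C(1) by (intro add_right_mono mult_left_mono)
    also have "\<dots> = C * L2_norm \<Omega> (grad \<Omega> v) + \<epsilon>"
    proof -
      have "(1 + C) * \<delta> = \<epsilon>" using C(1) by (simp add: \<delta>_def)
      then show ?thesis by (simp add: algebra_simps)
    qed
    finally show "\<exists>c. L2_norm \<Omega> (\<lambda>x. v x - c) \<le> C * L2_norm \<Omega> (grad \<Omega> v) + \<epsilon> \<and> ((\<lambda>x. 1) \<notin> H1D \<Omega> \<Gamma>D \<longrightarrow> c = 0)"
      using c(2) by blast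
  qed
qed

section \<open>Primitives of Bochner integrable functions\<close>

lemma L2_simpleI:
  fixes n :: nat
  assumes "\<And>k. k < n \<Longrightarrow> A k \<in> lmeasurable" "\<And>k. k < n \<Longrightarrow> g k \<in> L2 \<Omega>"
    "s = (\<lambda>t x. \<Sum>k<n. indicator (A k) t * g k x)"
  shows "L2_simple \<Omega> s"
  unfolding L2_simple_def
  by (rule exI[of _ n], rule exI[of _ A], rule exI[of _ g]) (intro conjI allI impI assms)

lemma L2_simpleE:
  assumes "L2_simple \<Omega> s"
  obtains n :: nat and A g where "\<forall>k<n. A k \<in> lmeasurable" "\<forall>k<n. g k \<in> L2 \<Omega>"
    "s = (\<lambda>t x. \<Sum>k<n. indicator (A k) t * g k x)"
proof -
  from assms obtain n :: nat and A g where
    *: "(\<forall>k<n. A k \<in> lmeasurable \<and> g k \<in> L2 \<Omega>) \<and> s = (\<lambda>t x. \<Sum>k<n. indicator (A k) t * g k x)"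
    unfolding L2_simple_def by (elim exE)
  show thesis by (rule that[of n A g]) (use * in blast)+
qed

lemma L2_simple_L2:
  assumes "L2_simple \<Omega> s"
  shows "s t \<in> L2 \<Omega>"
proof -
  obtain n :: nat and A g where s': "\<forall>k<n. A k \<in> lmeasurable" "\<forall>k<n. g k \<in> L2 \<Omega>"
     "s = (\<lambda>t x. \<Sum>k<n. indicator (A k) t * g k x)"
    by (rule L2_simpleE[OF assms])
  note s = s'(1,2)[rule_format] s'(3)
  show ?thesis unfolding s(3) using s(2) by (intro L2_sum L2_cmult) auto
qed

lemma L2_simple_zero: "L2_simple \<Omega> (\<lambda>t x. 0)"
  by (rule L2_simpleI[of 0]) auto

lemma L2_simple_indicator:
  assumes "L2_simple \<Omega> s" "B \<in> sets lebesgue"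
  shows "L2_simple \<Omega> (\<lambda>t x. indicator B t * s t x)"
proof -
  obtain n :: nat and A g where s': "\<forall>k<n. A k \<in> lmeasurable" "\<forall>k<n. g k \<in> L2 \<Omega>"
     "s = (\<lambda>t x. \<Sum>k<n. indicator (A k) t * g k x)"
    by (rule L2_simpleE[OF assms(1)])
  note s = s'(1,2)[rule_format] s'(3)
  have "(\<lambda>t x. indicator B t * s t x) = (\<lambda>t x. \<Sum>k<n. indicator (A k \<inter> B) t * g k x)"
    unfolding s(3) by (simp only: sum_distrib_left indicator_inter_arith mult_ac)
  then show ?thesis
    using s(1,2) assms(2) by (intro L2_simpleI[of n "\<lambda>k. A k \<inter> B" g]) (auto intro: fmeasurable_Int_fmeasurable)
qed

lemma sum_lessThan_add: "(\<Sum>k<n + m. h k) = (\<Sum>k<n. h k) + (\<Sum>k<m. h (n + k))" for h :: "nat \<Rightarrow> real"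
  by (induction m) (auto simp: add_ac)

lemma L2_simple_diff:
  assumes "L2_simple \<Omega> s" "L2_simple \<Omega> r"
  shows "L2_simple \<Omega> (\<lambda>t x. s t x - r t x)"
proof -
  obtain n :: nat and A g where s': "\<forall>k<n. A k \<in> lmeasurable" "\<forall>k<n. g k \<in> L2 \<Omega>"
     "s = (\<lambda>t x. \<Sum>k<n. indicator (A k) t * g k x)"
    by (rule L2_simpleE[OF assms(1)])
  note s = s'(1,2)[rule_format] s'(3)
  obtain m :: nat and B h where r': "\<forall>k<m. B k \<in> lmeasurable" "\<forall>k<m. h k \<in> L2 \<Omega>"
     "r = (\<lambda>t x. \<Sum>k<m. indicator (B k) t * h k x)"
    by (rule L2_simpleE[OF assms(2)])
  note r = r'(1,2)[rule_format] r'(3)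
  define A' where "A' k = (if k < n then A k else B (k - n))" for k
  define g' where "g' k = (if k < n then g k else (\<lambda>x. - 1 * h (k - n) x))" for k
  have "(\<lambda>t x. s t x - r t x) = (\<lambda>t x. \<Sum>k<n + m. indicator (A' k) t * g' k x)"
    by (simp add: s(3) r(3) sum_lessThan_add A'_def g'_def sum_negf)
  moreover have "A' k \<in> lmeasurable" "g' k \<in> L2 \<Omega>" if "k < n + m" for k
    using that s(1,2) r(1)[of "k - n"] L2_cmult[OF r(2), of "k - n" "-1"]
    by (cases "k < n"; simp add: A'_def g'_def)+
  ultimately show ?thesis by (intro L2_simpleI[of "n + m" A' g'])
qed

lemma L2_simple_norm_measurable:
  assumes "L2_simple \<Omega> s"
  shows "(\<lambda>t. L2_norm \<Omega> (s t)) \<in> borel_measurable lebesgue"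
proof -
  obtain n :: nat and A g where s': "\<forall>k<n. A k \<in> lmeasurable" "\<forall>k<n. g k \<in> L2 \<Omega>"
     "s = (\<lambda>t x. \<Sum>k<n. indicator (A k) t * g k x)"
    by (rule L2_simpleE[OF assms])
  note s = s'(1,2)[rule_format] s'(3)
  define c where "c k j = (LINT x|lebesgue_on \<Omega>. g k x * g j x)" for k j
  have "L2_norm \<Omega> (s t) = sqrt (\<Sum>k<n. \<Sum>j<n. indicator (A k) t * indicator (A j) t * c k j)" for t
  proof -
    have "(L2_norm \<Omega> (s t))\<^sup>2 = (LINT x|lebesgue_on \<Omega>. (\<Sum>k<n. \<Sum>j<n. indicator (A k) t * indicator (A j) t * (g k x * g j x)))"
      unfolding L2_norm_power2_real s(3) by (simp only: sum_product mult_ac)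
    also have "\<dots> = (\<Sum>k<n. \<Sum>j<n. indicator (A k) t * indicator (A j) t * c k j)"
    proof -
      have int: "integrable (lebesgue_on \<Omega>) (\<lambda>x. indicator (A k) t * indicator (A j) t * (g k x * g j x))"
        if "k \<in> {..<n}" "j \<in> {..<n}" for k j
        using s(2) that by (intro integrable_mult_right L2_mult_integrable) auto
      have "(LINT x|lebesgue_on \<Omega>. (\<Sum>k<n. \<Sum>j<n. indicator (A k) t * indicator (A j) t * (g k x * g j x)))
          = (\<Sum>k<n. LINT x|lebesgue_on \<Omega>. (\<Sum>j<n. indicator (A k) t * indicator (A j) t * (g k x * g j x)))"
        by (intro Bochner_Integration.integral_sum Bochner_Integration.integrable_sum int)
      also have "\<dots> = (\<Sum>k<n. \<Sum>j<n. LINT x|lebesgue_on \<Omega>. indicator (A k) t * indicator (A j) t * (g k x * g j x))"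
        by (intro sum.cong refl Bochner_Integration.integral_sum int)
      also have "\<dots> = (\<Sum>k<n. \<Sum>j<n. indicator (A k) t * indicator (A j) t * c k j)"
        unfolding c_def by (intro sum.cong refl integral_mult_right_zero)
      finally show ?thesis .
    qed
    finally show ?thesis by (metis L2_norm_nonneg real_sqrt_unique)
  qed
  moreover have "(\<lambda>t. sqrt (\<Sum>k<n. \<Sum>j<n. indicator (A k) t * indicator (A j) t * c k j)) \<in> borel_measurable lebesgue"
  proof (rule measurable_compose[OF _ borel_measurable_sqrt])
    show "(\<lambda>t. \<Sum>k<n. \<Sum>j<n. indicator (A k) t * indicator (A j) t * c k j) \<in> borel_measurable lebesgue"
      using s(1) by (intro borel_measurable_sum borel_measurable_times borel_measurable_indicator) auto
  qed
  ultimately show ?thesis by simp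
qed

text \<open>Minkowski's inequality by duality: with \<open>I = \<integral> s\<close>, \<open>\<parallel>I\<parallel>\<^sup>2 = \<integral> (s t, I) dt \<le> \<parallel>I\<parallel> \<integral> \<parallel>s t\<parallel> dt\<close>.\<close>

lemma L2_simple_integral:
  assumes "L2_simple \<Omega> s" and J: "J \<in> sets lebesgue"
  shows "(\<lambda>x. LINT t|lebesgue_on J. s t x) \<in> L2 \<Omega>"
    and "ennreal (L2_norm \<Omega> (\<lambda>x. LINT t|lebesgue_on J. s t x)) \<le> (\<integral>\<^sup>+t. ennreal (L2_norm \<Omega> (s t)) \<partial>lebesgue_on J)"
    and "integrable (lebesgue_on J) (\<lambda>t. s t x)"
proof -
  obtain n :: nat and A g where s': "\<forall>k<n. A k \<in> lmeasurable" "\<forall>k<n. g k \<in> L2 \<Omega>"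
     "s = (\<lambda>t x. \<Sum>k<n. indicator (A k) t * g k x)"
    by (rule L2_simpleE[OF assms(1)])
  note s = s'(1,2)[rule_format] s'(3)
  define m where "m k = (LINT t|lebesgue_on J. indicator (A k) t :: real)" for k
  have Ai: "integrable (lebesgue_on J) (\<lambda>t. indicator (A k) t :: real)" if "k < n" for k
  proof -
    have "integrable lebesgue (indicator (A k) :: real \<Rightarrow> real)"
      using fmeasurableD[OF s(1)[OF that]] fmeasurableD2[OF s(1)[OF that]]
      by (intro integrable_real_indicator) (auto simp: less_top)
    then show ?thesis
      using J integrable_mult_indicator[of J lebesgue "indicator (A k) :: real \<Rightarrow> real"]
      by (simp add: integrable_restrict_space)
  qed
  show int: "integrable (lebesgue_on J) (\<lambda>t. s t x)" for x
    unfolding s(3) using Ai by (intro Bochner_Integration.integrable_sum integrable_mult_left) auto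
  define I where "I x = (LINT t|lebesgue_on J. s t x)" for x
  have I: "I = (\<lambda>x. \<Sum>k<n. m k * g k x)"
    unfolding I_def s(3) m_def using Ai by (intro ext, subst Bochner_Integration.integral_sum) auto
  have IL: "I \<in> L2 \<Omega>" unfolding I using s(2) by (intro L2_sum L2_cmult) auto
  show "(\<lambda>x. LINT t|lebesgue_on J. s t x) \<in> L2 \<Omega>" using IL by (simp add: I_def[abs_def])
  define c where "c k = (LINT x|lebesgue_on \<Omega>. g k x * I x)" for k
  note gi = L2_mult_integrable[OF s(2) IL]
  have I2: "(L2_norm \<Omega> I)\<^sup>2 = (\<Sum>k<n. m k * c k)"
  proof -
    have "(L2_norm \<Omega> I)\<^sup>2 = (LINT x|lebesgue_on \<Omega>. (\<Sum>k<n. m k * (g k x * I x)))"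
    proof -
      have "I x * I x = (\<Sum>k<n. m k * (g k x * I x))" for x
        by (subst (1) I) (simp only: sum_distrib_right mult.assoc)
      then show ?thesis unfolding L2_norm_power2_real by simp
    qed
    then show ?thesis
      unfolding c_def using gi by (subst (asm) Bochner_Integration.integral_sum) auto
  qed
  have pair: "(LINT x|lebesgue_on \<Omega>. s t x * I x) = (\<Sum>k<n. indicator (A k) t * c k)" for t
  proof -
    have "(LINT x|lebesgue_on \<Omega>. s t x * I x) = (LINT x|lebesgue_on \<Omega>. (\<Sum>k<n. indicator (A k) t * (g k x * I x)))"
      unfolding s(3) by (simp only: sum_distrib_right mult.assoc)
    then show ?thesis
      unfolding c_def using gi by (subst (asm) Bochner_Integration.integral_sum) auto
  qed
  have pi: "integrable (lebesgue_on J) (\<lambda>t. \<Sum>k<n. indicator (A k) t * c k)"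
    using Ai by (intro Bochner_Integration.integrable_sum integrable_mult_left) auto
  have "(\<Sum>k<n. m k * c k) = (LINT t|lebesgue_on J. (\<Sum>k<n. indicator (A k) t * c k))"
    unfolding m_def using Ai by (subst Bochner_Integration.integral_sum) auto
  also have "ennreal \<dots> \<le> (\<integral>\<^sup>+t. ennreal (norm (\<Sum>k<n. indicator (A k) t * c k)) \<partial>lebesgue_on J)"
    by (rule order_trans[OF ennreal_leI integral_norm_bound_ennreal[OF pi]])
      (simp only: real_norm_def abs_ge_self)
  also have "\<dots> \<le> (\<integral>\<^sup>+t. ennreal (L2_norm \<Omega> I) * ennreal (L2_norm \<Omega> (s t)) \<partial>lebesgue_on J)"
  proof (rule nn_integral_mono)
    fix t
    have "norm (\<Sum>k<n. indicator (A k) t * c k) \<le> L2_norm \<Omega> (s t) * L2_norm \<Omega> I"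
      using L2_Cauchy_Schwarz_real[OF L2_simple_L2[OF assms(1)] IL, of t] by (simp add: pair)
    then have "ennreal (norm (\<Sum>k<n. indicator (A k) t * c k)) \<le> ennreal (L2_norm \<Omega> I * L2_norm \<Omega> (s t))"
      by (intro ennreal_leI) (simp add: mult.commute)
    then show "ennreal (norm (\<Sum>k<n. indicator (A k) t * c k)) \<le> ennreal (L2_norm \<Omega> I) * ennreal (L2_norm \<Omega> (s t))"
      by (simp add: ennreal_mult)
  qed
  also have "\<dots> = ennreal (L2_norm \<Omega> I) * (\<integral>\<^sup>+t. ennreal (L2_norm \<Omega> (s t)) \<partial>lebesgue_on J)"
    using L2_simple_norm_measurable[OF assms(1)]
    by (intro nn_integral_cmult) (auto intro: measurable_restrict_space1)
  finally have le: "ennreal ((L2_norm \<Omega> I)\<^sup>2) \<le> ennreal (L2_norm \<Omega> I) * (\<integral>\<^sup>+t. ennreal (L2_norm \<Omega> (s t)) \<partial>lebesgue_on J)"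
    by (simp add: I2)
  have "ennreal (L2_norm \<Omega> I) \<le> (\<integral>\<^sup>+t. ennreal (L2_norm \<Omega> (s t)) \<partial>lebesgue_on J)"
  proof (cases "\<integral>\<^sup>+t. ennreal (L2_norm \<Omega> (s t)) \<partial>lebesgue_on J")
    case (real q)
    then have "ennreal ((L2_norm \<Omega> I)\<^sup>2) \<le> ennreal (L2_norm \<Omega> I * q)"
      using le by (simp add: ennreal_mult)
    then have "L2_norm \<Omega> I * L2_norm \<Omega> I \<le> L2_norm \<Omega> I * q"
      using real(1) by (subst (asm) ennreal_le_iff) (auto simp: power2_eq_square)
    then have "L2_norm \<Omega> I \<le> q"
      using L2_norm_nonneg[of \<Omega> I] real(1) by (cases "L2_norm \<Omega> I = 0") (auto simp: mult_le_cancel_left)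
    then show ?thesis using real by (simp add: ennreal_leI)
  qed simp
  then show "ennreal (L2_norm \<Omega> (\<lambda>x. LINT t|lebesgue_on J. s t x)) \<le> (\<integral>\<^sup>+t. ennreal (L2_norm \<Omega> (s t)) \<partial>lebesgue_on J)"
    by (simp add: I_def[abs_def])
qed

lemma L1_L2_norm_diff_measurable:
  assumes f: "f \<in> L1_L2 J \<Omega>" and J: "J \<in> sets lebesgue" and S: "L2_simple \<Omega> S"
  shows "(\<lambda>t. L2_norm \<Omega> (\<lambda>x. f t x - S t x)) \<in> borel_measurable (lebesgue_on J)"
proof -
  obtain s where s: "\<And>i. L2_simple \<Omega> (s i)"
     "AE t in lebesgue_on J. (\<lambda>i. L2_norm \<Omega> (\<lambda>x. f t x - s i t x)) \<longlonglongrightarrow> 0"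
    using f unfolding L1_L2_def by blast
  have fL: "f t \<in> L2 \<Omega>" if "t \<in> J" for t using f that by (auto simp: L1_L2_def)
  let ?h = "\<lambda>t. lim (\<lambda>i. L2_norm \<Omega> (\<lambda>x. s i t x - S t x))"
  have m: "?h \<in> borel_measurable (lebesgue_on J)"
    by (intro borel_measurable_lim_metric measurable_restrict_space1 L2_simple_norm_measurable L2_simple_diff s(1) S)
  have "AE t in lebesgue_on J. t \<in> J" by (rule AE_I2) simp
  with s(2) have "AE t in lebesgue_on J. ?h t = L2_norm \<Omega> (\<lambda>x. f t x - S t x)"
  proof eventually_elim
    case (elim t)
    have a: "f t \<in> L2 \<Omega>" "s i t \<in> L2 \<Omega>" "S t \<in> L2 \<Omega>" for i
      using fL[OF elim(2)] L2_simple_L2 s(1) S by auto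
    have "\<bar>L2_norm \<Omega> (\<lambda>x. s i t x - S t x) - L2_norm \<Omega> (\<lambda>x. f t x - S t x)\<bar> \<le> L2_norm \<Omega> (\<lambda>x. f t x - s i t x)" for i
      using L2_norm_triangle_diff[OF L2_diff[OF a(1,3)] L2_diff[OF a(2,3)], of i]
        L2_norm_triangle_diff[OF L2_diff[OF a(2,3)] L2_diff[OF a(1,3)], of i]
        L2_norm_minus_commute[of \<Omega> "f t" "s i t"] by simp
    then have "(\<lambda>i. L2_norm \<Omega> (\<lambda>x. s i t x - S t x) - L2_norm \<Omega> (\<lambda>x. f t x - S t x)) \<longlonglongrightarrow> 0"
      by (intro Lim_null_comparison[OF _ elim(1)] always_eventually) auto
    then show ?case by (intro limI) (simp add: LIM_zero_iff)
  qed
  then show ?thesis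
    by (rule borel_measurable_lebesgue_on_cong_AE[OF m _ J])
qed

lemma has_L2_bochner_integral_diff_bound:
  assumes F: "has_L2_bochner_integral \<Omega> {0..s} f Fs" "has_L2_bochner_integral \<Omega> {0..t} f Ft"
    and st: "0 \<le> s" "s \<le> t"
  shows "ennreal (L2_norm \<Omega> (\<lambda>x. Ft x - Fs x)) \<le> (\<integral>\<^sup>+r. ennreal (L2_norm \<Omega> (f r)) * indicator {s<..t} r \<partial>lebesgue)"
proof -
  obtain a where a: "\<And>i. L2_simple \<Omega> (a i)"
      "(\<lambda>i. \<integral>\<^sup>+r. ennreal (L2_norm \<Omega> (\<lambda>x. f r x - a i r x)) \<partial>lebesgue_on {0..t}) \<longlonglongrightarrow> 0"
      "(\<lambda>i. L2_norm \<Omega> (\<lambda>x. Ft x - (LINT r|lebesgue_on {0..t}. a i r x))) \<longlonglongrightarrow> 0"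
    using F(2) unfolding has_L2_bochner_integral_def by blast
  obtain b where b: "\<And>i. L2_simple \<Omega> (b i)"
      "(\<lambda>i. \<integral>\<^sup>+r. ennreal (L2_norm \<Omega> (\<lambda>x. f r x - b i r x)) \<partial>lebesgue_on {0..s}) \<longlonglongrightarrow> 0"
      "(\<lambda>i. L2_norm \<Omega> (\<lambda>x. Fs x - (LINT r|lebesgue_on {0..s}. b i r x))) \<longlonglongrightarrow> 0"
    using F(1) unfolding has_L2_bochner_integral_def by blast
  have f: "f \<in> L1_L2 {0..s} \<Omega>" "f \<in> L1_L2 {0..t} \<Omega>" and FL: "Fs \<in> L2 \<Omega>" "Ft \<in> L2 \<Omega>"
    using F by (auto simp: has_L2_bochner_integral_def)
  have fL: "f r \<in> L2 \<Omega>" if "r \<in> {0..t}" for r using f(2) that by (auto simp: L1_L2_def)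
  define N where "N = (\<integral>\<^sup>+r. ennreal (L2_norm \<Omega> (f r)) * indicator {s<..t} r \<partial>lebesgue)"
  define ea where "ea i = (\<integral>\<^sup>+r. ennreal (L2_norm \<Omega> (\<lambda>x. f r x - a i r x)) \<partial>lebesgue_on {0..t})" for i
  define eb where "eb i = (\<integral>\<^sup>+r. ennreal (L2_norm \<Omega> (\<lambda>x. f r x - b i r x)) \<partial>lebesgue_on {0..s})" for i
  define da where "da i = L2_norm \<Omega> (\<lambda>x. Ft x - (LINT r|lebesgue_on {0..t}. a i r x))" for i
  define db where "db i = L2_norm \<Omega> (\<lambda>x. Fs x - (LINT r|lebesgue_on {0..s}. b i r x))" for i
  have le: "ennreal (L2_norm \<Omega> (\<lambda>x. Ft x - Fs x)) \<le> ennreal (da i) + ennreal (db i) + (ea i + eb i + N)" for i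
  proof -
    define S where "S r x = a i r x - indicator {0..s} r * b i r x" for r x
    have S: "L2_simple \<Omega> S"
      unfolding S_def[abs_def] by (intro L2_simple_diff a L2_simple_indicator b) auto
    define IA where "IA x = (LINT r|lebesgue_on {0..t}. a i r x)" for x
    define IB where "IB x = (LINT r|lebesgue_on {0..s}. b i r x)" for x
    have IL: "IA \<in> L2 \<Omega>" "IB \<in> L2 \<Omega>"
      unfolding IA_def[abs_def] IB_def[abs_def] by (intro L2_simple_integral(1) a b; simp)+
    have IS: "(LINT r|lebesgue_on {0..t}. S r x) = IA x - IB x" for x
    proof -
      have "(LINT r|lebesgue_on {0..t}. indicator {0..s} r * b i r x) = IB x"
        unfolding IB_def using st
        by (simp add: integral_restrict_space) (auto intro!: Bochner_Integration.integral_cong simp: indicator_def)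
      moreover have "(LINT r|lebesgue_on {0..t}. S r x)
         = IA x - (LINT r|lebesgue_on {0..t}. indicator {0..s} r * b i r x)"
        unfolding S_def IA_def
        by (intro Bochner_Integration.integral_diff L2_simple_integral(3)[of \<Omega>] a L2_simple_indicator b) auto
      ultimately show ?thesis by simp
    qed
    have "ennreal (L2_norm \<Omega> (\<lambda>x. IA x - IB x)) \<le> (\<integral>\<^sup>+r. ennreal (L2_norm \<Omega> (S r)) \<partial>lebesgue_on {0..t})"
      using L2_simple_integral(2)[OF S, of "{0..t}"] unfolding IS by simp
    also have "\<dots> \<le> (\<integral>\<^sup>+r. ennreal (L2_norm \<Omega> (\<lambda>x. f r x - a i r x)) +
         (ennreal (L2_norm \<Omega> (\<lambda>x. f r x - b i r x)) * indicator {0..s} r + ennreal (L2_norm \<Omega> (f r)) * indicator {s<..t} r) \<partial>lebesgue_on {0..t})"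
    proof (rule nn_integral_mono)
      fix r assume "r \<in> space (lebesgue_on {0..t})"
      then have r: "r \<in> {0..t}" by simp
      note L = fL[OF r] L2_simple_L2[OF a(1), of i r] L2_simple_L2[OF b(1), of i r]
      show "ennreal (L2_norm \<Omega> (S r)) \<le> ennreal (L2_norm \<Omega> (\<lambda>x. f r x - a i r x)) +
         (ennreal (L2_norm \<Omega> (\<lambda>x. f r x - b i r x)) * indicator {0..s} r + ennreal (L2_norm \<Omega> (f r)) * indicator {s<..t} r)"
      proof (cases "r \<le> s")
        case True
        have "L2_norm \<Omega> (S r) \<le> L2_norm \<Omega> (\<lambda>x. f r x - b i r x) + L2_norm \<Omega> (\<lambda>x. f r x - a i r x)"
          using L2_norm_triangle_minus[OF L2_diff[OF L(1,3)] L2_diff[OF L(1,2)]] r True by (simp add: S_def[abs_def])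
        then show ?thesis
          using r True by (simp add: add.commute flip: ennreal_plus) 
      next
        case False
        have "L2_norm \<Omega> (S r) \<le> L2_norm \<Omega> (f r) + L2_norm \<Omega> (\<lambda>x. f r x - a i r x)"
          using L2_norm_triangle_minus[OF L(1) L2_diff[OF L(1,2)]] r False by (simp add: S_def[abs_def])
        then show ?thesis
          using r False by (simp add: add.commute flip: ennreal_plus)
      qed
    qed
    also have "\<dots> = ea i + (eb i + N)"
    proof -
      have m1: "(\<lambda>r. ennreal (L2_norm \<Omega> (\<lambda>x. f r x - a i r x))) \<in> borel_measurable (lebesgue_on {0..t})"
        using L1_L2_norm_diff_measurable[OF f(2) _ a(1), of i] by simp
      have m2: "(\<lambda>r. ennreal (L2_norm \<Omega> (\<lambda>x. f r x - b i r x)) * indicator {0..s} r) \<in> borel_measurable (lebesgue_on {0..t})"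
        using L1_L2_norm_diff_measurable[OF f(2) _ b(1), of i] st
        by (intro borel_measurable_times_ennreal borel_measurable_indicator) (auto simp: sets_restrict_space_iff)
      have m3: "(\<lambda>r. ennreal (L2_norm \<Omega> (f r)) * indicator {s<..t} r) \<in> borel_measurable (lebesgue_on {0..t})"
        using L1_L2_norm_diff_measurable[OF f(2) _ L2_simple_zero] st
        by (intro borel_measurable_times_ennreal borel_measurable_indicator) (auto simp: sets_restrict_space_iff)
      have "(\<integral>\<^sup>+r. ennreal (L2_norm \<Omega> (\<lambda>x. f r x - b i r x)) * indicator {0..s} r \<partial>lebesgue_on {0..t}) = eb i"
        unfolding eb_def using st
        by (simp add: nn_integral_restrict_space) (auto intro!: nn_integral_cong simp: indicator_def)
      moreover have "(\<integral>\<^sup>+r. ennreal (L2_norm \<Omega> (f r)) * indicator {s<..t} r \<partial>lebesgue_on {0..t}) = N"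
        unfolding N_def using st
        by (simp add: nn_integral_restrict_space) (auto intro!: nn_integral_cong simp: indicator_def)
      ultimately show ?thesis
        using m1 m2 m3 by (simp add: nn_integral_add ea_def)
    qed
    finally have AB: "ennreal (L2_norm \<Omega> (\<lambda>x. IA x - IB x)) \<le> ea i + eb i + N" by (simp add: add.assoc)
    have "L2_norm \<Omega> (\<lambda>x. Ft x - Fs x) \<le> L2_norm \<Omega> (\<lambda>x. IA x - IB x) + (da i + db i)"
    proof -
      have "L2_norm \<Omega> (\<lambda>x. Ft x - Fs x) \<le> L2_norm \<Omega> (\<lambda>x. IA x - IB x) + L2_norm \<Omega> (\<lambda>x. (Ft x - Fs x) - (IA x - IB x))"
        by (intro L2_norm_triangle_diff L2_diff FL IL)
      also have "(\<lambda>x. (Ft x - Fs x) - (IA x - IB x)) = (\<lambda>x. (Ft x - IA x) - (Fs x - IB x))" by auto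
      also have "L2_norm \<Omega> \<dots> \<le> L2_norm \<Omega> (\<lambda>x. Ft x - IA x) + L2_norm \<Omega> (\<lambda>x. Fs x - IB x)"
        by (intro L2_norm_triangle_minus L2_diff FL IL)
      finally show ?thesis by (simp add: da_def db_def IA_def IB_def)
    qed
    then have "ennreal (L2_norm \<Omega> (\<lambda>x. Ft x - Fs x)) \<le> ennreal (L2_norm \<Omega> (\<lambda>x. IA x - IB x) + (da i + db i))"
      by (rule ennreal_leI)
    also have "\<dots> = (ennreal (da i) + ennreal (db i)) + ennreal (L2_norm \<Omega> (\<lambda>x. IA x - IB x))"
      by (simp add: da_def db_def add.commute)
    also have "\<dots> \<le> (ennreal (da i) + ennreal (db i)) + (ea i + eb i + N)"
      by (intro add_left_mono AB)
    finally show ?thesis .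
  qed
  have "(\<lambda>i. ennreal (da i) + ennreal (db i) + (ea i + eb i + N)) \<longlonglongrightarrow> ennreal 0 + ennreal 0 + (0 + 0 + N)"
    using a b unfolding da_def db_def ea_def eb_def by (intro tendsto_add tendsto_ennrealI tendsto_const)
  then have "ennreal (L2_norm \<Omega> (\<lambda>x. Ft x - Fs x)) \<le> ennreal 0 + ennreal 0 + (0 + 0 + N)"
    by (rule LIMSEQ_le_const) (use le in auto)
  then show ?thesis by (simp add: N_def)
qed

lemma has_L2_bochner_integral_null:
  assumes "has_L2_bochner_integral \<Omega> {0..0} f G"
  shows "L2_norm \<Omega> G = 0"
proof -
  obtain s where "\<And>i. L2_simple \<Omega> (s i)"
      "(\<lambda>i. \<integral>\<^sup>+r. ennreal (L2_norm \<Omega> (\<lambda>x. f r x - s i r x)) \<partial>lebesgue_on {0..0}) \<longlonglongrightarrow> 0"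
      and s: "(\<lambda>i. L2_norm \<Omega> (\<lambda>x. G x - (LINT t|lebesgue_on {0..0}. s i t x))) \<longlonglongrightarrow> 0"
    using assms unfolding has_L2_bochner_integral_def by blast
  have "(LINT t|lebesgue_on {0..0::real}. g t) = 0" for g :: "real \<Rightarrow> real"
  proof (rule integral_eq_zero_AE)
    have "{0} \<in> null_sets (lebesgue :: real measure)"
      using negligible_sing negligible_iff_null_sets by blast
    then have "AE t in lebesgue. t \<notin> {0::real}" by (rule AE_not_in)
    then have "AE t in lebesgue. t \<in> {0..0::real} \<longrightarrow> g t = 0"
      by eventually_elim simp
    then show "AE t in lebesgue_on {0..0}. g t = 0"
      by (subst AE_restrict_space_iff) auto
  qed
  then have "(\<lambda>i::nat. L2_norm \<Omega> G) \<longlonglongrightarrow> 0" using s by simp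
  then show ?thesis by (simp add: LIMSEQ_const_iff)
qed

lemma bochner_primitive_variation:
  fixes f :: "real \<Rightarrow> 'a::euclidean_space \<Rightarrow> real"
  assumes f: "f \<in> L1_L2 {0..T} \<Omega>" and "0 \<le> T"
    and F: "\<And>t. t \<in> {0..T} \<Longrightarrow> has_L2_bochner_integral \<Omega> {0..t} f (F t)"
  obtains \<phi> B where "\<And>s t. 0 \<le> s \<Longrightarrow> s \<le> t \<Longrightarrow> t \<le> T \<Longrightarrow> L2_norm \<Omega> (\<lambda>x. F t x - F s x) \<le> \<phi> t - \<phi> s"
    "\<And>t. 0 \<le> t \<Longrightarrow> t \<le> T \<Longrightarrow> L2_norm \<Omega> (F t) \<le> \<phi> t" "\<And>t. 0 \<le> t \<Longrightarrow> t \<le> T \<Longrightarrow> 0 \<le> \<phi> t \<and> \<phi> t \<le> B"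
proof -
  define n where "n J = (\<integral>\<^sup>+r. ennreal (L2_norm \<Omega> (f r)) * indicator J r \<partial>lebesgue)" for J
  have nT: "n {0..T} < \<infinity>"
    using f unfolding n_def L1_L2_def by (auto simp: nn_integral_restrict_space)
  have mono: "n J \<le> n J'" if "J \<subseteq> J'" for J J'
    unfolding n_def using that by (intro nn_integral_mono mult_left_mono) (auto simp: indicator_def)
  have fin: "n {0..t} < \<infinity>" if "t \<le> T" for t
    using mono[of "{0..t}" "{0..T}"] nT that by (auto intro: le_less_trans)
  define \<phi> where "\<phi> t = enn2real (n {0..t})" for t
  have diff: "L2_norm \<Omega> (\<lambda>x. F t x - F s x) \<le> \<phi> t - \<phi> s" if st: "0 \<le> s" "s \<le> t" "t \<le> T" for s t
  proof -
    have m: "(\<lambda>r. ennreal (L2_norm \<Omega> (f r)) * indicator {0..T} r) \<in> borel_measurable lebesgue"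
    proof -
      have "(\<lambda>r. L2_norm \<Omega> (f r)) \<in> borel_measurable (lebesgue_on {0..T})"
        using L1_L2_norm_diff_measurable[OF f _ L2_simple_zero] by simp
      then have "(\<lambda>r. if r \<in> {0..T} then L2_norm \<Omega> (f r) else 0) \<in> borel_measurable lebesgue"
        by (subst borel_measurable_if) auto
      then have "(\<lambda>r. ennreal (if r \<in> {0..T} then L2_norm \<Omega> (f r) else 0)) \<in> borel_measurable lebesgue"
        by measurable
      also have "(\<lambda>r. ennreal (if r \<in> {0..T} then L2_norm \<Omega> (f r) else 0))
          = (\<lambda>r. ennreal (L2_norm \<Omega> (f r)) * indicator {0..T} r)"
        by (auto simp: fun_eq_iff indicator_def)
      finally show ?thesis .
    qed
    have m': "(\<lambda>r. ennreal (L2_norm \<Omega> (f r)) * indicator J r) \<in> borel_measurable lebesgue"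
      if "J \<subseteq> {0..T}" "J \<in> sets lebesgue" for J
    proof -
      have "(\<lambda>r. (ennreal (L2_norm \<Omega> (f r)) * indicator {0..T} r) * indicator J r) \<in> borel_measurable lebesgue"
        by (rule borel_measurable_times_ennreal[OF m borel_measurable_indicator[OF that(2)]])
      also have "(\<lambda>r. (ennreal (L2_norm \<Omega> (f r)) * indicator {0..T} r) * indicator J r)
         = (\<lambda>r. ennreal (L2_norm \<Omega> (f r)) * indicator J r)"
        using that by (auto simp: indicator_def fun_eq_iff)
      finally show ?thesis .
    qed
    have "n {0..t} = n {0..s} + n {s<..t}"
    proof -
      have "n {0..t} = (\<integral>\<^sup>+r. ennreal (L2_norm \<Omega> (f r)) * indicator {0..s} r + ennreal (L2_norm \<Omega> (f r)) * indicator {s<..t} r \<partial>lebesgue)"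
        unfolding n_def using st by (intro nn_integral_cong) (auto simp: indicator_def)
      also have "\<dots> = n {0..s} + n {s<..t}"
        unfolding n_def using st by (intro nn_integral_add m') auto
      finally show ?thesis .
    qed
    moreover have fs: "n {0..s} < \<infinity>" "n {s<..t} < \<infinity>"
    proof -
      show "n {0..s} < \<infinity>" using fin[of s] st by simp
      have "n {s<..t} \<le> n {0..T}" using st by (intro mono) auto
      then show "n {s<..t} < \<infinity>" using nT by (rule le_less_trans)
    qed
    ultimately have "\<phi> t - \<phi> s = enn2real (n {s<..t})"
      unfolding \<phi>_def by (simp add: enn2real_plus)
    moreover have "ennreal (L2_norm \<Omega> (\<lambda>x. F t x - F s x)) \<le> n {s<..t}"
      unfolding n_def by (rule has_L2_bochner_integral_diff_bound[OF F F]) (use st in auto)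
    then have "L2_norm \<Omega> (\<lambda>x. F t x - F s x) \<le> enn2real (n {s<..t})"
      using enn2real_mono[of "ennreal (L2_norm \<Omega> (\<lambda>x. F t x - F s x))" "n {s<..t}"] fs(2) by simp
    ultimately show ?thesis by simp
  qed
  have FL: "F t \<in> L2 \<Omega>" if "0 \<le> t" "t \<le> T" for t
    using F[of t] that by (auto simp: has_L2_bochner_integral_def)
  have nrm: "L2_norm \<Omega> (F t) \<le> \<phi> t" if t: "0 \<le> t" "t \<le> T" for t
  proof -
    have "L2_norm \<Omega> (F t) \<le> L2_norm \<Omega> (F 0) + L2_norm \<Omega> (\<lambda>x. F t x - F 0 x)"
      using t \<open>0 \<le> T\<close> by (intro L2_norm_triangle_diff FL) auto
    moreover have "L2_norm \<Omega> (F 0) = 0"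
      using F[of 0] \<open>0 \<le> T\<close> by (intro has_L2_bochner_integral_null) auto
    moreover have "0 \<le> \<phi> 0" by (simp add: \<phi>_def)
    ultimately show ?thesis using diff[of 0 t] t by simp
  qed
  have bnd: "0 \<le> \<phi> t \<and> \<phi> t \<le> \<phi> T" if "0 \<le> t" "t \<le> T" for t
  proof
    show "0 \<le> \<phi> t" by (simp add: \<phi>_def)
    show "\<phi> t \<le> \<phi> T"
      using diff[of t T] that L2_norm_nonneg[of \<Omega> "\<lambda>x. F T x - F t x"] by linarith
  qed
  show thesis by (rule that[OF diff nrm bnd])
qed

section \<open>Energy estimates for the leapfrog scheme\<close>

lemma P1D_lincomb:
  assumes "v \<in> P1D \<Omega> \<Gamma>D M" "w \<in> P1D \<Omega> \<Gamma>D M"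
  shows "(\<lambda>x. a * v x + b * w x) \<in> P1D \<Omega> \<Gamma>D M"
proof -
  have "\<exists>c d. \<forall>x\<in>K. a * v x + b * w x = c \<bullet> x + d" if K: "K \<in> M" for K
  proof -
    obtain c1 d1 where 1: "\<forall>x\<in>K. v x = c1 \<bullet> x + d1" using assms(1) K unfolding P1D_def P1_def by blast
    obtain c2 d2 where 2: "\<forall>x\<in>K. w x = c2 \<bullet> x + d2" using assms(2) K unfolding P1D_def P1_def by blast
    show ?thesis
      by (rule exI[of _ "a *\<^sub>R c1 + b *\<^sub>R c2"], rule exI[of _ "a * d1 + b * d2"])
        (use 1 2 in \<open>auto simp: inner_add_left algebra_simps\<close>)
  qed
  then show ?thesis
    using assms by (auto simp: P1D_def P1_def intro!: continuous_intros)
qed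

lemma grad_inner_lincomb:
  assumes \<Omega>: "open \<Omega>" "bounded \<Omega>" and v: "v \<in> H1 \<Omega>" and w: "w \<in> H1 \<Omega>" and z: "z \<in> L2 \<Omega>"
  shows "(LINT x|lebesgue_on \<Omega>. z x \<bullet> grad \<Omega> (\<lambda>x. a * v x + b * w x) x)
    = a * (LINT x|lebesgue_on \<Omega>. z x \<bullet> grad \<Omega> v x) + b * (LINT x|lebesgue_on \<Omega>. z x \<bullet> grad \<Omega> w x)"
proof -
  note m = L2_D(1)[OF z] L2_D(1)[OF grad_in_L2[OF v]] L2_D(1)[OF grad_in_L2[OF w]]
    L2_D(1)[OF grad_in_L2[OF H1_lincomb(1)[OF \<Omega> v w, of a b]]]
  have "(LINT x|lebesgue_on \<Omega>. z x \<bullet> grad \<Omega> (\<lambda>x. a * v x + b * w x) x)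
     = (LINT x|lebesgue_on \<Omega>. a * (z x \<bullet> grad \<Omega> v x) + b * (z x \<bullet> grad \<Omega> w x))"
  proof (rule integral_cong_AE)
    show "AE x in lebesgue_on \<Omega>. z x \<bullet> grad \<Omega> (\<lambda>x. a * v x + b * w x) x
        = a * (z x \<bullet> grad \<Omega> v x) + b * (z x \<bullet> grad \<Omega> w x)"
      using H1_lincomb(2)[OF \<Omega> v w, of a b] by eventually_elim (simp add: inner_add_right)
    show "(\<lambda>x. z x \<bullet> grad \<Omega> (\<lambda>x. a * v x + b * w x) x) \<in> borel_measurable (lebesgue_on \<Omega>)"
      by (intro borel_measurable_inner m)
    show "(\<lambda>x. a * (z x \<bullet> grad \<Omega> v x) + b * (z x \<bullet> grad \<Omega> w x)) \<in> borel_measurable (lebesgue_on \<Omega>)"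
      by (intro borel_measurable_add borel_measurable_times borel_measurable_const borel_measurable_inner m)
  qed
  then show ?thesis
    using L2_inner_integrable[OF z grad_in_L2[OF v]] L2_inner_integrable[OF z grad_in_L2[OF w]] by simp
qed

locale leapfrog =
  fixes \<Omega> \<Gamma>D :: "'a::euclidean_space set" and M :: "'a set set"
    and \<eta> p0 p1 \<nu> :: "'a \<Rightarrow> real" and F :: "real \<Rightarrow> 'a \<Rightarrow> real"
    and \<tau> \<kappa> \<nu>m \<nu>p \<eta>p :: real and N :: nat
    and p :: "nat \<Rightarrow> 'a \<Rightarrow> real" and u :: "nat \<Rightarrow> 'a \<Rightarrow> 'a"
  assumes \<Omega>: "open \<Omega>" "bounded \<Omega>"
    and P1D_H1: "P1D \<Omega> \<Gamma>D M \<subseteq> H1 \<Omega>"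
    and inverse_estimate: "\<And>q. q \<in> P1D \<Omega> \<Gamma>D M \<Longrightarrow> L2_norm \<Omega> (grad \<Omega> q) \<le> \<kappa> * L2_norm \<Omega> q"
    and \<tau>: "0 < \<tau>" and \<kappa>: "0 \<le> \<kappa>" and cfl: "\<tau> * \<kappa> \<le> sqrt \<nu>m / sqrt 2" and \<nu>m: "0 < \<nu>m" "0 \<le> \<nu>p"
    and \<nu>: "\<nu> \<in> borel_measurable (lebesgue_on \<Omega>)" "AE x in lebesgue_on \<Omega>. \<nu>m \<le> \<nu> x \<and> \<nu> x \<le> \<nu>p"
    and \<eta>: "\<eta> \<in> borel_measurable (lebesgue_on \<Omega>)" "AE x in lebesgue_on \<Omega>. 0 \<le> \<eta> x \<and> \<eta> x \<le> \<eta>p" "0 \<le> \<eta>p"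
    and p0: "p0 \<in> H1 \<Omega>" and p1: "p1 \<in> L2 \<Omega>"
    and F: "\<And>l. l < N \<Longrightarrow> F (real l * \<tau> + \<tau> / 2) \<in> L2 \<Omega>"
    and N: "1 \<le> N"
    and sol: "leapfrog_solution \<Omega> \<Gamma>D M \<eta> p0 p1 F \<tau> N \<nu> p u"
begin

abbreviation V :: "('a \<Rightarrow> real) set" where
  "V \<equiv> P1D \<Omega> \<Gamma>D M"

abbreviation nrm :: "('a \<Rightarrow> 'b::euclidean_space) \<Rightarrow> real" where
  "nrm \<equiv> L2_norm \<Omega>"

abbreviation ip :: "('a \<Rightarrow> real) \<Rightarrow> ('a \<Rightarrow> real) \<Rightarrow> real" where
  "ip v w \<equiv> (LINT x|lebesgue_on \<Omega>. v x * w x)"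

abbreviation gp :: "('a \<Rightarrow> real) \<Rightarrow> ('a \<Rightarrow> real) \<Rightarrow> real" where
  "gp v w \<equiv> (LINT x|lebesgue_on \<Omega>. grad \<Omega> v x \<bullet> grad \<Omega> w x)"

abbreviation \<delta> :: "nat \<Rightarrow> 'a \<Rightarrow> real" where
  "\<delta> \<equiv> diff_p \<tau> p"

abbreviation FF :: "nat \<Rightarrow> 'a \<Rightarrow> real" where
  "FF l \<equiv> F (real l * \<tau> + \<tau> / 2)"

lemma p_P1D: "l \<le> N \<Longrightarrow> p l \<in> V"
  using sol by (simp add: leapfrog_solution_def)

lemma P1D_imp_H1: "q \<in> V \<Longrightarrow> q \<in> H1 \<Omega>"
  using P1D_H1 by auto

lemma P1D_imp_L2: "q \<in> V \<Longrightarrow> q \<in> L2 \<Omega>"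
  using P1D_imp_H1 H1_imp_L2 by blast

lemma \<delta>_P1D: "l < N \<Longrightarrow> \<delta> l \<in> V"
  using P1D_lincomb[OF p_P1D p_P1D, of "l + 1" l "1/\<tau>" "-1/\<tau>"] by (simp add: diff_p_def diff_divide_distrib)

lemma mean_P1D: "l < N \<Longrightarrow> mean_p p l \<in> V"
  using P1D_lincomb[OF p_P1D p_P1D, of "l + 1" l "1/2" "1/2"] by (simp add: mean_p_def add_divide_distrib)

lemma p_Suc_eq: "p (Suc l) = (\<lambda>x. 1 * mean_p p l x + (\<tau> / 2) * \<delta> l x)"
  using \<tau> by (simp add: mean_p_def diff_p_def field_simps)

lemma p_eq: "p l = (\<lambda>x. 1 * mean_p p l x + (- \<tau> / 2) * \<delta> l x)"
  using \<tau> by (simp add: mean_p_def diff_p_def field_simps)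

lemma gp_commute: "gp v w = gp w v"
  by (simp add: inner_commute)

lemma gp_self: "gp v v = (nrm (grad \<Omega> v))\<^sup>2"
  by (simp only: L2_norm_power2)

lemma gp_lincomb:
  assumes "v \<in> H1 \<Omega>" "w \<in> H1 \<Omega>" "z \<in> H1 \<Omega>"
  shows "gp z (\<lambda>x. a * v x + b * w x) = a * gp z v + b * gp z w"
    "gp (\<lambda>x. a * v x + b * w x) z = a * gp v z + b * gp w z"
proof -
  show *: "gp z (\<lambda>x. a * v x + b * w x) = a * gp z v + b * gp z w"
    by (rule grad_inner_lincomb[OF \<Omega> assms(1,2) grad_in_L2[OF assms(3)]])
  show "gp (\<lambda>x. a * v x + b * w x) z = a * gp v z + b * gp w z"
    using * by (simp only: gp_commute[of _ z])
qed

lemma \<nu>_mult: "v \<in> L2 \<Omega> \<Longrightarrow> (\<lambda>x. \<nu> x * v x) \<in> L2 \<Omega>" "v \<in> L2 \<Omega> \<Longrightarrow> nrm (\<lambda>x. \<nu> x * v x) \<le> \<nu>p * nrm v"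
proof -
  have "AE x in lebesgue_on \<Omega>. \<bar>\<nu> x\<bar> \<le> \<nu>p"
    using \<nu>(2) by eventually_elim (use \<nu>m in auto)
  from L2_bounded_mult[OF \<nu>(1) this, of v] \<nu>m
  show "v \<in> L2 \<Omega> \<Longrightarrow> (\<lambda>x. \<nu> x * v x) \<in> L2 \<Omega>" "v \<in> L2 \<Omega> \<Longrightarrow> nrm (\<lambda>x. \<nu> x * v x) \<le> \<nu>p * nrm v"
    by simp_all
qed

lemma \<eta>_mult: "v \<in> L2 \<Omega> \<Longrightarrow> (\<lambda>x. \<eta> x * v x) \<in> L2 \<Omega>" "v \<in> L2 \<Omega> \<Longrightarrow> nrm (\<lambda>x. \<eta> x * v x) \<le> \<eta>p * nrm v"
proof -
  have "AE x in lebesgue_on \<Omega>. \<bar>\<eta> x\<bar> \<le> \<eta>p"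
    using \<eta>(2) by eventually_elim (use \<eta>(3) in auto)
  from L2_bounded_mult[OF \<eta>(1) this, of v] \<eta>(3)
  show "v \<in> L2 \<Omega> \<Longrightarrow> (\<lambda>x. \<eta> x * v x) \<in> L2 \<Omega>" "v \<in> L2 \<Omega> \<Longrightarrow> nrm (\<lambda>x. \<eta> x * v x) \<le> \<eta>p * nrm v"
    by simp_all
qed

lemma \<nu>_ip_lower: "v \<in> L2 \<Omega> \<Longrightarrow> \<nu>m * (nrm v)\<^sup>2 \<le> ip (\<lambda>x. \<nu> x * v x) v"
proof -
  assume v: "v \<in> L2 \<Omega>"
  have "\<nu>m * (nrm v)\<^sup>2 = (LINT x|lebesgue_on \<Omega>. \<nu>m * (v x * v x))"
    by (simp add: L2_norm_power2_real)
  also have "\<dots> \<le> ip (\<lambda>x. \<nu> x * v x) v"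
  proof (rule integral_mono_AE)
    show "AE x in lebesgue_on \<Omega>. \<nu>m * (v x * v x) \<le> \<nu> x * v x * v x"
      using \<nu>(2) by eventually_elim (simp add: mult.assoc mult_right_mono)
  qed (use v in \<open>auto intro!: L2_mult_integrable \<nu>_mult\<close>)
  finally show ?thesis .
qed

lemma \<eta>_ip_nonneg: "v \<in> L2 \<Omega> \<Longrightarrow> 0 \<le> ip (\<lambda>x. \<eta> x * v x) v"
proof (rule integral_nonneg_AE)
  show "AE x in lebesgue_on \<Omega>. 0 \<le> \<eta> x * v x * v x"
    using \<eta>(2) by eventually_elim (simp add: mult.assoc)
qed

lemma ip_lincomb:
  assumes "v \<in> L2 \<Omega>" "w \<in> L2 \<Omega>" "z \<in> L2 \<Omega>"
  shows "ip (\<lambda>x. a * v x + b * w x) z = a * ip v z + b * ip w z"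
proof -
  have "ip (\<lambda>x. a * v x + b * w x) z = (LINT x|lebesgue_on \<Omega>. a * (v x * z x) + b * (w x * z x))"
    by (simp add: algebra_simps)
  then show ?thesis
    using L2_mult_integrable[OF assms(1,3)] L2_mult_integrable[OF assms(2,3)] by simp
qed

lemma diff_u_AE:
  assumes "1 \<le> l" "l < N"
  shows "AE x in lebesgue_on \<Omega>. u l x = u (l - 1) x - \<tau> *\<^sub>R grad \<Omega> (p l) x"
proof -
  have "AE x in lebesgue_on \<Omega>. diff_u \<tau> u l x + grad \<Omega> (p l) x = 0"
    using sol assms by (simp add: leapfrog_solution_def)
  then show ?thesis
  proof eventually_elim
    case (elim x)
    have "\<tau> *\<^sub>R (diff_u \<tau> u l x + grad \<Omega> (p l) x) = (u l x - u (l - 1) x) + \<tau> *\<^sub>R grad \<Omega> (p l) x"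
      using \<tau> by (simp add: diff_u_def scaleR_add_right)
    then show ?case using elim by (simp add: algebra_simps)
  qed
qed

lemma u0:
  obtains y where "y \<in> V" "AE x in lebesgue_on \<Omega>. u 0 x = grad \<Omega> y x"
    "\<forall>\<phi>\<in>V. gp y \<phi> = ip (\<lambda>x. \<eta> x * p0 x + \<nu> x * p1 x) \<phi>"
proof -
  have "is_Phi \<Omega> \<Gamma>D M \<eta> p0 p1 \<nu> (u 0)" using sol by (simp add: leapfrog_solution_def)
  then show thesis unfolding is_Phi_def by (elim conjE bexE) (rule that)
qed

lemma \<Omega>_sets: "\<Omega> \<in> sets lebesgue"
  using \<Omega> by auto

lemma u_L2: "l < N \<Longrightarrow> u l \<in> L2 \<Omega>"
proof (induction l)
  case 0
  obtain y where y: "y \<in> V" "AE x in lebesgue_on \<Omega>. u 0 x = grad \<Omega> y x"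
    "\<forall>\<phi>\<in>V. gp y \<phi> = ip (\<lambda>x. \<eta> x * p0 x + \<nu> x * p1 x) \<phi>" by (rule u0)
  have "AE x in lebesgue_on \<Omega>. grad \<Omega> y x = u 0 x" using y(2) by eventually_elim simp
  then show ?case
    by (rule L2_cong_AE[OF grad_in_L2[OF P1D_imp_H1[OF y(1)]] _ \<Omega>_sets])
next
  case (Suc l)
  have "AE x in lebesgue_on \<Omega>. u l x - \<tau> *\<^sub>R grad \<Omega> (p (Suc l)) x = u (Suc l) x"
  proof -
    have "AE x in lebesgue_on \<Omega>. u (Suc l) x = u (Suc l - 1) x - \<tau> *\<^sub>R grad \<Omega> (p (Suc l)) x"
      using Suc.prems by (intro diff_u_AE) auto
    then show ?thesis by eventually_elim simp
  qed
  moreover have "(\<lambda>x. u l x - \<tau> *\<^sub>R grad \<Omega> (p (Suc l)) x) \<in> L2 \<Omega>"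
    using Suc by (intro L2_diff L2_scaleR grad_in_L2 P1D_imp_H1 p_P1D) auto
  ultimately show ?case using L2_cong_AE[OF _ _ \<Omega>_sets] by blast
qed

lemma scheme:
  assumes l: "l < N" and \<phi>: "\<phi> \<in> V"
  shows "ip (\<lambda>x. \<nu> x * \<delta> l x) \<phi> + ip (\<lambda>x. \<eta> x * mean_p p l x) \<phi>
     - (LINT x|lebesgue_on \<Omega>. u l x \<bullet> grad \<Omega> \<phi> x) = ip (FF l) \<phi>"
proof -
  note L = P1D_imp_L2[OF \<phi>] \<nu>_mult(1)[OF P1D_imp_L2[OF \<delta>_P1D[OF l]]] \<eta>_mult(1)[OF P1D_imp_L2[OF mean_P1D[OF l]]]
  have "(LINT x|lebesgue_on \<Omega>. (\<nu> x * \<delta> l x + \<eta> x * mean_p p l x) * \<phi> x - u l x \<bullet> grad \<Omega> \<phi> x) = ip (FF l) \<phi>"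
    using sol l \<phi> unfolding leapfrog_solution_def by blast
  moreover have "(LINT x|lebesgue_on \<Omega>. (\<nu> x * \<delta> l x + \<eta> x * mean_p p l x) * \<phi> x - u l x \<bullet> grad \<Omega> \<phi> x)
     = ip (\<lambda>x. \<nu> x * \<delta> l x) \<phi> + ip (\<lambda>x. \<eta> x * mean_p p l x) \<phi>
     - (LINT x|lebesgue_on \<Omega>. u l x \<bullet> grad \<Omega> \<phi> x)"
    unfolding distrib_right
    using L2_mult_integrable[OF L(2,1)] L2_mult_integrable[OF L(3,1)]
      L2_inner_integrable[OF u_L2[OF l] grad_in_L2[OF P1D_imp_H1[OF \<phi>]]] by simp
  ultimately show ?thesis by simp
qed

definition energy :: "nat \<Rightarrow> real" where
  "energy l = ip (\<lambda>x. \<nu> x * \<delta> l x) (\<delta> l) + gp (p (Suc l)) (p l)"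

lemma grad_\<delta>_bound: "l < N \<Longrightarrow> \<tau> * nrm (grad \<Omega> (\<delta> l)) \<le> sqrt \<nu>m / sqrt 2 * nrm (\<delta> l)"
proof -
  assume l: "l < N"
  have "\<tau> * nrm (grad \<Omega> (\<delta> l)) \<le> \<tau> * (\<kappa> * nrm (\<delta> l))"
    using \<tau> inverse_estimate[OF \<delta>_P1D[OF l]] by (intro mult_left_mono) auto
  also have "\<dots> = \<tau> * \<kappa> * nrm (\<delta> l)" by simp
  also have "\<dots> \<le> sqrt \<nu>m / sqrt 2 * nrm (\<delta> l)"
    using cfl by (intro mult_right_mono) auto
  finally show ?thesis .
qed

lemma energy_lower:
  assumes l: "l < N"
  shows "7/8 * \<nu>m * (nrm (\<delta> l))\<^sup>2 + (nrm (grad \<Omega> (mean_p p l)))\<^sup>2 \<le> energy l"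
proof -
  note H = P1D_imp_H1[OF mean_P1D[OF l]] P1D_imp_H1[OF \<delta>_P1D[OF l]]
  let ?m = "mean_p p l"
  have "gp (p (Suc l)) (p l) = gp (\<lambda>x. 1 * ?m x + (\<tau> / 2) * \<delta> l x) (\<lambda>x. 1 * ?m x + (- \<tau> / 2) * \<delta> l x)"
    by (simp only: p_Suc_eq[symmetric] p_eq[symmetric])
  also have "\<dots> = gp ?m ?m - (\<tau> / 2)\<^sup>2 * gp (\<delta> l) (\<delta> l)"
    unfolding gp_lincomb(1)[OF H H1_lincomb(1)[OF \<Omega> H]] gp_lincomb(2)[OF H H(1)] gp_lincomb(2)[OF H H(2)]
    by (simp add: gp_commute[of ?m "\<delta> l"] algebra_simps power2_eq_square)
  finally have g: "gp (p (Suc l)) (p l) = (nrm (grad \<Omega> ?m))\<^sup>2 - (\<tau> / 2)\<^sup>2 * (nrm (grad \<Omega> (\<delta> l)))\<^sup>2"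
    by (simp only: gp_self)
  have "(\<tau> * nrm (grad \<Omega> (\<delta> l)))\<^sup>2 \<le> (sqrt \<nu>m / sqrt 2 * nrm (\<delta> l))\<^sup>2"
    using grad_\<delta>_bound[OF l] \<tau> by (intro power_mono) auto
  then have "(\<tau> / 2)\<^sup>2 * (nrm (grad \<Omega> (\<delta> l)))\<^sup>2 \<le> \<nu>m / 8 * (nrm (\<delta> l))\<^sup>2"
    using \<nu>m by (simp add: power_mult_distrib power_divide)
  then show ?thesis
    using \<nu>_ip_lower[OF P1D_imp_L2[OF \<delta>_P1D[OF l]]] g by (simp add: energy_def algebra_simps)
qed

text \<open>The difference of two consecutive equations, tested with \<open>\<delta> l + \<delta> (l - 1) = (p (l + 1) - p (l - 1)) / \<tau>\<close>.\<close>

lemma energy_step: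
  assumes l: "Suc l < N"
  shows "energy (Suc l) \<le> energy l +
     nrm (\<lambda>x. FF (Suc l) x - FF l x) * (nrm (\<delta> (Suc l)) + nrm (\<delta> l))"
proof -
  have l': "l < N" using l by simp
  define \<phi> where "\<phi> = (\<lambda>x. 1 * \<delta> (Suc l) x + 1 * \<delta> l x)"
  have \<phi>: "\<phi> \<in> V"
    unfolding \<phi>_def using l l' by (intro P1D_lincomb \<delta>_P1D)
  have \<tau>\<phi>: "\<phi> = (\<lambda>x. (1/\<tau>) * p (Suc (Suc l)) x + (- 1/\<tau>) * p l x)"
    by (simp add: \<phi>_def diff_p_def diff_divide_distrib)
  note d = P1D_imp_L2[OF \<delta>_P1D[OF l]] P1D_imp_L2[OF \<delta>_P1D[OF l']]
  note \<phi>L = P1D_imp_L2[OF \<phi>]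
  have nu: "ip (\<lambda>x. \<nu> x * \<delta> (Suc l) x) \<phi> - ip (\<lambda>x. \<nu> x * \<delta> l x) \<phi>
     = ip (\<lambda>x. \<nu> x * \<delta> (Suc l) x) (\<delta> (Suc l)) - ip (\<lambda>x. \<nu> x * \<delta> l x) (\<delta> l)"
  proof -
    have "ip (\<lambda>x. \<nu> x * \<delta> (Suc l) x) \<phi> - ip (\<lambda>x. \<nu> x * \<delta> l x) \<phi>
       = (LINT x|lebesgue_on \<Omega>. \<nu> x * \<delta> (Suc l) x * \<phi> x - \<nu> x * \<delta> l x * \<phi> x)"
      by (intro Bochner_Integration.integral_diff[symmetric] L2_mult_integrable \<nu>_mult d \<phi>L)
    also have "\<dots> = (LINT x|lebesgue_on \<Omega>. \<nu> x * \<delta> (Suc l) x * \<delta> (Suc l) x - \<nu> x * \<delta> l x * \<delta> l x)"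
      by (simp add: \<phi>_def algebra_simps)
    also have "\<dots> = ip (\<lambda>x. \<nu> x * \<delta> (Suc l) x) (\<delta> (Suc l)) - ip (\<lambda>x. \<nu> x * \<delta> l x) (\<delta> l)"
      by (intro Bochner_Integration.integral_diff L2_mult_integrable \<nu>_mult d)
    finally show ?thesis .
  qed
  have eta: "ip (\<lambda>x. \<eta> x * mean_p p (Suc l) x) \<phi> - ip (\<lambda>x. \<eta> x * mean_p p l x) \<phi> \<ge> 0"
  proof -
    note m = P1D_imp_L2[OF mean_P1D[OF l]] P1D_imp_L2[OF mean_P1D[OF l']]
    have "ip (\<lambda>x. \<eta> x * mean_p p (Suc l) x) \<phi> - ip (\<lambda>x. \<eta> x * mean_p p l x) \<phi>
       = (LINT x|lebesgue_on \<Omega>. \<eta> x * mean_p p (Suc l) x * \<phi> x - \<eta> x * mean_p p l x * \<phi> x)"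
      by (intro Bochner_Integration.integral_diff[symmetric] L2_mult_integrable \<eta>_mult m \<phi>L)
    also have "\<dots> = (LINT x|lebesgue_on \<Omega>. \<tau> / 2 * (\<eta> x * \<phi> x * \<phi> x))"
    proof -
      have "mean_p p (Suc l) x = mean_p p l x + \<tau> / 2 * \<phi> x" for x
        using \<tau> unfolding \<tau>\<phi> by (simp add: mean_p_def field_simps)
      then show ?thesis by (simp add: algebra_simps)
    qed
    also have "\<dots> = \<tau> / 2 * ip (\<lambda>x. \<eta> x * \<phi> x) \<phi>" by simp
    also have "\<dots> \<ge> 0" using \<eta>_ip_nonneg[OF \<phi>L] \<tau> by simp
    finally show ?thesis .
  qed
  have uu: "(LINT x|lebesgue_on \<Omega>. u (Suc l) x \<bullet> grad \<Omega> \<phi> x) - (LINT x|lebesgue_on \<Omega>. u l x \<bullet> grad \<Omega> \<phi> x)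
     = gp (p (Suc l)) (p l) - gp (p (Suc (Suc l))) (p (Suc l))"
  proof -
    note P = P1D_imp_H1[OF p_P1D]
    note H = P[of "Suc (Suc l)"] P[of l] P[of "Suc l"]
    note G = grad_in_L2[OF P1D_imp_H1[OF \<phi>]]
    have "(LINT x|lebesgue_on \<Omega>. u (Suc l) x \<bullet> grad \<Omega> \<phi> x) - (LINT x|lebesgue_on \<Omega>. u l x \<bullet> grad \<Omega> \<phi> x)
      = (LINT x|lebesgue_on \<Omega>. u (Suc l) x \<bullet> grad \<Omega> \<phi> x - u l x \<bullet> grad \<Omega> \<phi> x)"
      by (intro Bochner_Integration.integral_diff[symmetric] L2_inner_integrable G u_L2 l l')
    also have "\<dots> = (LINT x|lebesgue_on \<Omega>. - \<tau> * (grad \<Omega> (p (Suc l)) x \<bullet> grad \<Omega> \<phi> x))"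
    proof (rule integral_cong_AE)
      show "AE x in lebesgue_on \<Omega>. u (Suc l) x \<bullet> grad \<Omega> \<phi> x - u l x \<bullet> grad \<Omega> \<phi> x
          = - \<tau> * (grad \<Omega> (p (Suc l)) x \<bullet> grad \<Omega> \<phi> x)"
        using diff_u_AE[of "Suc l"] l by (auto elim!: AE_mp simp: inner_diff_left)
      show "(\<lambda>x. u (Suc l) x \<bullet> grad \<Omega> \<phi> x - u l x \<bullet> grad \<Omega> \<phi> x) \<in> borel_measurable (lebesgue_on \<Omega>)"
        by (intro borel_measurable_diff borel_measurable_inner L2_D(1)[OF G] L2_D(1)[OF u_L2] l l')
      show "(\<lambda>x. - \<tau> * (grad \<Omega> (p (Suc l)) x \<bullet> grad \<Omega> \<phi> x)) \<in> borel_measurable (lebesgue_on \<Omega>)"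
        using l by (intro borel_measurable_times borel_measurable_const borel_measurable_inner L2_D(1)[OF G]
            L2_D(1)[OF grad_in_L2[OF H(3)]]) auto
    qed
    also have "\<dots> = - \<tau> * gp (p (Suc l)) \<phi>" by simp
    also have "gp (p (Suc l)) \<phi> = (1/\<tau>) * gp (p (Suc l)) (p (Suc (Suc l))) + (- 1/\<tau>) * gp (p (Suc l)) (p l)"
      unfolding \<tau>\<phi> by (rule gp_lincomb(1)) (use H l in auto)
    finally show ?thesis using \<tau> by (simp add: gp_commute[of "p (Suc l)" "p (Suc (Suc l))"] algebra_simps)
  qed
  have ff: "ip (FF (Suc l)) \<phi> - ip (FF l) \<phi>
      \<le> nrm (\<lambda>x. FF (Suc l) x - FF l x) * (nrm (\<delta> (Suc l)) + nrm (\<delta> l))"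
  proof -
    have "ip (FF (Suc l)) \<phi> - ip (FF l) \<phi> = ip (\<lambda>x. 1 * FF (Suc l) x + (-1) * FF l x) \<phi>"
      by (subst ip_lincomb[OF F[OF l] F[OF l'] \<phi>L]) simp
    also have "\<dots> = ip (\<lambda>x. FF (Suc l) x - FF l x) \<phi>" by simp
    also have "\<dots> \<le> nrm (\<lambda>x. FF (Suc l) x - FF l x) * nrm \<phi>"
      using L2_Cauchy_Schwarz_real[OF L2_diff[OF F[OF l] F[OF l']] \<phi>L] by linarith
    also have "\<dots> \<le> nrm (\<lambda>x. FF (Suc l) x - FF l x) * (nrm (\<delta> (Suc l)) + nrm (\<delta> l))"
      using L2_norm_triangle[OF d] by (intro mult_left_mono) (auto simp: \<phi>_def)
    finally show ?thesis .
  qed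
  show ?thesis
    using scheme[OF l \<phi>] scheme[OF l' \<phi>] nu eta uu ff unfolding energy_def by linarith
qed

lemma data_L2: "(\<lambda>x. \<eta> x * p0 x + \<nu> x * p1 x) \<in> L2 \<Omega>"
  "nrm (\<lambda>x. \<eta> x * p0 x + \<nu> x * p1 x) \<le> \<eta>p * nrm p0 + \<nu>p * nrm p1"
proof -
  note L = \<eta>_mult(1)[OF H1_imp_L2[OF p0]] \<nu>_mult(1)[OF p1]
  show "(\<lambda>x. \<eta> x * p0 x + \<nu> x * p1 x) \<in> L2 \<Omega>" by (rule L2_add[OF L])
  show "nrm (\<lambda>x. \<eta> x * p0 x + \<nu> x * p1 x) \<le> \<eta>p * nrm p0 + \<nu>p * nrm p1"
    using L2_norm_triangle[OF L] \<eta>_mult(2)[OF H1_imp_L2[OF p0]] \<nu>_mult(2)[OF p1] by linarith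
qed

lemma initial_p_bound:
  "nrm (p 0) \<le> H1_norm \<Omega> p0" "nrm (grad \<Omega> (p 0)) \<le> H1_norm \<Omega> p0"
proof -
  have P: "p 0 \<in> V" by (rule p_P1D) simp
  note H = P1D_imp_H1[OF P]
  have "is_Psi \<Omega> \<Gamma>D M p0 (p 0)" using sol by (simp add: leapfrog_solution_def)
  then have "H1_inner \<Omega> (p 0) (p 0) = H1_inner \<Omega> p0 (p 0)" using P by (simp add: is_Psi_def)
  then have "(nrm (grad \<Omega> (p 0)))\<^sup>2 + (nrm (p 0))\<^sup>2 = gp p0 (p 0) + ip p0 (p 0)"
    unfolding H1_inner_eq[OF H H] H1_inner_eq[OF p0 H] by (simp only: gp_self L2_norm_power2_real)
  also have "\<dots> \<le> nrm (grad \<Omega> p0) * nrm (grad \<Omega> (p 0)) + nrm p0 * nrm (p 0)"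
    using L2_Cauchy_Schwarz[OF grad_in_L2[OF p0] grad_in_L2[OF H]]
      L2_Cauchy_Schwarz_real[OF H1_imp_L2[OF p0] H1_imp_L2[OF H]] by linarith
  finally have "(nrm (grad \<Omega> (p 0)))\<^sup>2 + (nrm (p 0))\<^sup>2 \<le> (nrm (grad \<Omega> p0))\<^sup>2 + (nrm p0)\<^sup>2"
    using sum_squares_bound[of "nrm (grad \<Omega> p0)" "nrm (grad \<Omega> (p 0))"]
      sum_squares_bound[of "nrm p0" "nrm (p 0)"] by linarith
  then have "H1_norm \<Omega> (p 0) \<le> H1_norm \<Omega> p0"
    unfolding H1_norm_eq[OF H] H1_norm_eq[OF p0] by (rule real_sqrt_le_mono)
  then show "nrm (p 0) \<le> H1_norm \<Omega> p0" "nrm (grad \<Omega> (p 0)) \<le> H1_norm \<Omega> p0"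
    using H1_norm_ge[OF H] by linarith+
qed

lemma initial_\<delta>_bound:
  "\<nu>m * nrm (\<delta> 0) \<le> nrm (FF 0) + \<eta>p * (nrm p0 + H1_norm \<Omega> p0) + \<nu>p * nrm p1"
    (is "_ \<le> ?R")
proof -
  have N0: "0 < N" using N by simp
  note D = \<delta>_P1D[OF N0]
  note DL = P1D_imp_L2[OF D]
  note p0L = P1D_imp_L2[OF p_P1D[OF le0]]
  obtain y where y: "y \<in> V" "AE x in lebesgue_on \<Omega>. u 0 x = grad \<Omega> y x"
    "\<forall>\<phi>\<in>V. gp y \<phi> = ip (\<lambda>x. \<eta> x * p0 x + \<nu> x * p1 x) \<phi>"
    by (rule u0)
  let ?g = "\<lambda>x. \<eta> x * p0 x + \<nu> x * p1 x"
  have "(LINT x|lebesgue_on \<Omega>. u 0 x \<bullet> grad \<Omega> (\<delta> 0) x) = gp y (\<delta> 0)"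
  proof (rule integral_cong_AE)
    show "AE x in lebesgue_on \<Omega>. u 0 x \<bullet> grad \<Omega> (\<delta> 0) x = grad \<Omega> y x \<bullet> grad \<Omega> (\<delta> 0) x"
      using y(2) by eventually_elim simp
  qed (intro borel_measurable_inner L2_D(1)[OF u_L2[OF N0]] L2_D(1)[OF grad_in_L2] P1D_imp_H1 D y(1))+
  then have u: "(LINT x|lebesgue_on \<Omega>. u 0 x \<bullet> grad \<Omega> (\<delta> 0) x) = ip ?g (\<delta> 0)"
    using bspec[OF y(3) D] by simp
  have m: "ip (\<lambda>x. \<eta> x * mean_p p 0 x) (\<delta> 0) = ip (\<lambda>x. \<eta> x * p 0 x) (\<delta> 0) + \<tau> / 2 * ip (\<lambda>x. \<eta> x * \<delta> 0 x) (\<delta> 0)"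
  proof -
    have "mean_p p 0 x = p 0 x + \<tau> / 2 * \<delta> 0 x" for x
      using \<tau> by (simp add: mean_p_def diff_p_def field_simps)
    then have "\<eta> x * mean_p p 0 x = 1 * (\<eta> x * p 0 x) + \<tau> / 2 * (\<eta> x * \<delta> 0 x)" for x
      by (simp add: algebra_simps)
    then have "ip (\<lambda>x. \<eta> x * mean_p p 0 x) (\<delta> 0) = ip (\<lambda>x. 1 * (\<eta> x * p 0 x) + \<tau> / 2 * (\<eta> x * \<delta> 0 x)) (\<delta> 0)"
      by (simp only:)
    also have "\<dots> = 1 * ip (\<lambda>x. \<eta> x * p 0 x) (\<delta> 0) + \<tau> / 2 * ip (\<lambda>x. \<eta> x * \<delta> 0 x) (\<delta> 0)"
      by (rule ip_lincomb[OF \<eta>_mult(1)[OF p0L] \<eta>_mult(1)[OF DL] DL])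
    finally show ?thesis by simp
  qed
  have "\<nu>m * (nrm (\<delta> 0))\<^sup>2 \<le> ip (\<lambda>x. \<nu> x * \<delta> 0 x) (\<delta> 0)"
    by (rule \<nu>_ip_lower[OF DL])
  also have "\<dots> \<le> ip (FF 0) (\<delta> 0) + ip ?g (\<delta> 0) - ip (\<lambda>x. \<eta> x * p 0 x) (\<delta> 0)"
  proof -
    have "0 \<le> \<tau> / 2 * ip (\<lambda>x. \<eta> x * \<delta> 0 x) (\<delta> 0)" using \<eta>_ip_nonneg[OF DL] \<tau> by simp
    then show ?thesis using scheme[OF N0 D] unfolding u m by linarith
  qed
  also have "\<dots> \<le> nrm (FF 0) * nrm (\<delta> 0) + nrm ?g * nrm (\<delta> 0)
      + nrm (\<lambda>x. \<eta> x * p 0 x) * nrm (\<delta> 0)"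
    using L2_Cauchy_Schwarz_real[OF F[OF N0] DL] L2_Cauchy_Schwarz_real[OF data_L2(1) DL]
      L2_Cauchy_Schwarz_real[OF \<eta>_mult(1)[OF p0L] DL] by linarith
  also have "\<dots> = (nrm (FF 0) + nrm ?g + nrm (\<lambda>x. \<eta> x * p 0 x)) * nrm (\<delta> 0)"
    by (simp only: distrib_right)
  also have "\<dots> \<le> ?R * nrm (\<delta> 0)"
  proof (rule mult_right_mono)
    have "nrm (\<lambda>x. \<eta> x * p 0 x) \<le> \<eta>p * H1_norm \<Omega> p0"
      using \<eta>_mult(2)[OF p0L] mult_left_mono[OF initial_p_bound(1) \<eta>(3)] by linarith
    then show "nrm (FF 0) + nrm ?g + nrm (\<lambda>x. \<eta> x * p 0 x) \<le> ?R"
      using data_L2(2) by (simp only: distrib_left)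
  qed simp
  finally have *: "\<nu>m * nrm (\<delta> 0) * nrm (\<delta> 0) \<le> ?R * nrm (\<delta> 0)"
    by (simp only: power2_eq_square mult.assoc)
  show ?thesis
  proof (cases "nrm (\<delta> 0) = 0")
    case True
    have "0 \<le> H1_norm \<Omega> p0" using H1_norm_ge(1)[OF p0] L2_norm_nonneg order_trans by blast
    then show ?thesis using True \<nu>m \<eta>(3) by simp
  next
    case False
    then have "0 < nrm (\<delta> 0)" using L2_norm_nonneg[of \<Omega> "\<delta> 0"] by linarith
    with * show ?thesis by (simp only: mult_le_cancel_right_pos)
  qed
qed

text \<open>A discrete Gronwall argument for the maximum \<open>m\<close> of \<open>\<parallel>\<delta> l\<parallel>\<close>: it satisfies \<open>7/8 \<nu>m m\<^sup>2 \<le> E + 2 m B\<close>.\<close>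

lemma energy_bounds:
  assumes E: "energy 0 \<le> E" "0 \<le> E" and W: "\<And>l. l < N \<Longrightarrow> 0 \<le> W l \<and> W l \<le> B"
    "\<And>l. Suc l < N \<Longrightarrow> nrm (\<lambda>x. FF (Suc l) x - FF l x) \<le> W (Suc l) - W l"
    and A: "A = 1 + (E + 2 * B) / (7/8 * \<nu>m)"
    and l: "l < N"
  shows "nrm (\<delta> l) \<le> A" "energy l \<le> E + 2 * A * B"
proof -
  define m where "m = Max ((\<lambda>l. nrm (\<delta> l)) ` {..<N})"
  have le_m: "nrm (\<delta> l) \<le> m" if "l < N" for l
    unfolding m_def using that by (intro Max_ge) auto
  have "m \<in> (\<lambda>l. nrm (\<delta> l)) ` {..<N}"
    unfolding m_def using N by (intro Max_in) (auto simp: lessThan_empty_iff)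
  then obtain k where k: "k < N" "m = nrm (\<delta> k)" by auto
  have m0: "0 \<le> m" by (simp add: k(2))
  have B: "0 \<le> B" using W(1)[of 0] N by auto
  have en: "energy l \<le> E + 2 * m * (W l - W 0)" if "l < N" for l
    using that
  proof (induction l)
    case 0
    then show ?case using E by simp
  next
    case (Suc l)
    have "energy (Suc l) \<le> energy l +
        nrm (\<lambda>x. FF (Suc l) x - FF l x) * (nrm (\<delta> (Suc l)) + nrm (\<delta> l))"
      by (rule energy_step[OF Suc.prems])
    also have "nrm (\<lambda>x. FF (Suc l) x - FF l x) * (nrm (\<delta> (Suc l)) + nrm (\<delta> l))
        \<le> (W (Suc l) - W l) * (2 * m)"
    proof (rule mult_mono)
      show "nrm (\<lambda>x. FF (Suc l) x - FF l x) \<le> W (Suc l) - W l" by (rule W(2)[OF Suc.prems])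
      then show "0 \<le> W (Suc l) - W l" by (rule order_trans[OF L2_norm_nonneg])
      show "nrm (\<delta> (Suc l)) + nrm (\<delta> l) \<le> 2 * m"
        using le_m[of l] le_m[of "Suc l"] Suc.prems by simp
    qed simp
    finally have "energy (Suc l) \<le> energy l + (W (Suc l) - W l) * (2 * m)" by simp
    also have "energy l \<le> E + 2 * m * (W l - W 0)" using Suc by simp
    finally show ?case by (simp add: algebra_simps)
  qed
  have VB: "W l - W 0 \<le> B" if "l < N" for l using W(1)[of l] W(1)[of 0] that N by auto
  have en': "energy l \<le> E + 2 * m * B" if "l < N" for l
    using en[OF that] mult_left_mono[OF VB[OF that], of "2 * m"] m0 by linarith
  have "m \<le> A"
  proof (cases "m \<le> 1")
    case True
    have "0 \<le> (E + 2 * B) / (7/8 * \<nu>m)" using E B \<nu>m by simp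
    then show ?thesis using True A by simp
  next
    case False
    have "7/8 * \<nu>m * m\<^sup>2 \<le> energy k"
      using energy_lower[OF k(1)] zero_le_power2[of "nrm (grad \<Omega> (mean_p p k))"] by (simp only: k(2))
    also have "\<dots> \<le> E + 2 * m * B" by (rule en'[OF k(1)])
    also have "\<dots> \<le> (E + 2 * B) * m"
      using mult_left_mono[of 1 m E] False E(2) by (simp add: algebra_simps)
    finally have "7/8 * \<nu>m * m * m \<le> (E + 2 * B) * m" by (simp only: power2_eq_square mult.assoc)
    then have "7/8 * \<nu>m * m \<le> E + 2 * B" using False by (simp only: mult_le_cancel_right_pos)
    then have "m \<le> (E + 2 * B) / (7/8 * \<nu>m)" using \<nu>m by (simp add: field_simps)
    then show ?thesis using A by simp
  qed
  then show "nrm (\<delta> l) \<le> A" using le_m[OF l] by simp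
  have "2 * m * B \<le> 2 * A * B" using \<open>m \<le> A\<close> B by (intro mult_right_mono) auto
  then show "energy l \<le> E + 2 * A * B" using en'[OF l] by simp
qed

lemma energy_0_bound:
  assumes A0: "nrm (\<delta> 0) \<le> A0"
  shows "energy 0 \<le> \<nu>p * A0\<^sup>2 + (H1_norm \<Omega> p0)\<^sup>2 + sqrt \<nu>m * A0 * H1_norm \<Omega> p0"
proof -
  have N0: "0 < N" using N by simp
  note D = \<delta>_P1D[OF N0]
  note DL = P1D_imp_L2[OF D]
  note H = P1D_imp_H1[OF p_P1D[OF le0]] P1D_imp_H1[OF D]
  let ?P = "H1_norm \<Omega> p0"
  have A0': "0 \<le> A0" using A0 L2_norm_nonneg[of \<Omega> "\<delta> 0"] by linarith
  have "ip (\<lambda>x. \<nu> x * \<delta> 0 x) (\<delta> 0) \<le> nrm (\<lambda>x. \<nu> x * \<delta> 0 x) * nrm (\<delta> 0)"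
    using L2_Cauchy_Schwarz_real[OF \<nu>_mult(1)[OF DL] DL] by linarith
  also have "\<dots> \<le> (\<nu>p * nrm (\<delta> 0)) * nrm (\<delta> 0)"
    using \<nu>_mult(2)[OF DL] by (rule mult_right_mono) simp
  also have "\<dots> \<le> (\<nu>p * A0) * A0"
    using A0 A0' \<nu>m by (intro mult_mono mult_left_mono) auto
  finally have 1: "ip (\<lambda>x. \<nu> x * \<delta> 0 x) (\<delta> 0) \<le> \<nu>p * A0\<^sup>2" by (simp only: power2_eq_square mult.assoc)
  have "p (Suc 0) = (\<lambda>x. 1 * p 0 x + \<tau> * \<delta> 0 x)"
    using \<tau> by (simp add: diff_p_def)
  then have "gp (p (Suc 0)) (p 0) = gp (\<lambda>x. 1 * p 0 x + \<tau> * \<delta> 0 x) (p 0)" by (rule arg_cong)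
  also have "\<dots> = gp (p 0) (p 0) + \<tau> * gp (\<delta> 0) (p 0)"
    by (subst gp_lincomb(2)[OF H H(1)]) simp
  also have "\<dots> \<le> (nrm (grad \<Omega> (p 0)))\<^sup>2 + \<tau> * (nrm (grad \<Omega> (\<delta> 0)) * nrm (grad \<Omega> (p 0)))"
    unfolding gp_self using L2_Cauchy_Schwarz[OF grad_in_L2[OF H(2)] grad_in_L2[OF H(1)]] \<tau>
    by (intro add_left_mono mult_left_mono) auto
  also have "\<dots> \<le> ?P\<^sup>2 + sqrt \<nu>m * A0 * ?P"
  proof (rule add_mono)
    show "(nrm (grad \<Omega> (p 0)))\<^sup>2 \<le> ?P\<^sup>2"
      by (intro power_mono initial_p_bound) simp
    have "sqrt \<nu>m / sqrt 2 \<le> sqrt \<nu>m"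
      using \<nu>m by (simp add: divide_le_eq mult_le_cancel_left1)
    then have "sqrt \<nu>m / sqrt 2 * nrm (\<delta> 0) \<le> sqrt \<nu>m * A0"
      using A0 \<nu>m by (intro mult_mono) auto
    then have "\<tau> * nrm (grad \<Omega> (\<delta> 0)) \<le> sqrt \<nu>m * A0"
      using grad_\<delta>_bound[OF N0] by linarith
    then have "(\<tau> * nrm (grad \<Omega> (\<delta> 0))) * nrm (grad \<Omega> (p 0)) \<le> (sqrt \<nu>m * A0) * ?P"
      by (rule mult_mono) (use initial_p_bound(2) A0' \<nu>m in auto)
    then show "\<tau> * (nrm (grad \<Omega> (\<delta> 0)) * nrm (grad \<Omega> (p 0))) \<le> sqrt \<nu>m * A0 * ?P"
      by (simp only: mult.assoc)
  qed
  finally show ?thesis using 1 by (simp add: energy_def)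
qed

lemma grad_p_bound:
  assumes l: "l < N" and A: "nrm (\<delta> l) \<le> A" "energy l \<le> E"
  shows "nrm (grad \<Omega> (p l)) \<le> sqrt E + sqrt \<nu>m * A"
proof -
  let ?m = "mean_p p l"
  note H = P1D_imp_H1[OF mean_P1D[OF l]] P1D_imp_H1[OF \<delta>_P1D[OF l]]
  have A0: "0 \<le> A" using A L2_norm_nonneg[of \<Omega> "\<delta> l"] by linarith
  have "(nrm (grad \<Omega> ?m))\<^sup>2 \<le> E"
  proof -
    have "0 \<le> 7/8 * \<nu>m * (nrm (\<delta> l))\<^sup>2" using \<nu>m by simp
    then show ?thesis using energy_lower[OF l] A(2) by linarith
  qed
  then have 1: "nrm (grad \<Omega> ?m) \<le> sqrt E" by (rule real_le_rsqrt)
  have "nrm (grad \<Omega> (p l)) = nrm (grad \<Omega> (\<lambda>x. 1 * ?m x + (- \<tau> / 2) * \<delta> l x))"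
    by (simp only: p_eq[symmetric])
  also have "\<dots> = nrm (\<lambda>x. 1 *\<^sub>R grad \<Omega> ?m x + (- \<tau> / 2) *\<^sub>R grad \<Omega> (\<delta> l) x)"
    by (rule L2_norm_grad_lincomb[OF \<Omega> H])
  also have "\<dots> \<le> nrm (\<lambda>x. 1 *\<^sub>R grad \<Omega> ?m x) + nrm (\<lambda>x. (- \<tau> / 2) *\<^sub>R grad \<Omega> (\<delta> l) x)"
    by (intro L2_norm_triangle L2_scaleR grad_in_L2 H)
  also have "\<dots> = nrm (grad \<Omega> ?m) + \<tau> * nrm (grad \<Omega> (\<delta> l)) / 2"
    unfolding L2_norm_scaleR using \<tau> by simp
  finally have 2: "nrm (grad \<Omega> (p l)) \<le> nrm (grad \<Omega> ?m) + \<tau> * nrm (grad \<Omega> (\<delta> l)) / 2" .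
  have "sqrt \<nu>m / sqrt 2 \<le> sqrt \<nu>m"
    using \<nu>m by (simp add: divide_le_eq mult_le_cancel_left1)
  then have "sqrt \<nu>m / sqrt 2 * nrm (\<delta> l) \<le> sqrt \<nu>m * A"
    using A \<nu>m by (intro mult_mono) auto
  then have 3: "\<tau> * nrm (grad \<Omega> (\<delta> l)) \<le> sqrt \<nu>m * A" using grad_\<delta>_bound[OF l] by simp
  have "0 \<le> sqrt \<nu>m * A" using A0 \<nu>m by simp
  with 1 2 3 show ?thesis by linarith
qed

lemma diff_u_norm:
  assumes "1 \<le> l" "l < N"
  shows "nrm (diff_u \<tau> u l) = nrm (grad \<Omega> (p l))"
proof -
  have "l - 1 < N" using assms by simp
  note U = u_L2[OF assms(2)] u_L2[OF this]
  have "p l \<in> V" using assms(2) by (intro p_P1D) simp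
  note G = grad_in_L2[OF P1D_imp_H1[OF this]]
  have "nrm (diff_u \<tau> u l) = nrm (\<lambda>x. (- 1) *\<^sub>R grad \<Omega> (p l) x)"
  proof (rule L2_norm_cong_AE)
    show "diff_u \<tau> u l \<in> borel_measurable (lebesgue_on \<Omega>)"
      unfolding diff_u_def by (intro L2_D(1)[OF L2_scaleR] L2_diff U)
    show "(\<lambda>x. (- 1) *\<^sub>R grad \<Omega> (p l) x) \<in> borel_measurable (lebesgue_on \<Omega>)"
      by (intro L2_D(1)[OF L2_scaleR] G)
    have "AE x in lebesgue_on \<Omega>. diff_u \<tau> u l x + grad \<Omega> (p l) x = 0"
      using sol assms by (simp add: leapfrog_solution_def)
    then show "AE x in lebesgue_on \<Omega>. diff_u \<tau> u l x = (- 1) *\<^sub>R grad \<Omega> (p l) x"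
      by eventually_elim (simp add: add_eq_0_iff)
  qed
  then show ?thesis unfolding L2_norm_scaleR by simp
qed

lemma p_bound:
  assumes A: "\<And>l. l < N \<Longrightarrow> nrm (\<delta> l) \<le> A" and l: "l \<le> N"
  shows "nrm (p l) \<le> H1_norm \<Omega> p0 + real l * \<tau> * A"
  using l
proof (induction l)
  case 0
  then show ?case using initial_p_bound(1) by simp
next
  case (Suc l)
  then have l: "l < N" by simp
  note P = P1D_imp_L2[OF p_P1D[OF less_imp_le[OF l]]] P1D_imp_L2[OF \<delta>_P1D[OF l]]
  have "p (Suc l) = (\<lambda>x. p l x + \<tau> * \<delta> l x)"
    using \<tau> by (simp add: diff_p_def)
  then have "nrm (p (Suc l)) \<le> nrm (p l) + \<tau> * nrm (\<delta> l)"
    using L2_norm_triangle[OF P(1) L2_cmult[OF P(2), of \<tau>]] L2_norm_cmult[of \<Omega> \<tau> "\<delta> l"] \<tau> by simp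
  also have "\<dots> \<le> (H1_norm \<Omega> p0 + real l * \<tau> * A) + \<tau> * A"
    using Suc l A[OF l] \<tau> by (intro add_mono mult_left_mono) auto
  finally show ?case by (simp add: algebra_simps)
qed

lemma u_bound:
  assumes G: "\<And>l. l < N \<Longrightarrow> nrm (grad \<Omega> (p l)) \<le> G" and l: "l < N"
  shows "nrm (u l) \<le> nrm (u 0) + real l * \<tau> * G"
  using l
proof (induction l)
  case (Suc l)
  then have l: "l < N" by simp
  have "p (Suc l) \<in> V" using Suc.prems by (intro p_P1D) simp
  note L = u_L2[OF l] L2_scaleR[OF grad_in_L2[OF P1D_imp_H1[OF this]], of \<tau>]
  have "nrm (u (Suc l)) = nrm (\<lambda>x. u l x - \<tau> *\<^sub>R grad \<Omega> (p (Suc l)) x)"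
  proof (rule L2_norm_cong_AE)
    show "AE x in lebesgue_on \<Omega>. u (Suc l) x = u l x - \<tau> *\<^sub>R grad \<Omega> (p (Suc l)) x"
      using diff_u_AE[of "Suc l"] Suc.prems by simp
  qed (intro L2_D(1)[OF u_L2[OF Suc.prems]] L2_D(1)[OF L2_diff] L)+
  also have "\<dots> \<le> nrm (u l) + nrm (\<lambda>x. \<tau> *\<^sub>R grad \<Omega> (p (Suc l)) x)"
    by (rule L2_norm_triangle_minus[OF L])
  also have "\<dots> = nrm (u l) + \<tau> * nrm (grad \<Omega> (p (Suc l)))"
    unfolding L2_norm_scaleR using \<tau> by simp
  also have "\<dots> \<le> (nrm (u 0) + real l * \<tau> * G) + \<tau> * G"
    using Suc l G[OF Suc.prems] \<tau> by (intro add_mono mult_left_mono) auto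
  finally show ?case by (simp add: algebra_simps)
qed simp

text \<open>If \<open>1\<close> is a test function, testing with it shows that the data have mean zero, so that any
  constant \<open>c\<close> may be subtracted from \<open>y\<close>.\<close>

lemma initial_u_bound:
  assumes C: "0 \<le> C" "\<And>v \<epsilon>. v \<in> V \<Longrightarrow> \<epsilon> > 0 \<Longrightarrow>
       \<exists>c. nrm (\<lambda>x. v x - c) \<le> C * nrm (grad \<Omega> v) + \<epsilon> \<and> ((\<lambda>x. 1) \<notin> V \<longrightarrow> c = 0)"
  shows "nrm (u 0) \<le> C * (\<eta>p * nrm p0 + \<nu>p * nrm p1)"
proof -
  obtain y where y: "y \<in> V" "AE x in lebesgue_on \<Omega>. u 0 x = grad \<Omega> y x"
    "\<forall>\<phi>\<in>V. gp y \<phi> = ip (\<lambda>x. \<eta> x * p0 x + \<nu> x * p1 x) \<phi>" by (rule u0)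
  define g where "g = (\<lambda>x. \<eta> x * p0 x + \<nu> x * p1 x)"
  have gL: "g \<in> L2 \<Omega>" using data_L2(1) by (simp only: g_def)
  have y3: "gp y \<phi> = ip g \<phi>" if "\<phi> \<in> V" for \<phi> using bspec[OF y(3) that] by (simp only: g_def)
  note yH = P1D_imp_H1[OF y(1)]
  let ?n = "nrm (grad \<Omega> y)"
  have one: "(\<lambda>x. 1) \<in> H1 \<Omega>" by (rule smooth_in_H1[OF \<Omega> smooth_const])
  have N0: "0 < N" using N by simp
  have u: "nrm (u 0) = ?n"
    by (rule L2_norm_cong_AE[OF L2_D(1)[OF u_L2[OF N0]] L2_D(1)[OF grad_in_L2[OF yH]] y(2)])
  have le: "?n\<^sup>2 \<le> nrm g * (C * ?n) + nrm g * \<epsilon>" if \<epsilon>: "\<epsilon> > 0" for \<epsilon>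
  proof -
    obtain c where c: "nrm (\<lambda>x. y x - c) \<le> C * ?n + \<epsilon>" "(\<lambda>x. 1) \<notin> V \<longrightarrow> c = 0"
      using C(2)[OF y(1) \<epsilon>] by (elim exE conjE)
    have cL: "(\<lambda>x. y x - c) \<in> L2 \<Omega>"
      using L2_diff[OF H1_imp_L2[OF yH] L2_cmult[OF H1_imp_L2[OF one], of c]] by simp
    have "c * ip g (\<lambda>x. 1) = 0"
    proof (cases "c = 0")
      case False
      then have o: "(\<lambda>x. 1) \<in> V" using c(2) by auto
      have "ip g (\<lambda>x. 1) = gp y (\<lambda>x. 1)" using y3[OF o] by simp
      also have "\<dots> = 0"
      proof (rule integral_eq_zero_AE)
        show "AE x in lebesgue_on \<Omega>. grad \<Omega> y x \<bullet> grad \<Omega> (\<lambda>x. 1) x = 0"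
          using grad_const_AE[OF \<Omega>, of 1] by eventually_elim simp
      qed
      finally show ?thesis by simp
    qed simp
    moreover have "ip (\<lambda>x. 1 * y x + (- c) * 1) g = 1 * ip y g + (- c) * ip (\<lambda>x. 1) g"
      by (rule ip_lincomb[OF H1_imp_L2[OF yH] H1_imp_L2[OF one] gL])
    ultimately have "ip g y = ip g (\<lambda>x. y x - c)" by (simp add: mult.commute)
    then have "?n\<^sup>2 = ip g (\<lambda>x. y x - c)"
      using y3[OF y(1)] gp_self[of y] by simp
    also have "\<dots> \<le> nrm g * nrm (\<lambda>x. y x - c)"
      using L2_Cauchy_Schwarz_real[OF gL cL] by linarith
    also have "\<dots> \<le> nrm g * (C * ?n + \<epsilon>)"
      using c(1) by (intro mult_left_mono) auto
    finally show ?thesis by (simp only: distrib_left)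
  qed
  have "?n\<^sup>2 \<le> nrm g * (C * ?n)"
  proof (rule field_le_epsilon)
    fix e :: real assume e: "e > 0"
    let ?\<epsilon> = "e / (nrm g + 1)"
    have gp1: "0 < nrm g + 1" using L2_norm_nonneg[of \<Omega> g] by linarith
    have "nrm g * ?\<epsilon> \<le> (nrm g + 1) * ?\<epsilon>"
      using e gp1 by (intro mult_right_mono) auto
    also have "\<dots> = e" using gp1 by simp
    finally show "?n\<^sup>2 \<le> nrm g * (C * ?n) + e"
      using le[of ?\<epsilon>] e gp1 by simp
  qed
  then have "?n * ?n \<le> (C * nrm g) * ?n" by (simp add: power2_eq_square mult_ac)
  then have "?n \<le> C * nrm g"
    using C(1) L2_norm_nonneg[of \<Omega> "grad \<Omega> y"] by (cases "?n = 0") (auto simp: mult_le_cancel_right)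
  also have "\<dots> \<le> C * (\<eta>p * nrm p0 + \<nu>p * nrm p1)"
    using data_L2(2) C(1) unfolding g_def by (rule mult_left_mono)
  finally show ?thesis by (simp only: u)
qed

end

lemma max_over_le:
  assumes "finite A" "0 \<le> c" "\<And>a. a \<in> A \<Longrightarrow> g a \<le> c"
  shows "max_over A g \<le> c"
  using assms by (auto simp: max_over_def)

lemma one_in_P1: "(\<lambda>x. 1) \<in> P1 \<Omega> M"
  unfolding P1_def by (auto intro!: exI[of _ 0] exI[of _ 1])

theorem theorem3p2:
  fixes \<Omega> \<Gamma>D \<Gamma>N :: "'a::euclidean_space set"
    and T \<nu>m \<nu>p cinv :: real
    and p0 p1 \<eta> :: "'a \<Rightarrow> real"
    and f F :: "real \<Rightarrow> 'a \<Rightarrow> real"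
    and H :: "real set" and \<T> :: "real \<Rightarrow> 'a set set"
  assumes dim: "DIM('a) \<ge> 2"
    and domain: "polyhedral_lipschitz_domain \<Omega>"
    and \<Gamma>D: "\<Gamma>D \<subset> frontier \<Omega>" "closed \<Gamma>D"
    and \<Gamma>N: "\<Gamma>N = frontier \<Omega> - \<Gamma>D" "hausdorff_measure (real (DIM('a) - 1)) \<Gamma>N \<noteq> 0"
    and T: "T > 0"
    and p0: "p0 \<in> H1D \<Omega> \<Gamma>D"
    and p1: "p1 \<in> Linfty \<Omega>"
    and f: "f \<in> L1_L2 {0..T} \<Omega>"
    and F: "\<And>t. t \<in> {0..T} \<Longrightarrow> has_L2_bochner_integral \<Omega> {0..t} f (F t)"
    and \<eta>: "\<eta> \<in> Linfty \<Omega>" "AE x in lebesgue_on \<Omega>. 0 \<le> \<eta> x"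
    and \<nu>: "0 < \<nu>m" "\<nu>m \<le> \<nu>p"
    and H: "H \<subseteq> {0<..}"
    and mesh: "\<And>h. h \<in> H \<Longrightarrow> mesh \<Omega> \<Gamma>D (\<T> h) h"
    and quasi_uniform: "quasi_uniform H \<T>"
    and P1D: "\<And>h. h \<in> H \<Longrightarrow> P1D \<Omega> \<Gamma>D (\<T> h) = P1 \<Omega> (\<T> h) \<inter> H1D \<Omega> \<Gamma>D"
    and cinv: "cinv > 0"
      "\<And>h q. h \<in> H \<Longrightarrow> q \<in> P1 \<Omega> (\<T> h) \<Longrightarrow> L2_norm \<Omega> (grad \<Omega> q) \<le> cinv / h * L2_norm \<Omega> q"
  shows "\<exists>C>0. \<forall>h\<in>H. \<forall>N\<ge>1. let \<tau> = T / real N in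
           \<tau> / h \<le> sqrt \<nu>m / (sqrt 2 * cinv) \<longrightarrow>
           (\<forall>\<nu>\<in>Vad \<Omega> \<nu>m \<nu>p. \<forall>p u. leapfrog_solution \<Omega> \<Gamma>D (\<T> h) \<eta> p0 p1 F \<tau> N \<nu> p u \<longrightarrow>
              max_over {0..N-1} (\<lambda>l. L2_norm \<Omega> (diff_p \<tau> p l))
                + max_over {1..N-1} (\<lambda>l. L2_norm \<Omega> (diff_u \<tau> u l))
                + max_over {1..N-1} (\<lambda>l. L2_norm \<Omega> (grad \<Omega> (p l))) \<le> C \<and>
              max_over {0..N} (\<lambda>l. L2_norm \<Omega> (p l))
                + max_over {0..N-1} (\<lambda>l. L2_norm \<Omega> (u l)) \<le> C)"
proof -
  have \<Omega>: "open \<Omega>" "bounded \<Omega>" using domain by (auto simp: polyhedral_lipschitz_domain_def)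
  have \<Omega>l: "\<Omega> \<in> lmeasurable" using \<Omega> by (simp add: lmeasurable_open)
  obtain cp where cp: "AE x in lebesgue_on \<Omega>. \<bar>p1 x\<bar> \<le> cp" "p1 \<in> borel_measurable (lebesgue_on \<Omega>)"
    using p1 by (auto simp: Linfty_def)
  have p1L: "p1 \<in> L2 \<Omega>" by (rule bounded_in_L2[OF cp(2) _ \<Omega>l]) (use cp(1) in simp)
  obtain c\<eta> where c\<eta>: "AE x in lebesgue_on \<Omega>. \<bar>\<eta> x\<bar> \<le> c\<eta>" "\<eta> \<in> borel_measurable (lebesgue_on \<Omega>)"
    using \<eta>(1) by (auto simp: Linfty_def)
  define \<eta>p where "\<eta>p = max c\<eta> 0"
  have \<eta>b: "AE x in lebesgue_on \<Omega>. 0 \<le> \<eta> x \<and> \<eta> x \<le> \<eta>p"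
    using c\<eta>(1) \<eta>(2) by eventually_elim (auto simp: \<eta>p_def)
  have p0H: "p0 \<in> H1 \<Omega>" using p0 by (simp add: H1D_def)
  obtain \<phi> B where \<phi>: "\<And>s t. 0 \<le> s \<Longrightarrow> s \<le> t \<Longrightarrow> t \<le> T \<Longrightarrow> L2_norm \<Omega> (\<lambda>x. F t x - F s x) \<le> \<phi> t - \<phi> s"
    "\<And>t. 0 \<le> t \<Longrightarrow> t \<le> T \<Longrightarrow> L2_norm \<Omega> (F t) \<le> \<phi> t" "\<And>t. 0 \<le> t \<Longrightarrow> t \<le> T \<Longrightarrow> 0 \<le> \<phi> t \<and> \<phi> t \<le> B"
    using bochner_primitive_variation[OF f less_imp_le[OF T] F] by blast
  obtain Cp where Cp: "Cp \<ge> 0"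
    "\<And>v \<epsilon>. v \<in> H1D \<Omega> \<Gamma>D \<Longrightarrow> \<epsilon> > 0 \<Longrightarrow> \<exists>c. L2_norm \<Omega> (\<lambda>x. v x - c) \<le> Cp * L2_norm \<Omega> (grad \<Omega> v) + \<epsilon> \<and>
        ((\<lambda>x. 1) \<notin> H1D \<Omega> \<Gamma>D \<longrightarrow> c = 0)"
    using poincare_H1D[OF domain, of \<Gamma>D] by blast
  define P where "P = H1_norm \<Omega> p0"
  have P: "0 \<le> P" unfolding P_def using H1_norm_ge(1)[OF p0H] L2_norm_nonneg[of \<Omega> p0] by linarith
  have B: "0 \<le> B" using \<phi>(3)[of 0] T by simp
  define A0 where "A0 = (B + \<eta>p * (L2_norm \<Omega> p0 + P) + \<nu>p * L2_norm \<Omega> p1) / \<nu>m"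
  have \<eta>p: "0 \<le> \<eta>p" by (simp add: \<eta>p_def)
  have A0: "0 \<le> A0" using B \<eta>p P \<nu> by (simp add: A0_def)
  define E where "E = \<nu>p * A0\<^sup>2 + P\<^sup>2 + sqrt \<nu>m * A0 * P"
  have E: "0 \<le> E" using A0 P \<nu> by (simp add: E_def)
  define A where "A = 1 + (E + 2 * B) / (7/8 * \<nu>m)"
  have A: "0 \<le> A" using E B \<nu> by (simp add: A_def)
  define G where "G = sqrt (E + 2 * A * B) + sqrt \<nu>m * A"
  have G: "0 \<le> G" using E A B \<nu> by (simp add: G_def)
  define U where "U = Cp * (\<eta>p * L2_norm \<Omega> p0 + \<nu>p * L2_norm \<Omega> p1)"
  have U: "0 \<le> U" using Cp(1) \<eta>p \<nu> by (simp add: U_def)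
  define C where "C = (A + G + G) + ((P + T * A) + (U + T * G)) + 1"
  have TA: "0 \<le> T * A" "0 \<le> T * G" using T A G by auto
  have C: "0 < C" using A G P U TA by (simp add: C_def)
  have main: "max_over {0..N-1} (\<lambda>l. L2_norm \<Omega> (diff_p \<tau> p l))
                + max_over {1..N-1} (\<lambda>l. L2_norm \<Omega> (diff_u \<tau> u l))
                + max_over {1..N-1} (\<lambda>l. L2_norm \<Omega> (grad \<Omega> (p l))) \<le> C \<and>
              max_over {0..N} (\<lambda>l. L2_norm \<Omega> (p l))
                + max_over {0..N-1} (\<lambda>l. L2_norm \<Omega> (u l)) \<le> C"
    if h: "h \<in> H" and N: "1 \<le> N" and \<tau>: "\<tau> = T / real N" and cfl: "\<tau> / h \<le> sqrt \<nu>m / (sqrt 2 * cinv)"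
      and \<nu>': "\<nu>' \<in> Vad \<Omega> \<nu>m \<nu>p" and sol: "leapfrog_solution \<Omega> \<Gamma>D (\<T> h) \<eta> p0 p1 F \<tau> N \<nu>' p u"
    for h N \<tau> \<nu>' p u
  proof -
    have h0: "h > 0" using h H by auto
    have \<tau>0: "0 < \<tau>" using T N by (simp add: \<tau>)
    have time: "real l * \<tau> \<le> T" if "l \<le> N" for l
      using that T N by (simp add: \<tau> field_simps)
    have half: "0 \<le> real l * \<tau> + \<tau> / 2" "real l * \<tau> + \<tau> / 2 \<le> T" if "l < N" for l
      using time[of "Suc l"] that \<tau>0 by (auto simp: algebra_simps)
    have X: "P1D \<Omega> \<Gamma>D (\<T> h) = P1 \<Omega> (\<T> h) \<inter> H1D \<Omega> \<Gamma>D" by (rule P1D[OF h])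
    interpret leapfrog \<Omega> \<Gamma>D "\<T> h" \<eta> p0 p1 \<nu>' F \<tau> "cinv / h" \<nu>m \<nu>p \<eta>p N p u
    proof
      show "P1D \<Omega> \<Gamma>D (\<T> h) \<subseteq> H1 \<Omega>" unfolding X by (auto simp: H1D_def)
      show "L2_norm \<Omega> (grad \<Omega> q) \<le> cinv / h * L2_norm \<Omega> q" if "q \<in> P1D \<Omega> \<Gamma>D (\<T> h)" for q
        using cinv(2)[OF h] that unfolding X by blast
      show "\<tau> * (cinv / h) \<le> sqrt \<nu>m / sqrt 2"
        using mult_right_mono[OF cfl, of cinv] cinv(1) by simp
      show "F (real l * \<tau> + \<tau> / 2) \<in> L2 \<Omega>" if "l < N" for l
        using F[of "real l * \<tau> + \<tau> / 2"] half[OF that] by (simp add: has_L2_bochner_integral_def)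
      show "\<nu>' \<in> borel_measurable (lebesgue_on \<Omega>)" "AE x in lebesgue_on \<Omega>. \<nu>m \<le> \<nu>' x \<and> \<nu>' x \<le> \<nu>p"
        using \<nu>' by (auto simp: Vad_def L2_def)
    qed (use \<Omega> \<tau>0 h0 cinv(1) \<nu> c\<eta>(2) \<eta>b \<eta>p p0H p1L N sol in auto)
    have "\<nu>m * L2_norm \<Omega> (\<delta> 0) \<le> B + \<eta>p * (L2_norm \<Omega> p0 + P) + \<nu>p * L2_norm \<Omega> p1"
    proof -
      have "L2_norm \<Omega> (FF 0) \<le> B"
        using \<phi>(2,3)[OF half[of 0]] N by fastforce
      then show ?thesis using initial_\<delta>_bound unfolding P_def by linarith
    qed
    then have "L2_norm \<Omega> (\<delta> 0) \<le> A0" using \<nu>m(1) by (simp add: A0_def pos_le_divide_eq mult.commute)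
    from energy_0_bound[OF this] have E0: "energy 0 \<le> E" by (simp add: E_def P_def)
    define W where "W l = \<phi> (real l * \<tau> + \<tau> / 2)" for l
    have W: "0 \<le> W l \<and> W l \<le> B" if "l < N" for l
      unfolding W_def by (rule \<phi>(3)[OF half[OF that]])
    have WF: "L2_norm \<Omega> (\<lambda>x. FF (Suc l) x - FF l x) \<le> W (Suc l) - W l" if "Suc l < N" for l
      unfolding W_def using \<tau>0 half(1)[of l] half(2)[OF that] that
      by (intro \<phi>(1)) (auto simp: algebra_simps)
    note eb = energy_bounds[OF E0 E W WF A_def]
    have bg: "L2_norm \<Omega> (grad \<Omega> (p l)) \<le> G" if "l < N" for l
      unfolding G_def by (rule grad_p_bound[OF that eb[OF _ _ that]])
    have bp: "L2_norm \<Omega> (p l) \<le> P + T * A" if "l \<le> N" for l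
      using p_bound[OF eb(1) that] mult_right_mono[OF time[OF that] A] unfolding P_def by linarith
    have "L2_norm \<Omega> (u 0) \<le> U"
      unfolding U_def
    proof (rule initial_u_bound[OF Cp(1)])
      fix v and \<epsilon> :: real assume v: "v \<in> P1D \<Omega> \<Gamma>D (\<T> h)" "\<epsilon> > 0"
      have "(\<lambda>x. 1) \<in> P1D \<Omega> \<Gamma>D (\<T> h) \<longleftrightarrow> (\<lambda>x. 1) \<in> H1D \<Omega> \<Gamma>D"
        using X one_in_P1[of \<Omega> "\<T> h"] by blast
      moreover have "v \<in> H1D \<Omega> \<Gamma>D" using v(1) X by blast
      ultimately show "\<exists>c. L2_norm \<Omega> (\<lambda>x. v x - c) \<le> Cp * L2_norm \<Omega> (grad \<Omega> v) + \<epsilon> \<and>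
          ((\<lambda>x. 1) \<notin> P1D \<Omega> \<Gamma>D (\<T> h) \<longrightarrow> c = 0)"
        using Cp(2)[OF _ v(2)] by simp
    qed
    then have bu: "L2_norm \<Omega> (u l) \<le> U + T * G" if "l < N" for l
      using u_bound[OF bg that] mult_right_mono[OF time[OF less_imp_le[OF that]] G] by linarith
    have "max_over {0..N-1} (\<lambda>l. L2_norm \<Omega> (\<delta> l)) \<le> A"
      by (rule max_over_le[OF _ A]) (use eb(1) N in auto)
    moreover have "max_over {1..N-1} (\<lambda>l. L2_norm \<Omega> (diff_u \<tau> u l)) \<le> G"
      by (rule max_over_le[OF _ G]) (use bg diff_u_norm in auto)
    moreover have "max_over {1..N-1} (\<lambda>l. L2_norm \<Omega> (grad \<Omega> (p l))) \<le> G"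
      by (rule max_over_le[OF _ G]) (use bg in auto)
    moreover have "max_over {0..N} (\<lambda>l. L2_norm \<Omega> (p l)) \<le> P + T * A"
      by (rule max_over_le) (use bp P TA in auto)
    moreover have "max_over {0..N-1} (\<lambda>l. L2_norm \<Omega> (u l)) \<le> U + T * G"
      by (rule max_over_le) (use bu U TA N in auto)
    ultimately show ?thesis
      using A G P U TA unfolding C_def by linarith
  qed
  show ?thesis
    unfolding Let_def by (intro exI[of _ C] conjI C ballI allI impI main[THEN conjunct1] main[THEN conjunct2]) (rule refl | assumption)+
qed

end
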